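(* Let $d\ge2$ and let $\Delta$ be a pure $(d-1)$-dimensional simplicial forest. Then \[\beta_{i,i+d}(\mathcal{I}(\Delta))=\begin{cases}|\mathcal{F}(\Delta)| & \text{if } i=0,\\[2pt] \displaystyle\sum_{G\in\mathcal{A}(\Delta)}\binom{\deg_\Delta(G)}{i+1} & \text{if } i\ge1.\end{cases}\]
   Context: A simplicial complex $\Delta$ on $\{x_1,\dots,x_n\}$ is a collection of subsets closed under taking subsets and containing all $\{x_i\}$; facets are its maximal faces, and $\mathcal{F}(\Delta)$ is the set of facets. $\Delta$ is pure $(d-1)$-dimensional if every facet has exactly $d$ elements. The facet ideal is $\mathcal{I}(\Delta)=(\{\prod_{x\in F}x\mid F\in\mathcal{F}(\Delta)\})\subseteq R=k[x_1,\dots,x_n]$, $k$ an arbitrary field, and $\beta_{i,j}(I)=\dim_k\mathrm{Tor}_i^R(I,k)_j$. $\mathcal{A}(\Delta)$ is the set of $(d-2)$-dimensional faces of $\Delta$ (faces with $d-1$ elements), and for $G\in\mathcal{A}(\Delta)$, $\deg_\Delta(G)=|\{F\in\mathcal{F}(\Delta)\mid G\subseteq F\}|$. A subcomplex of $\Delta$ means a simplicial complex whose facet set is a subset of $\mathcal{F}(\Delta)$. Two facets $F,G$ are connected if there is a chain of facets $F=F_0,\dots,F_m=G$ with $F_i\cap F_{i+1}\ne\emptyset$ for all $i$; a complex is connected if any two of its facets are connected. A facet $F$ of $\Delta$ is a leaf if either $F$ is the only facet, or there is a facet $G\neq F$ with $F\cap F'\subseteq F\cap G$ for every facet $F'\ne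 F$. $\Delta$ is a tree if it is connected and every nonempty connected subcomplex of $\Delta$ (including $\Delta$) has a leaf; $\Delta$ is a forest if every connected component of $\Delta$ is a tree. *)

theory Defs
  imports Complex_Main "HOL-Library.Poly_Mapping" "HOL-Library.Function_Algebras"
begin

section \<open>Simplicial complexes, trees and forests\<close>

definition simplicial_complex :: "'v set \<Rightarrow> 'v set set \<Rightarrow> bool" where
  "simplicial_complex V \<Delta> \<longleftrightarrow>
     \<Delta> \<subseteq> Pow V \<and> (\<forall>F\<in>\<Delta>. \<forall>G. G \<subseteq> F \<longrightarrow> G \<in> \<Delta>) \<and> (\<forall>v\<in>V. {v} \<in> \<Delta>)"

definition facets :: "'v set set \<Rightarrow> 'v set set" where
  "facets \<Delta> = {F \<in> \<Delta>. \<forall>G\<in>\<Delta>. F \<subseteq> G \<longrightarrow> G = F}"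

text \<open>The parameter \<open>d\<close> is the number of vertices of a facet, so \<open>pure_complex d\<close> means
  ``pure of dimension \<open>d - 1\<close>'' and \<open>codim1_faces d \<Delta>\<close> consists of the faces of
  dimension \<open>d - 2\<close>.\<close>

definition pure_complex :: "nat \<Rightarrow> 'v set set \<Rightarrow> bool" where
  "pure_complex d \<Delta> \<longleftrightarrow> (\<forall>F\<in>facets \<Delta>. card F = d)"

definition codim1_faces :: "nat \<Rightarrow> 'v set set \<Rightarrow> 'v set set" where
  "codim1_faces d \<Delta> = {G \<in> \<Delta>. card G = d - 1}"

definition face_degree :: "'v set set \<Rightarrow> 'v set \<Rightarrow> nat" where
  "face_degree \<Delta> G = card {F \<in> facets \<Delta>. G \<subseteq> F}"

text \<open>A subcomplex lives on its own vertex set \<open>\<Union>\<Gamma>\<close>; it is determined by a set of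
  facets of \<open>\<Delta>\<close>.\<close>

definition facet_subcomplex :: "'v set set \<Rightarrow> 'v set set \<Rightarrow> bool" where
  "facet_subcomplex \<Gamma> \<Delta> \<longleftrightarrow> simplicial_complex (\<Union>\<Gamma>) \<Gamma> \<and> facets \<Gamma> \<subseteq> facets \<Delta>"

definition facets_connected :: "'v set set \<Rightarrow> 'v set \<Rightarrow> 'v set \<Rightarrow> bool" where
  "facets_connected \<Delta> F G \<longleftrightarrow>
     F \<in> facets \<Delta> \<and> G \<in> facets \<Delta> \<and>
     (F, G) \<in> {(A, B). A \<in> facets \<Delta> \<and> B \<in> facets \<Delta> \<and> A \<inter> B \<noteq> {}}\<^sup>*"

definition connected_complex :: "'v set set \<Rightarrow> bool" where
  "connected_complex \<Delta> \<longleftrightarrow> (\<forall>F\<in>facets \<Delta>. \<forall>G\<in>facets \<Delta>. facets_connected \<Delta> F G)"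

definition leaf :: "'v set set \<Rightarrow> 'v set \<Rightarrow> bool" where
  "leaf \<Delta> F \<longleftrightarrow> F \<in> facets \<Delta> \<and>
     (facets \<Delta> = {F} \<or>
      (\<exists>G\<in>facets \<Delta>. G \<noteq> F \<and> (\<forall>F'\<in>facets \<Delta>. F' \<noteq> F \<longrightarrow> F \<inter> F' \<subseteq> F \<inter> G)))"

definition simplicial_tree :: "'v set set \<Rightarrow> bool" where
  "simplicial_tree \<Delta> \<longleftrightarrow> connected_complex \<Delta> \<and>
     (\<forall>\<Gamma>. facet_subcomplex \<Gamma> \<Delta> \<and> facets \<Gamma> \<noteq> {} \<and> connected_complex \<Gamma> \<longrightarrow> (\<exists>F. leaf \<Gamma> F))"

definition complex_component :: "'v set set \<Rightarrow> 'v set set \<Rightarrow> bool" where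
  "complex_component \<Gamma> \<Delta> \<longleftrightarrow>
     facet_subcomplex \<Gamma> \<Delta> \<and> facets \<Gamma> \<noteq> {} \<and> connected_complex \<Gamma> \<and>
     (\<forall>\<Gamma>'. facet_subcomplex \<Gamma>' \<Delta> \<and> connected_complex \<Gamma>' \<and> \<Gamma> \<subseteq> \<Gamma>' \<longrightarrow> \<Gamma>' = \<Gamma>)"

definition simplicial_forest :: "'v set set \<Rightarrow> bool" where
  "simplicial_forest \<Delta> \<longleftrightarrow> (\<forall>\<Gamma>. complex_component \<Gamma> \<Delta> \<longrightarrow> simplicial_tree \<Gamma>)"


section \<open>The polynomial ring and the facet ideal\<close>

text \<open>\<open>('v, 'k) mpoly\<close> is the polynomial ring over \<open>'k\<close> with one variable for each element of
  \<open>'v\<close>: finitely supported functions from exponent vectors to coefficients, with the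
  convolution product.\<close>

type_synonym ('v, 'k) mpoly = "('v \<Rightarrow>\<^sub>0 nat) \<Rightarrow>\<^sub>0 'k"

definition var :: "'v \<Rightarrow> ('v, 'k::comm_ring_1) mpoly" where
  "var x = Poly_Mapping.single (Poly_Mapping.single x 1) 1"

definition exp_degree :: "('v \<Rightarrow>\<^sub>0 nat) \<Rightarrow> nat" where
  "exp_degree m = (\<Sum>x\<in>Poly_Mapping.keys m. Poly_Mapping.lookup m x)"

text \<open>The zero polynomial is homogeneous of every degree, and it is the only polynomial that is
  homogeneous of a negative degree.\<close>

definition homogeneous :: "int \<Rightarrow> ('v, 'k::zero) mpoly \<Rightarrow> bool" where
  "homogeneous e p \<longleftrightarrow> (\<forall>m\<in>Poly_Mapping.keys p. int (exp_degree m) = e)"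

text \<open>An ideal is a submodule of the ring regarded as a module over itself.\<close>

definition facet_ideal :: "'v set set \<Rightarrow> ('v, 'k::field) mpoly set" where
  "facet_ideal \<Delta> = module.span (*) ((\<lambda>F. \<Prod>x\<in>F. var x) ` facets \<Delta>)"


section \<open>Graded Betti numbers\<close>

text \<open>A sequence of graded free modules of finite rank with maps
  \<open>\<cdots> \<rightarrow> F\<^sub>2 \<rightarrow> F\<^sub>1 \<rightarrow> F\<^sub>0 \<rightarrow> R\<close> given by matrices. The module \<open>F\<^sub>i\<close> has a basis \<open>e\<^sub>b\<close>, \<open>b < rk C i\<close>, with \<open>e\<^sub>b\<close> in degree
  \<open>dg C i b\<close>. The entry \<open>dmat C i a b\<close> is the coefficient at \<open>e\<^sub>a\<close> of the image
  of \<open>e\<^sub>b\<close> under the map from \<open>F\<^bsub>i+1\<^esub>\<close> to \<open>F\<^sub>i\<close>, and \<open>aug C b\<close> is the image in \<open>R\<close> of the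
  basis element \<open>e\<^sub>b\<close> of \<open>F\<^sub>0\<close>.\<close>

record (overloaded) ('v, 'k) free_complex =
  rk :: "nat \<Rightarrow> nat"
  dg :: "nat \<Rightarrow> nat \<Rightarrow> int"
  aug :: "nat \<Rightarrow> ('v, 'k) mpoly"
  dmat :: "nat \<Rightarrow> nat \<Rightarrow> nat \<Rightarrow> ('v, 'k) mpoly"

text \<open>Coordinate vectors supported on an index set, and multiplication of such a vector by a
  matrix with rows \<open>I\<close> and columns \<open>J\<close>.\<close>

definition coord_vecs :: "nat set \<Rightarrow> (nat \<Rightarrow> 'a::zero) set" where
  "coord_vecs I = {v. \<forall>b. b \<notin> I \<longrightarrow> v b = 0}"

definition mat_apply ::
    "nat set \<Rightarrow> nat set \<Rightarrow> (nat \<Rightarrow> nat \<Rightarrow> 'a::comm_ring_1) \<Rightarrow> (nat \<Rightarrow> 'a) \<Rightarrow> nat \<Rightarrow> 'a" where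
  "mat_apply I J A v = (\<lambda>a. if a \<in> I then \<Sum>b\<in>J. A a b * v b else 0)"

definition free_mod :: "('v, 'k::field) free_complex \<Rightarrow> nat \<Rightarrow> (nat \<Rightarrow> ('v, 'k) mpoly) set" where
  "free_mod C i = coord_vecs {..<rk C i}"

definition diff_map ::
    "('v, 'k::field) free_complex \<Rightarrow> nat \<Rightarrow> (nat \<Rightarrow> ('v, 'k) mpoly) \<Rightarrow> nat \<Rightarrow> ('v, 'k) mpoly" where
  "diff_map C i = mat_apply {..<rk C i} {..<rk C (Suc i)} (dmat C i)"

definition aug_map ::
    "('v, 'k::field) free_complex \<Rightarrow> (nat \<Rightarrow> ('v, 'k) mpoly) \<Rightarrow> ('v, 'k) mpoly" where
  "aug_map C v = (\<Sum>b<rk C 0. aug C b * v b)"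

definition graded_free_resolution ::
    "('v, 'k::field) mpoly set \<Rightarrow> ('v, 'k) free_complex \<Rightarrow> bool" where
  "graded_free_resolution I C \<longleftrightarrow>
     (\<forall>b<rk C 0. homogeneous (dg C 0 b) (aug C b)) \<and>
     (\<forall>i. \<forall>a<rk C i. \<forall>b<rk C (Suc i). homogeneous (dg C (Suc i) b - dg C i a) (dmat C i a b)) \<and>
     aug_map C ` free_mod C 0 = I \<and>
     diff_map C 0 ` free_mod C 1 = {v \<in> free_mod C 0. aug_map C v = 0} \<and>
     (\<forall>i. diff_map C (Suc i) ` free_mod C (Suc (Suc i)) =
          {v \<in> free_mod C (Suc i). diff_map C i v = (\<lambda>_. 0)})"

text \<open>The complex \<open>F \<otimes>\<^sub>R k\<close>. The residue field \<open>k = R/(x\<^sub>1, \<dots>, x\<^sub>n)\<close> is an \<open>R\<close>-module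
  through the constant coefficient, and it is concentrated in degree \<open>0\<close>. Hence \<open>F\<^sub>i \<otimes>\<^sub>R k\<close>
  is the \<open>k\<close>-vector space with basis \<open>e\<^sub>b\<close>, \<open>b < rk C i\<close>, its degree \<open>j\<close> component is spanned by
  the \<open>e\<^sub>b\<close> of degree \<open>j\<close>, and the maps are given by the constant coefficients of the matrices.
  The augmentation to the resolved ideal is not part of this complex.\<close>

definition tens_mod :: "('v, 'k::field) free_complex \<Rightarrow> nat \<Rightarrow> int \<Rightarrow> (nat \<Rightarrow> 'k) set" where
  "tens_mod C i j = coord_vecs {b. b < rk C i \<and> dg C i b = j}"

definition tens_diff :: "('v, 'k::field) free_complex \<Rightarrow> nat \<Rightarrow> (nat \<Rightarrow> 'k) \<Rightarrow> nat \<Rightarrow> 'k" where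
  "tens_diff C i = mat_apply {..<rk C i} {..<rk C (Suc i)} (\<lambda>a b. Poly_Mapping.lookup (dmat C i a b) 0)"

definition tens_cycles :: "('v, 'k::field) free_complex \<Rightarrow> nat \<Rightarrow> int \<Rightarrow> (nat \<Rightarrow> 'k) set" where
  "tens_cycles C i j =
     (case i of 0 \<Rightarrow> tens_mod C 0 j
      | Suc i' \<Rightarrow> {v \<in> tens_mod C (Suc i') j. tens_diff C i' v = (\<lambda>_. 0)})"

definition tens_boundaries :: "('v, 'k::field) free_complex \<Rightarrow> nat \<Rightarrow> int \<Rightarrow> (nat \<Rightarrow> 'k) set" where
  "tens_boundaries C i j = tens_diff C i ` tens_mod C (Suc i) j"

definition kdim :: "(nat \<Rightarrow> 'k::field) set \<Rightarrow> nat" where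
  "kdim = vector_space.dim (\<lambda>c v b. c * v b)"

text \<open>\<open>\<beta>\<^bsub>i,j\<^esub>(I) = dim\<^sub>k Tor\<^sub>i\<^sup>R(I,k)\<^sub>j\<close>, where \<open>Tor\<^sub>i\<^sup>R(I,k)\<close> is the \<open>i\<close>-th homology of
  \<open>F \<otimes>\<^sub>R k\<close> for a graded free resolution \<open>F\<close> of \<open>I\<close>. Up to isomorphism it does not depend on
  the choice of \<open>F\<close>, so an arbitrary one is taken. All spaces are finite-dimensional and the
  boundaries form a subspace of the cycles, so the dimension of the homology is a difference of
  dimensions and the subtraction does not truncate.\<close>

definition tor_dim :: "('v, 'k::field) free_complex \<Rightarrow> nat \<Rightarrow> int \<Rightarrow> nat" where
  "tor_dim C i j = kdim (tens_cycles C i j) - kdim (tens_boundaries C i j)"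

definition graded_betti :: "('v, 'k::field) mpoly set \<Rightarrow> nat \<Rightarrow> int \<Rightarrow> nat" where
  "graded_betti I i j = tor_dim (SOME C. graded_free_resolution I C) i j"

end

theory Submission
  imports Defs
begin

text \<open>Since the Koszul complex \<open>K\<close> resolves the residue field, a staircase argument in the double
  complex \<open>K \<otimes> F\<close> identifies the homology of \<open>F \<otimes> k\<close>, for any graded free resolution \<open>F\<close> of \<open>I\<close>,
  with the homology of \<open>K \<otimes> I\<close>. As \<open>I\<close> is generated in degree \<open>d\<close>, the part of degree \<open>i + d\<close> is the
  kernel of \<open>K\<^sub>i \<otimes> I\<^sub>d \<rightarrow> K\<^bsub>i-1\<^esub> \<otimes> I\<^bsub>d+1\<^esub>\<close>. For a codimension one face \<open>A\<close> and a set \<open>S\<close> of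
  \<open>i + 1\<close> vertices \<open>x\<close> for which \<open>A \<union> {x}\<close> is a facet, the Koszul boundary of \<open>e\<^sub>S\<close> times the monomial of
  \<open>A\<close> lies in this kernel. For a forest and \<open>i \<ge> 1\<close> these elements form a basis: a leaf among the
  facets occurring in a cycle singles out one of them, which can be subtracted without enlarging the
  support, and no three facets lie in a common set of \<open>d + 1\<close> vertices, which gives independence.
  A finite graded free resolution exists by the Taylor complex; it and the Koszul complex
  are in each multidegree the chain complex of a full simplex.\<close>

section \<open>Squarefree monomials and homogeneous parts\<close>

text \<open>\<open>graded_betti\<close> takes an unspecified resolution, which need not be minimal,
  so nothing can be read off its matrices; its homology has to be carried to a place where the
  resolution no longer appears. What is carried is a family of representatives of a basis modulo
  boundaries. Dimensions are counted only in the last space, which consists of coordinate vectors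
  over k. The triangle with facets xy, yz, xz shows what a forest must exclude: the sum for i = 1 is
  3, but the linear syzygies have dimension 2, because the elements attached to the three vertices
  are dependent. Leaves forbid such configurations, and they also drive the proof that the elements
  generate. The case i = 0 is separate because each facet would be counted d times, once for each of
  its codimension one faces. There the map out of the strand is the constant coefficient, which
  vanishes, and the generators themselves form the basis.\<close>

abbreviation coeff_at :: "('v, 'k::zero) mpoly \<Rightarrow> ('v \<Rightarrow>\<^sub>0 nat) \<Rightarrow> 'k" where
  "coeff_at \<equiv> Poly_Mapping.lookup"

definition ind_exp :: "'v set \<Rightarrow> ('v::finite \<Rightarrow>\<^sub>0 nat)" where
  "ind_exp A = Abs_poly_mapping (\<lambda>x. if x \<in> A then 1 else 0)"

definition mon :: "'v::finite set \<Rightarrow> ('v, 'k::comm_ring_1) mpoly" where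
  "mon A = Poly_Mapping.single (ind_exp A) 1"

lemma lookup_ind_exp: "Poly_Mapping.lookup (ind_exp A) x = (if x \<in> A then 1 else 0)"
  unfolding ind_exp_def by simp

lemma keys_ind_exp [simp]: "Poly_Mapping.keys (ind_exp A) = A"
  by (auto simp: in_keys_iff lookup_ind_exp split: if_splits)

lemma ind_exp_inject [simp]: "ind_exp A = ind_exp B \<longleftrightarrow> A = B"
  by (metis keys_ind_exp)

lemma ind_exp_empty [simp]: "ind_exp {} = 0"
  by (rule poly_mapping_eqI) (simp add: lookup_ind_exp)

lemma ind_exp_union: "A \<inter> B = {} \<Longrightarrow> ind_exp (A \<union> B) = ind_exp A + ind_exp B"
  by (rule poly_mapping_eqI) (auto simp: lookup_ind_exp lookup_add)

lemma exp_degree_UNIV: "exp_degree (m :: 'v::finite \<Rightarrow>\<^sub>0 nat) = (\<Sum>x\<in>UNIV. Poly_Mapping.lookup m x)"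
  unfolding exp_degree_def by (rule sum.mono_neutral_left) (auto simp: in_keys_iff)

lemma exp_degree_add: "exp_degree (m + n :: 'v::finite \<Rightarrow>\<^sub>0 nat) = exp_degree m + exp_degree n"
  by (simp add: exp_degree_UNIV lookup_add sum.distrib)

lemma exp_degree_ind: "exp_degree (ind_exp A) = card A"
  unfolding exp_degree_def by (simp add: lookup_ind_exp)

lemma exp_degree_eq_0: "exp_degree (m :: 'v::finite \<Rightarrow>\<^sub>0 nat) = 0 \<longleftrightarrow> m = 0"
proof
  assume "exp_degree m = 0"
  then show "m = 0" by (intro poly_mapping_eqI) (simp add: exp_degree_UNIV)
qed (simp add: exp_degree_UNIV)

lemma ind_exp_dvd:
  assumes "A \<subseteq> Poly_Mapping.keys u"
  obtains m where "u = ind_exp A + m"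
proof
  show "u = ind_exp A + (u - ind_exp A)"
  proof (rule poly_mapping_eqI)
    fix x
    show "Poly_Mapping.lookup u x = Poly_Mapping.lookup (ind_exp A + (u - ind_exp A)) x"
      using assms by (auto simp: lookup_add lookup_minus lookup_ind_exp in_keys_iff)
  qed
qed

lemma keys_ind_exp_add: "Poly_Mapping.keys (ind_exp A + m) = A \<union> Poly_Mapping.keys m"
  by (auto simp: in_keys_iff lookup_add lookup_ind_exp split: if_splits)

lemma mon_empty [simp]: "mon {} = 1"
  by (simp add: mon_def)

lemma mon_union: "A \<inter> B = {} \<Longrightarrow> mon (A \<union> B) = mon A * mon B"
  by (simp add: mon_def mult_single ind_exp_union)

lemma mon_prod: "(\<Prod>x\<in>A. var x) = (mon A :: ('v::finite, 'k::comm_ring_1) mpoly)"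
proof -
  have "finite A" by simp
  then show ?thesis
  proof (induction A rule: finite_induct)
    case (insert x F)
    have "var x = (mon {x} :: ('v, 'k) mpoly)"
      unfolding var_def mon_def
      by (rule arg_cong[where f = "\<lambda>m. Poly_Mapping.single m 1"], rule poly_mapping_eqI)
        (auto simp: lookup_ind_exp lookup_single when_def)
    moreover have "mon (insert x F) = (mon {x} * mon F :: ('v, 'k) mpoly)"
      using mon_union[of "{x}" F] insert by simp
    ultimately show ?case using insert by simp
  qed simp
qed

lemma lookup_mon: "coeff_at (mon A) m = (if m = ind_exp A then 1 else 0)"
  by (auto simp: mon_def lookup_single when_def)

lemma lookup_single_times_add:
  fixes p :: "('v, 'k::comm_ring_1) mpoly"
  shows "coeff_at (Poly_Mapping.single t c * p) (t + s) = c * coeff_at p s"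
proof -
  have "coeff_at (Poly_Mapping.single t c * p) (t + s) =
      (\<Sum>l. coeff_at (Poly_Mapping.single t c) l * (\<Sum>q. coeff_at p q when t + s = l + q))"
    by (rule lookup_mult)
  also have "\<dots> = (\<Sum>l. c * (\<Sum>q. coeff_at p q when t + s = l + q) when t = l)"
    by (rule arg_cong[where f = Sum_any]) (auto simp: lookup_single when_def)
  also have "\<dots> = c * coeff_at p s" by simp
  finally show ?thesis .
qed

lemma lookup_mon_times_add: "coeff_at (mon A * p) (ind_exp A + s) = coeff_at p s"
  unfolding mon_def lookup_single_times_add by simp

lemma keys_mon_times:
  assumes "u \<in> Poly_Mapping.keys (mon A * p)"
  obtains s where "u = ind_exp A + s" "s \<in> Poly_Mapping.keys p"
  using assms keys_mult[of "mon A" p] by (auto simp: mon_def split: if_splits)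

lemma mon_times_eq_0: "mon A * p = 0 \<Longrightarrow> p = 0"
  by (metis lookup_mon_times_add lookup_zero poly_mapping_eqI)

lemma mon_times_cancel: "mon A * p = mon A * q \<Longrightarrow> p = q"
  by (metis lookup_mon_times_add poly_mapping_eqI)

text \<open>Division by a monomial is a shift of exponents; injectivity of the shift keeps the
  support finite.\<close>

lemma mon_dvdE:
  fixes q :: "('v::finite, 'k::comm_ring_1) mpoly"
  assumes "\<And>u. u \<in> Poly_Mapping.keys q \<Longrightarrow> A \<subseteq> Poly_Mapping.keys u"
  obtains p where "q = mon A * p"
proof
  define p where "p = Abs_poly_mapping (\<lambda>m. coeff_at q (ind_exp A + m))"
  have "finite ((\<lambda>m. ind_exp A + m) -` Poly_Mapping.keys q)"
    by (rule finite_vimageI) (auto simp: inj_def)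
  then have fin: "finite {m. coeff_at q (ind_exp A + m) \<noteq> 0}"
    by (simp add: vimage_def in_keys_iff)
  have p: "coeff_at p m = coeff_at q (ind_exp A + m)" for m
    unfolding p_def by (simp add: fin)
  show "q = mon A * p"
  proof (rule poly_mapping_eqI)
    fix u
    show "coeff_at q u = coeff_at (mon A * p) u"
    proof (cases "\<exists>m. u = ind_exp A + m")
      case True
      then show ?thesis using p by (auto simp: lookup_mon_times_add)
    next
      case False
      then have "u \<notin> Poly_Mapping.keys q"
        using assms ind_exp_dvd by metis
      moreover have "u \<notin> Poly_Mapping.keys (mon A * p)"
        using False keys_mon_times by metis
      ultimately show ?thesis by (simp add: in_keys_iff)
    qed
  qed
qed

section \<open>Restriction to a set of exponent vectors\<close>

text \<open>Projection onto the span of the monomials in \<open>P\<close>. It serves both to take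
  homogeneous components and to distribute the terms of a polynomial among generators dividing
  them.\<close>

definition res :: "('v \<Rightarrow>\<^sub>0 nat) set \<Rightarrow> ('v, 'k::comm_ring_1) mpoly \<Rightarrow> ('v, 'k) mpoly" where
  "res P p = Abs_poly_mapping (\<lambda>m. if m \<in> P then coeff_at p m else 0)"

lemma lookup_res: "coeff_at (res P p) m = (if m \<in> P then coeff_at p m else 0)"
proof -
  have "finite {m. (if m \<in> P then coeff_at p m else 0) \<noteq> 0}"
    by (rule finite_subset[OF _ finite_keys[of p]]) (auto simp: in_keys_iff)
  then show ?thesis unfolding res_def by simp
qed

lemma keys_res: "Poly_Mapping.keys (res P p) = Poly_Mapping.keys p \<inter> P"
  by (auto simp: in_keys_iff lookup_res split: if_splits)

lemma res_0 [simp]: "res P 0 = 0"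
  by (rule poly_mapping_eqI) (simp add: lookup_res)

lemma res_add: "res P (p + q) = res P p + res P q"
  by (rule poly_mapping_eqI) (simp add: lookup_res lookup_add)

lemma res_sum: "res P (\<Sum>a\<in>A. f a) = (\<Sum>a\<in>A. res P (f a))"
  by (induction A rule: infinite_finite_induct) (auto simp: res_add)

lemma mpoly_induct [case_names zero single add]:
  fixes p :: "('v, 'k::comm_ring_1) mpoly"
  assumes "P 0" "\<And>m c. P (Poly_Mapping.single m c)" "\<And>p q. P p \<Longrightarrow> P q \<Longrightarrow> P (p + q)"
  shows "P p"
proof (induction p rule: update_induct)
  case const
  show ?case by (rule assms)
next
  case (update f a b)
  have "Poly_Mapping.update a b f = f + Poly_Mapping.single a b"
    by (rule poly_mapping_eqI)
      (use update in \<open>auto simp: lookup_update lookup_add lookup_single when_def in_keys_iff\<close>)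
  then show ?case using assms update by simp
qed

section \<open>Homogeneous components and constant coefficients\<close>

lemma homogeneous_0 [simp]: "homogeneous e 0"
  by (simp add: homogeneous_def)

lemma homogeneous_add: "homogeneous e p \<Longrightarrow> homogeneous e q \<Longrightarrow> homogeneous e (p + q)"
  using keys_add[of p q] by (auto simp: homogeneous_def)

lemma homogeneous_sum: "(\<And>a. a \<in> A \<Longrightarrow> homogeneous e (f a)) \<Longrightarrow> homogeneous e (\<Sum>a\<in>A. f a)"
  by (induction A rule: infinite_finite_induct) (auto simp: homogeneous_add)

lemma homogeneous_mult:
  fixes p q :: "('v::finite, 'k::comm_ring_1) mpoly"
  assumes "homogeneous e p" "homogeneous f q"
  shows "homogeneous (e + f) (p * q)"
  unfolding homogeneous_def
proof
  fix m assume "m \<in> Poly_Mapping.keys (p * q)"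
  then obtain a b where "m = a + b" "a \<in> Poly_Mapping.keys p" "b \<in> Poly_Mapping.keys q"
    using keys_mult[of p q] by blast
  then show "int (exp_degree m) = e + f"
    using assms by (auto simp: homogeneous_def exp_degree_add)
qed

lemma homogeneous_uminus: "homogeneous e p \<Longrightarrow> homogeneous e (- p)"
  by (simp add: homogeneous_def in_keys_iff)

lemma homogeneous_mon: "homogeneous (int (card A)) (mon A)"
  by (simp add: homogeneous_def mon_def exp_degree_ind)

lemma homogeneous_single_0: "homogeneous 0 (Poly_Mapping.single (0 :: 'v::finite \<Rightarrow>\<^sub>0 nat) c)"
  by (simp add: homogeneous_def exp_degree_UNIV)

lemma homogeneous_scale:
  fixes p :: "('v::finite, 'k::comm_ring_1) mpoly"
  shows "homogeneous e p \<Longrightarrow> homogeneous e (Poly_Mapping.single 0 c * p)"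
  using homogeneous_mult[OF homogeneous_single_0] by fastforce

lemma homogeneous_coeff_0:
  "homogeneous e (p :: ('v::finite, 'k::comm_ring_1) mpoly) \<Longrightarrow> e \<noteq> 0 \<Longrightarrow> coeff_at p 0 = 0"
  by (force simp: homogeneous_def in_keys_iff exp_degree_UNIV)

lemma homogeneous_mon_cancel:
  assumes "homogeneous e (mon A * p)"
  shows "homogeneous (e - int (card A)) p"
  unfolding homogeneous_def
proof
  fix m assume "m \<in> Poly_Mapping.keys p"
  then have "ind_exp A + m \<in> Poly_Mapping.keys (mon A * p)"
    by (simp add: in_keys_iff lookup_mon_times_add)
  then show "int (exp_degree m) = e - int (card A)"
    using assms by (auto simp: homogeneous_def exp_degree_add exp_degree_ind)
qed

definition hpart :: "int \<Rightarrow> ('v, 'k::comm_ring_1) mpoly \<Rightarrow> ('v, 'k) mpoly" where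
  "hpart e = res {m. int (exp_degree m) = e}"

lemma homogeneous_hpart: "homogeneous e (hpart e p)"
  by (simp add: homogeneous_def hpart_def keys_res)

lemma hpart_homogeneous: "homogeneous e p \<Longrightarrow> hpart e p = p"
  unfolding hpart_def homogeneous_def
  by (rule poly_mapping_eqI) (auto simp: lookup_res in_keys_iff)

lemma hpart_other: "homogeneous e p \<Longrightarrow> e \<noteq> f \<Longrightarrow> hpart f p = 0"
  unfolding hpart_def homogeneous_def
  by (rule poly_mapping_eqI) (auto simp: lookup_res in_keys_iff)

lemma hpart_0 [simp]: "hpart e 0 = 0"
  by (simp add: hpart_def)

lemma hpart_sum: "hpart e (\<Sum>a\<in>A. f a) = (\<Sum>a\<in>A. hpart e (f a))"
  by (simp add: hpart_def res_sum)

text \<open>Both sides are additive in \<open>p\<close>, so single terms suffice. This is what turns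
  an arbitrary preimage under a homogeneous matrix into a homogeneous one.\<close>

lemma hpart_mult:
  fixes A :: "('v::finite, 'k::comm_ring_1) mpoly"
  assumes A: "homogeneous s A"
  shows "hpart (s + e) (A * p) = A * hpart e p"
proof (induction p rule: mpoly_induct)
  case (single m c)
  have h: "homogeneous (int (exp_degree m)) (Poly_Mapping.single m c)"
    by (simp add: homogeneous_def)
  note hA = homogeneous_mult[OF A h]
  show ?case
  proof (cases "e = int (exp_degree m)")
    case True
    then show ?thesis using hpart_homogeneous[OF hA] hpart_homogeneous[OF h] by simp
  next
    case False
    then show ?thesis using hpart_other[OF hA, of "s + e"] hpart_other[OF h, of e] by simp
  qed
next
  case (add p q)
  then show ?case by (simp add: distrib_left hpart_def res_add)
qed simp

text \<open>Exponents cannot cancel, so the exponent 0 arises only as 0 + 0. Taking constant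
  coefficients is thus the ring map from R to the residue field.\<close>

lemma coeff_0_mult:
  fixes p q :: "('v::finite, 'k::comm_ring_1) mpoly"
  shows "coeff_at (p * q) 0 = coeff_at p 0 * coeff_at q 0"
proof (induction q rule: mpoly_induct)
  case (single m c)
  show ?case
  proof (cases "m = 0")
    case True
    then show ?thesis using lookup_single_times_add[of 0 c p 0]
      by (simp add: mult.commute)
  next
    case False
    then have "exp_degree m > 0" using exp_degree_eq_0 by blast
    have "0 \<notin> Poly_Mapping.keys (p * Poly_Mapping.single m c)"
    proof
      assume "0 \<in> Poly_Mapping.keys (p * Poly_Mapping.single m c)"
      then obtain a where "0 = a + m"
        using keys_mult[of p "Poly_Mapping.single m c"] by (fastforce split: if_splits)
      then have "exp_degree (0 :: 'v \<Rightarrow>\<^sub>0 nat) = exp_degree a + exp_degree m"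
        by (metis exp_degree_add)
      with \<open>exp_degree m > 0\<close> show False using exp_degree_eq_0[of "0 :: 'v \<Rightarrow>\<^sub>0 nat"] by simp
    qed
    with False show ?thesis by (simp add: in_keys_iff lookup_single)
  qed
qed (simp_all add: distrib_left lookup_add)

section \<open>The Taylor complex\<close>

text \<open>The incidence sign of \<open>a\<close> in a face whose vertices are ordered by
  \<open>r\<close>. Vertices carry no order of their own, hence the map \<open>r\<close> into the
  naturals.\<close>

definition sg :: "('a \<Rightarrow> nat) \<Rightarrow> 'a \<Rightarrow> 'a set \<Rightarrow> 'r::comm_ring_1" where
  "sg r a S = (-1) ^ card {y \<in> S. r y < r a}"

lemma sg_sq: "sg r a S * sg r a S = (1 :: 'r::comm_ring_1)"
  by (cases "even (card {y \<in> S. r y < r a})") (auto simp: sg_def)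

lemma sg_sq_left: "sg r a S * (sg r a S * x) = (x :: 'r::comm_ring_1)"
  by (simp add: sg_sq flip: mult.assoc)

lemma sg_nonzero: "sg r a S \<noteq> (0 :: 'r::comm_ring_1)"
  by (metis mult_zero_left sg_sq zero_neq_one)

lemma sg_insert:
  assumes "finite S" "b \<notin> S"
  shows "sg r a (insert b S) = (if r b < r a then - sg r a S else (sg r a S :: 'r::comm_ring_1))"
proof -
  have "{y \<in> insert b S. r y < r a} =
      (if r b < r a then insert b {y \<in> S. r y < r a} else {y \<in> S. r y < r a})"
    by auto
  then show ?thesis using assms by (simp add: sg_def)
qed

lemma sg_anticomm:
  assumes "inj r" "finite S" "a \<notin> S" "b \<notin> S" "a \<noteq> b"
  shows "sg r a (insert b S) * sg r b S = - (sg r b (insert a S) * sg r a S :: 'r::comm_ring_1)"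
proof -
  have "r a \<noteq> r b" using assms by (auto dest: injD)
  then show ?thesis using assms by (auto simp: sg_insert mult.commute)
qed

lemma homogeneous_sg_mult:
  "homogeneous e p \<Longrightarrow> homogeneous e (sg r a S * (p :: ('v, 'k::comm_ring_1) mpoly))"
  by (cases "even (card {y \<in> S. r y < r a})") (auto simp: sg_def homogeneous_uminus)

lemma coeff_sg_mult:
  "coeff_at (sg r a S * p) m = sg r a S * coeff_at (p :: ('v, 'k::comm_ring_1) mpoly) m"
  by (cases "even (card {y \<in> S. r y < r a})") (auto simp: sg_def)

lemma res_sg_mult: "res P (sg r a S * p) = sg r a S * res P p"
  by (rule poly_mapping_eqI) (simp add: coeff_sg_mult lookup_res)

text \<open>A chain is given by its coefficients, and the value at \<open>S\<close> is the
  coefficient of \<open>S\<close> in the boundary. The empty face is included, so this is the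
  augmented chain complex.\<close>

definition simplex_diff ::
    "'a set \<Rightarrow> ('a \<Rightarrow> nat) \<Rightarrow> ('a set \<Rightarrow> 'r::comm_ring_1) \<Rightarrow> 'a set \<Rightarrow> 'r" where
  "simplex_diff \<Phi> r f S = (\<Sum>a\<in>\<Phi> - S. sg r a S * f (insert a S))"

lemma simplex_diff_diff:
  assumes r: "inj r" and fin: "finite \<Phi>" and S: "S \<subseteq> \<Phi>"
  shows "simplex_diff \<Phi> r (simplex_diff \<Phi> r f) S = 0"
proof -
  let ?D = "\<Phi> - S"
  let ?t = "\<lambda>a b. sg r a S * (sg r b (insert a S) * f (insert b (insert a S)))"
  have finS: "finite S" by (rule finite_subset[OF S fin])
  have anti: "?t b a = - ?t a b" if "a \<in> ?D" "b \<in> ?D" "a \<noteq> b" for a b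
  proof -
    have "?t b a = (sg r a (insert b S) * sg r b S) * f (insert b (insert a S))"
      by (simp add: insert_commute ac_simps)
    also have "\<dots> = - (sg r b (insert a S) * sg r a S) * f (insert b (insert a S))"
      using that by (subst sg_anticomm[OF r finS, of a b]) auto
    finally show ?thesis by (simp add: ac_simps)
  qed
  have "simplex_diff \<Phi> r (simplex_diff \<Phi> r f) S = (\<Sum>a\<in>?D. \<Sum>b\<in>?D - {a}. ?t a b)"
  proof -
    have "\<Phi> - insert a S = ?D - {a}" for a by blast
    then show ?thesis by (simp only: simplex_diff_def sum_distrib_left)
  qed
  \<comment> \<open>Ordering the pairs and matching (a, b) with (b, a) gives the cancellation over
    every ring; from X = - X alone nothing follows in characteristic 2.\<close>
  also have "\<dots> = (\<Sum>a\<in>?D. (\<Sum>b\<in>{b \<in> ?D. r a < r b}. ?t a b) + (\<Sum>b\<in>{b \<in> ?D. r b < r a}. ?t a b))"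
  proof (rule sum.cong[OF refl])
    fix a assume a: "a \<in> ?D"
    have eq: "?D - {a} = {b \<in> ?D. r a < r b} \<union> {b \<in> ?D. r b < r a}"
    proof (rule set_eqI)
      fix b
      have "b = a \<or> r a < r b \<or> r b < r a" using injD[OF r, of a b] by (cases "r a" "r b" rule: linorder_cases) auto
      then show "b \<in> ?D - {a} \<longleftrightarrow> b \<in> {b \<in> ?D. r a < r b} \<union> {b \<in> ?D. r b < r a}" by auto
    qed
    show "(\<Sum>b\<in>?D - {a}. ?t a b) =
        (\<Sum>b\<in>{b \<in> ?D. r a < r b}. ?t a b) + (\<Sum>b\<in>{b \<in> ?D. r b < r a}. ?t a b)"
      unfolding eq by (rule sum.union_disjoint) (use fin in auto)
  qed
  finally have "simplex_diff \<Phi> r (simplex_diff \<Phi> r f) S =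
      (\<Sum>a\<in>?D. \<Sum>b\<in>{b \<in> ?D. r a < r b}. ?t a b) +
      (\<Sum>a\<in>?D. \<Sum>b\<in>{b \<in> ?D. r b < r a}. ?t a b)"
    by (simp only: sum.distrib)
  moreover have "(\<Sum>a\<in>?D. \<Sum>b\<in>{b \<in> ?D. r b < r a}. ?t a b) =
      - (\<Sum>a\<in>?D. \<Sum>b\<in>{b \<in> ?D. r a < r b}. ?t a b)" (is "?X = - ?Y")
  proof -
    have "?X = (\<Sum>b\<in>?D. \<Sum>a\<in>{a \<in> ?D. r b < r a}. ?t a b)"
      using fin by (intro sum.swap_restrict) auto
    also have "\<dots> = (\<Sum>a\<in>?D. \<Sum>b\<in>{b \<in> ?D. r a < r b}. - ?t a b)"
      by (intro sum.cong refl anti) auto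
    finally show ?thesis by (simp only: sum_negf)
  qed
  ultimately show ?thesis by (simp only: add.right_inverse)
qed

definition cone :: "('a \<Rightarrow> nat) \<Rightarrow> 'a \<Rightarrow> ('a set \<Rightarrow> 'r::comm_ring_1) \<Rightarrow> 'a set \<Rightarrow> 'r" where
  "cone r e f S = (if e \<in> S then sg r e (S - {e}) * f (S - {e}) else 0)"

text \<open>Joining with a fixed vertex \<open>e\<close> is a contracting homotopy of the full simplex on \<open>\<Phi>\<close>.\<close>

lemma simplex_diff_cone:
  assumes r: "inj r" and fin: "finite \<Phi>" and e: "e \<in> \<Phi>" and S: "S \<subseteq> \<Phi>"
    and cyc: "\<And>T. T \<subseteq> \<Phi> \<Longrightarrow> simplex_diff \<Phi> r f T = 0"
  shows "simplex_diff \<Phi> r (cone r e f) S = f S"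
proof (cases "e \<in> S")
  case False
  \<comment> \<open>Cone chains live on faces containing \<open>e\<close>.\<close>
  have "simplex_diff \<Phi> r (cone r e f) S = (\<Sum>a\<in>{e}. sg r a S * cone r e f (insert a S))"
    unfolding simplex_diff_def
    by (rule sum.mono_neutral_right) (use fin e False in \<open>auto simp: cone_def\<close>)
  also have "\<dots> = sg r e S * (sg r e S * f S)"
    using False by (simp add: cone_def)
  also have "\<dots> = f S"
    by (simp add: sg_sq_left)
  finally show ?thesis .
next
  case True
  define T where "T = S - {e}"
  have ST: "S = insert e T" and eT: "e \<notin> T" and T: "T \<subseteq> \<Phi>"
    using True S by (auto simp: T_def)
  have finT: "finite T" by (rule finite_subset[OF T fin])
  have \<Phi>T: "\<Phi> - T = insert e (\<Phi> - S)" using ST eT e by auto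
  have "simplex_diff \<Phi> r f T =
      sg r e T * f S + (\<Sum>a\<in>\<Phi> - S. sg r a T * f (insert a T))"
    unfolding simplex_diff_def \<Phi>T using fin True by (simp add: ST[symmetric])
  \<comment> \<open>The cycle condition at the face without \<open>e\<close> expresses the remaining
    terms through \<open>f S\<close>.\<close>
  then have *: "(\<Sum>a\<in>\<Phi> - S. sg r a T * f (insert a T)) = - (sg r e T * f S)"
    using cyc[OF T] by (simp add: eq_neg_iff_add_eq_0 add.commute)
  have "simplex_diff \<Phi> r (cone r e f) S =
      (\<Sum>a\<in>\<Phi> - S. - (sg r e T * (sg r a T * f (insert a T))))"
    unfolding simplex_diff_def
  proof (rule sum.cong[OF refl])
    fix a assume a: "a \<in> \<Phi> - S"
    then have ae: "a \<noteq> e" "a \<notin> T" using ST by auto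
    have eq: "insert a S - {e} = insert a T" using ST ae eT by auto
    \<comment> \<open>Inserting the square of \<open>sg r e T\<close>, which is 1, produces a
      product to which anticommutation applies.\<close>
    have "sg r a (insert e T) * sg r e (insert a T) =
        (sg r a (insert e T) * sg r e T) * (sg r e T * (sg r e (insert a T) :: 'b))"
      by (simp add: mult.assoc sg_sq_left)
    also have "\<dots> = - ((sg r e T * sg r a T) * (sg r e (insert a T) * (sg r e (insert a T) :: 'b)))"
      using ae eT by (subst sg_anticomm[OF r finT]) (auto simp: ac_simps)
    finally have sgs: "sg r a (insert e T) * sg r e (insert a T) = - (sg r e T * (sg r a T :: 'b))"
      by (simp only: sg_sq mult_1_right)
    have "sg r a S * cone r e f (insert a S) =
        (sg r a (insert e T) * sg r e (insert a T)) * f (insert a T)"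
      unfolding cone_def eq ST[symmetric] using True by (simp add: mult.assoc)
    then show "sg r a S * cone r e f (insert a S) = - (sg r e T * (sg r a T * f (insert a T)))"
      by (simp add: sgs mult.assoc)
  qed
  also have "\<dots> = - (sg r e T * (\<Sum>a\<in>\<Phi> - S. sg r a T * f (insert a T)))"
    by (simp add: sum_negf sum_distrib_left)
  also have "\<dots> = f S"
    unfolding * by (simp add: sg_sq_left)
  finally show ?thesis .
qed

section \<open>The Taylor differential and its exactness\<close>

text \<open>Least common multiples of squarefree monomials are unions, so the monomial factor is
  lcm(S + a) / lcm(S). With the generators themselves as \<open>g\<close> this is the Taylor
  differential; with singletons it is the Koszul differential.\<close>

definition tay :: "'a set \<Rightarrow> ('a \<Rightarrow> 'v::finite set) \<Rightarrow> ('a \<Rightarrow> nat) \<Rightarrow>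
    ('a set \<Rightarrow> ('v, 'k::comm_ring_1) mpoly) \<Rightarrow> 'a set \<Rightarrow> ('v, 'k) mpoly" where
  "tay \<Phi> g r c S = (\<Sum>a\<in>\<Phi> - S. sg r a S * (mon (g a - \<Union>(g ` S)) * c (insert a S)))"

text \<open>Writing the basis element \<open>e\<^sub>S\<close> as the least common multiple of its generators turns the
  Taylor complex into a simplicial chain complex in each multidegree.\<close>

lemma mon_tay:
  fixes c :: "'a set \<Rightarrow> ('v::finite, 'k::comm_ring_1) mpoly"
  shows "mon (\<Union>(g ` S)) * tay \<Phi> g r c S = simplex_diff \<Phi> r (\<lambda>T. mon (\<Union>(g ` T)) * c T) S"
  unfolding tay_def simplex_diff_def sum_distrib_left
proof (rule sum.cong[OF refl])
  fix a
  have "mon (\<Union>(g ` S) \<union> (g a - \<Union>(g ` S))) =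
      (mon (\<Union>(g ` S)) * mon (g a - \<Union>(g ` S)) :: ('v, 'k) mpoly)"
    by (rule mon_union) auto
  moreover have "\<Union>(g ` S) \<union> (g a - \<Union>(g ` S)) = \<Union>(g ` insert a S)" by auto
  ultimately show "mon (\<Union>(g ` S)) * (sg r a S * (mon (g a - \<Union>(g ` S)) * c (insert a S))) =
      sg r a S * (mon (\<Union>(g ` insert a S)) * c (insert a S))"
    by (simp add: ac_simps)
qed

text \<open>Multiplication by the monomial of the union is injective, so the identity descends from
  the simplex.\<close>

lemma tay_tay:
  assumes "inj r" "finite \<Phi>" "S \<subseteq> \<Phi>"
  shows "tay \<Phi> g r (tay \<Phi> g r c) S = 0"
  by (rule mon_times_eq_0[of "\<Union>(g ` S)"]) (simp only: mon_tay simplex_diff_diff[OF assms])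

lemma tay_sum_mult:
  "tay \<Phi> g r (\<lambda>S. \<Sum>b\<in>J. A b * c S b) S = (\<Sum>b\<in>J. A b * tay \<Phi> g r (\<lambda>S. c S b) S)"
  unfolding tay_def sum_distrib_left
  by (subst sum.swap) (simp add: ac_simps)

lemma tay_add: "tay \<Phi> g r (\<lambda>S. c S + c' S) S = tay \<Phi> g r c S + tay \<Phi> g r c' S"
  by (simp add: tay_def distrib_left sum.distrib)

lemma tay_mult: "tay \<Phi> g r (\<lambda>S. A * c S) S = A * tay \<Phi> g r c S"
  by (simp add: tay_def sum_distrib_left ac_simps)

lemma simplex_diff_sum:
  "simplex_diff \<Phi> r (\<lambda>T. \<Sum>e\<in>E. f e T) S = (\<Sum>e\<in>E. simplex_diff \<Phi> r (f e) S)"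
  unfolding simplex_diff_def sum_distrib_left by (rule sum.swap)

text \<open>In multidegree \<open>u\<close> the Taylor complex is the full simplex on the generators dividing \<open>u\<close>,
  hence a cycle is a boundary if there is such a generator. In positive homological degree this
  holds automatically.\<close>

lemma tay_exact:
  fixes c :: "'a set \<Rightarrow> ('v::finite, 'k::comm_ring_1) mpoly"
  assumes r: "inj r" and fin: "finite \<Phi>"
    and supp: "\<And>S. c S \<noteq> 0 \<Longrightarrow> S \<subseteq> \<Phi> \<and> card S = p"
    and dvd: "p = 0 \<Longrightarrow> (\<And>u. u \<in> Poly_Mapping.keys (c {}) \<Longrightarrow> \<exists>a\<in>\<Phi>. g a \<subseteq> Poly_Mapping.keys u)"
    and cyc: "\<And>S. S \<subseteq> \<Phi> \<Longrightarrow> tay \<Phi> g r c S = 0"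
  obtains b where "\<And>S. b S \<noteq> 0 \<Longrightarrow> S \<subseteq> \<Phi> \<and> card S = Suc p"
    "\<forall>e. (\<forall>S. homogeneous (e - int (card (\<Union>(g ` S)))) (c S)) \<longrightarrow>
      (\<forall>S. homogeneous (e - int (card (\<Union>(g ` S)))) (b S))"
    "\<And>S. S \<subseteq> \<Phi> \<Longrightarrow> tay \<Phi> g r b S = c S"
proof -
  let ?U = "\<lambda>S. \<Union>(g ` S)"
  \<comment> \<open>The chosen generator depends on the exponent vector alone and not on the face,
    so the parts cut out by \<open>P\<close> are preserved by the boundary and can be coned off
    separately.\<close>
  define ch where "ch u = (SOME a. a \<in> \<Phi> \<and> g a \<subseteq> Poly_Mapping.keys u)" for u :: "'v \<Rightarrow>\<^sub>0 nat"
  define C where "C S = mon (?U S) * c S" for S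
  define P where "P a = {u. ch u = a \<and> g a \<subseteq> Poly_Mapping.keys u}" for a
  define H where "H S = (\<Sum>a\<in>\<Phi>. cone r a (\<lambda>T. res (P a) (C T)) S)" for S
  have C0: "C S = 0" if "\<not> (S \<subseteq> \<Phi> \<and> card S = p)" for S
  proof -
    have "c S = 0" using supp[of S] that by blast
    then show ?thesis by (simp add: C_def)
  qed
  have key: "ch u \<in> \<Phi> \<and> g (ch u) \<subseteq> Poly_Mapping.keys u" if u: "u \<in> Poly_Mapping.keys (C S)" for u S
  proof -
    have S: "S \<subseteq> \<Phi>" "card S = p" using u C0[of S] keys_zero by (metis emptyE)+
    obtain s where s: "u = ind_exp (?U S) + s" "s \<in> Poly_Mapping.keys (c S)"
      using keys_mon_times u unfolding C_def by metis
    have "\<exists>a. a \<in> \<Phi> \<and> g a \<subseteq> Poly_Mapping.keys u"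
    proof (cases "S = {}")
      case True
      then show ?thesis using s dvd S by auto
    next
      case False
      then obtain a where "a \<in> S" by auto
      then show ?thesis using S s by (intro exI[of _ a]) (auto simp: keys_ind_exp_add)
    qed
    then show ?thesis unfolding ch_def by (rule someI_ex)
  qed
  have cycC: "simplex_diff \<Phi> r C S = 0" if "S \<subseteq> \<Phi>" for S
    using mon_tay[of g S \<Phi> r c] cyc[OF that] by (simp add: C_def[abs_def])
  have dH: "simplex_diff \<Phi> r H S = C S" if S: "S \<subseteq> \<Phi>" for S
  proof -
    have "simplex_diff \<Phi> r H S = (\<Sum>a\<in>\<Phi>. simplex_diff \<Phi> r (cone r a (\<lambda>T. res (P a) (C T))) S)"
      unfolding H_def[abs_def] by (rule simplex_diff_sum)
    also have "\<dots> = (\<Sum>a\<in>\<Phi>. res (P a) (C S))"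
    proof (rule sum.cong[OF refl])
      fix a assume a: "a \<in> \<Phi>"
      show "simplex_diff \<Phi> r (cone r a (\<lambda>T. res (P a) (C T))) S = res (P a) (C S)"
      proof (rule simplex_diff_cone[OF r fin a S])
        fix T assume T: "T \<subseteq> \<Phi>"
        have "simplex_diff \<Phi> r (\<lambda>T. res (P a) (C T)) T = res (P a) (simplex_diff \<Phi> r C T)"
          by (simp add: simplex_diff_def res_sum res_sg_mult)
        then show "simplex_diff \<Phi> r (\<lambda>T. res (P a) (C T)) T = 0"
          using cycC[OF T] by simp
      qed
    qed
    also have "\<dots> = C S"
    proof (rule poly_mapping_eqI)
      fix u
      show "coeff_at (\<Sum>a\<in>\<Phi>. res (P a) (C S)) u = coeff_at (C S) u"
      proof (cases "u \<in> Poly_Mapping.keys (C S)")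
        case True
        note k = key[OF True]
        have "(\<Sum>a\<in>\<Phi>. coeff_at (res (P a) (C S)) u) = (\<Sum>a\<in>{ch u}. coeff_at (res (P a) (C S)) u)"
          by (rule sum.mono_neutral_right) (use fin k in \<open>auto simp: lookup_res P_def\<close>)
        also have "\<dots> = coeff_at (C S) u" using k by (simp add: lookup_res P_def)
        finally show ?thesis by (simp add: lookup_sum)
      next
        case False
        then have "coeff_at (C S) u = 0" by (simp add: in_keys_iff)
        then show ?thesis by (simp add: lookup_sum lookup_res cong: if_cong)
      qed
    qed
    finally show ?thesis .
  qed
  have H0: "S \<subseteq> \<Phi> \<and> card S = Suc p" if nz: "H S \<noteq> 0" for S
  proof -
    obtain a where a: "a \<in> \<Phi>" "cone r a (\<lambda>T. res (P a) (C T)) S \<noteq> 0"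
      using nz unfolding H_def by (rule sum.not_neutral_contains_not_neutral)
    have "a \<in> S" "C (S - {a}) \<noteq> 0"
      using a(2) by (auto simp: cone_def split: if_splits)
    then have S: "S - {a} \<subseteq> \<Phi>" "card (S - {a}) = p" using C0 by metis+
    then have "finite (S - {a})" using fin finite_subset by blast
    then have "card S = Suc p"
      using card.remove[of S a] S(2) \<open>a \<in> S\<close> by simp
    then show ?thesis using S(1) a(1) by auto
  qed
  \<comment> \<open>The cone point divides \<open>u\<close> by the definition of \<open>P\<close>,
    the other vertices because \<open>C\<close> carries their monomial. Hence \<open>H\<close> can
    be divided back into Taylor coordinates.\<close>
  have dvdH: "?U S \<subseteq> Poly_Mapping.keys u" if u: "u \<in> Poly_Mapping.keys (H S)" for S u
  proof -
    have "(\<Sum>a\<in>\<Phi>. coeff_at (cone r a (\<lambda>T. res (P a) (C T)) S) u) \<noteq> 0"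
      using u by (simp add: in_keys_iff H_def lookup_sum)
    then obtain a where a: "a \<in> \<Phi>" "coeff_at (cone r a (\<lambda>T. res (P a) (C T)) S) u \<noteq> 0"
      by (rule sum.not_neutral_contains_not_neutral)
    then have aS: "a \<in> S" and "coeff_at (res (P a) (C (S - {a}))) u \<noteq> 0"
      by (auto simp: cone_def coeff_sg_mult split: if_splits)
    then have ga: "g a \<subseteq> Poly_Mapping.keys u"
      and uC: "u \<in> Poly_Mapping.keys (mon (?U (S - {a})) * c (S - {a}))"
      by (auto simp: lookup_res P_def in_keys_iff C_def split: if_splits)
    from uC obtain s where s: "u = ind_exp (?U (S - {a})) + s"
      by (rule keys_mon_times)
    have "?U (S - {a}) \<subseteq> Poly_Mapping.keys u"
      unfolding s keys_ind_exp_add by (rule Un_upper1)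
    moreover have "?U S = ?U (S - {a}) \<union> g a" using aS by blast
    ultimately show ?thesis using ga by (simp only: Un_subset_iff)
  qed
  have "\<exists>b. H S = mon (?U S) * b" for S
  proof (rule mon_dvdE)
    show "?U S \<subseteq> Poly_Mapping.keys u" if "u \<in> Poly_Mapping.keys (H S)" for u
      using dvdH[OF that] .
  qed blast
  then obtain b where b: "\<And>S. H S = mon (?U S) * b S" by metis
  have hom_b: "homogeneous (e - int (card (?U S))) (b S)"
    if hom: "\<forall>S. homogeneous (e - int (card (?U S))) (c S)" for e S
  proof -
    have hC: "homogeneous e (C T)" for T
      using homogeneous_mult[OF homogeneous_mon hom[rule_format], of "?U T" T] by (simp add: C_def)
    have "homogeneous e (H S)"
      unfolding H_def
    proof (rule homogeneous_sum)
      fix a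
      have "homogeneous e (res (P a) (C (S - {a})))"
        using hC[of "S - {a}"] by (auto simp: homogeneous_def keys_res)
      then show "homogeneous e (cone r a (\<lambda>T. res (P a) (C T)) S)"
        by (simp add: cone_def homogeneous_sg_mult)
    qed
    then show ?thesis
      unfolding b by (rule homogeneous_mon_cancel)
  qed
  show ?thesis
  proof
    show "\<forall>e. (\<forall>S. homogeneous (e - int (card (?U S))) (c S)) \<longrightarrow>
        (\<forall>S. homogeneous (e - int (card (?U S))) (b S))"
      using hom_b by simp
    fix S
    show "S \<subseteq> \<Phi> \<and> card S = Suc p" if "b S \<noteq> 0"
    proof (rule H0)
      show "H S \<noteq> 0" using that mon_times_eq_0[of "?U S" "b S"] by (auto simp: b)
    qed
    show "tay \<Phi> g r b S = c S" if S: "S \<subseteq> \<Phi>"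
    proof (rule mon_times_cancel)
      show "mon (?U S) * tay \<Phi> g r b S = mon (?U S) * c S"
        using dH[OF S] by (simp add: mon_tay b[symmetric] C_def)
    qed
  qed
qed

lemma homogeneous_tay:
  fixes c :: "'a set \<Rightarrow> ('v::finite, 'k::comm_ring_1) mpoly"
  assumes "\<And>S. homogeneous (e - int (card (\<Union>(g ` S)))) (c S)"
  shows "homogeneous (e - int (card (\<Union>(g ` S)))) (tay \<Phi> g r c S)"
  unfolding tay_def
proof (intro homogeneous_sum homogeneous_sg_mult)
  fix a
  have U: "\<Union>(g ` insert a S) = \<Union>(g ` S) \<union> (g a - \<Union>(g ` S))" by auto
  have "card (\<Union>(g ` insert a S)) = card (\<Union>(g ` S)) + card (g a - \<Union>(g ` S))"
    unfolding U by (rule card_Un_disjoint) auto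
  then have deg: "int (card (g a - \<Union>(g ` S))) + (e - int (card (\<Union>(g ` insert a S)))) =
      e - int (card (\<Union>(g ` S)))"
    by linarith
  show "homogeneous (e - int (card (\<Union>(g ` S)))) (mon (g a - \<Union>(g ` S)) * c (insert a S))"
    using homogeneous_mult[OF homogeneous_mon[of "g a - \<Union>(g ` S)"] assms[of "insert a S"]]
    unfolding deg .
qed

section \<open>Squarefree monomial ideals and their Taylor resolutions\<close>

text \<open>Membership is a condition on single exponent vectors, the form in which multidegree
  arguments use it; \<open>facet_ideal_eq\<close> shows that for facets this is the generated
  ideal.\<close>

definition mon_ideal :: "'v::finite set set \<Rightarrow> ('v, 'k::comm_ring_1) mpoly set" where
  "mon_ideal \<Phi> = {p. \<forall>u\<in>Poly_Mapping.keys p. \<exists>F\<in>\<Phi>. F \<subseteq> Poly_Mapping.keys u}"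

lemma mon_ideal_0 [simp]: "0 \<in> mon_ideal \<Phi>"
  by (simp add: mon_ideal_def)

lemma mon_ideal_add: "p \<in> mon_ideal \<Phi> \<Longrightarrow> q \<in> mon_ideal \<Phi> \<Longrightarrow> p + q \<in> mon_ideal \<Phi>"
  using keys_add[of p q] unfolding mon_ideal_def by blast

lemma mon_ideal_sum: "(\<And>a. a \<in> A \<Longrightarrow> f a \<in> mon_ideal \<Phi>) \<Longrightarrow> (\<Sum>a\<in>A. f a) \<in> mon_ideal \<Phi>"
  by (induction A rule: infinite_finite_induct) (auto simp: mon_ideal_add)

lemma mon_ideal_mult:
  assumes "q \<in> mon_ideal \<Phi>"
  shows "p * q \<in> mon_ideal \<Phi>"
  unfolding mon_ideal_def
proof (intro CollectI ballI)
  fix u assume "u \<in> Poly_Mapping.keys (p * q)"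
  then obtain a b where u: "u = a + b" "b \<in> Poly_Mapping.keys q"
    using keys_mult[of p q] by blast
  then obtain F where "F \<in> \<Phi>" "F \<subseteq> Poly_Mapping.keys b"
    using assms by (auto simp: mon_ideal_def)
  moreover have "Poly_Mapping.keys b \<subseteq> Poly_Mapping.keys u"
    by (auto simp: u in_keys_iff lookup_add)
  ultimately show "\<exists>F\<in>\<Phi>. F \<subseteq> Poly_Mapping.keys u" by blast
qed

lemma mon_in_mon_ideal: "F \<in> \<Phi> \<Longrightarrow> mon F \<in> mon_ideal \<Phi>"
  unfolding mon_ideal_def by (auto simp: mon_def)

text \<open>Each term is assigned to one generator dividing it.\<close>

lemma mon_idealE:
  fixes p :: "('v::finite, 'k::comm_ring_1) mpoly"
  assumes p: "p \<in> mon_ideal \<Phi>"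
  obtains q where "p = (\<Sum>F\<in>\<Phi>. mon F * q F)"
proof -
  define ch where "ch u = (SOME F. F \<in> \<Phi> \<and> F \<subseteq> Poly_Mapping.keys u)" for u :: "'v \<Rightarrow>\<^sub>0 nat"
  have ch: "ch u \<in> \<Phi> \<and> ch u \<subseteq> Poly_Mapping.keys u" if "u \<in> Poly_Mapping.keys p" for u
    unfolding ch_def by (rule someI_ex) (use p that in \<open>auto simp: mon_ideal_def\<close>)
  have "\<exists>q. res {u. ch u = F} p = mon F * q" for F
  proof (rule mon_dvdE)
    show "F \<subseteq> Poly_Mapping.keys u" if "u \<in> Poly_Mapping.keys (res {u. ch u = F} p)" for u
      using that ch by (auto simp: keys_res)
  qed blast
  then obtain q where q: "\<And>F. res {u. ch u = F} p = mon F * q F" by metis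
  have "p = (\<Sum>F\<in>\<Phi>. res {u. ch u = F} p)"
  proof (rule poly_mapping_eqI)
    fix u
    show "coeff_at p u = coeff_at (\<Sum>F\<in>\<Phi>. res {u. ch u = F} p) u"
    proof (cases "u \<in> Poly_Mapping.keys p")
      case True
      then show ?thesis using ch by (simp add: lookup_sum lookup_res)
    next
      case False
      then have "coeff_at p u = 0" by (simp add: in_keys_iff)
      then show ?thesis by (simp add: lookup_sum lookup_res cong: if_cong)
    qed
  qed
  then show ?thesis using that by (simp add: q)
qed

lemma facet_ideal_eq: "facet_ideal \<Delta> = (mon_ideal (facets \<Delta>) :: ('v::finite, 'k::field) mpoly set)"
proof -
  interpret M: module "(*) :: ('v, 'k) mpoly \<Rightarrow> ('v, 'k) mpoly \<Rightarrow> ('v, 'k) mpoly"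
    by unfold_locales (simp_all add: algebra_simps)
  have gens: "(\<lambda>F. \<Prod>x\<in>F. var x) ` facets \<Delta> = (mon ` facets \<Delta> :: ('v, 'k) mpoly set)"
    by (simp add: mon_prod)
  have "p \<in> mon_ideal (facets \<Delta>)" if "p \<in> M.span (mon ` facets \<Delta>)" for p
    using that
  proof (induction rule: M.span_induct)
    case base
    show ?case
      unfolding M.subspace_def by (simp add: mon_ideal_add mon_ideal_mult)
  next
    case (step x)
    then show ?case by (auto simp: mon_in_mon_ideal)
  qed
  moreover have "p \<in> M.span (mon ` facets \<Delta>)" if p: "p \<in> mon_ideal (facets \<Delta>)" for p
  proof -
    obtain q where "p = (\<Sum>F\<in>facets \<Delta>. mon F * q F)"
      using p by (rule mon_idealE)
    also have "\<dots> = (\<Sum>F\<in>facets \<Delta>. q F * mon F)"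
      by (simp add: mult.commute)
    finally show ?thesis
      by (simp add: M.span_sum M.span_scale M.span_base)
  qed
  ultimately show ?thesis
    unfolding facet_ideal_def gens by blast
qed

section \<open>From chains indexed by sets to a resolution by matrices\<close>

locale taylor =
  fixes \<Phi> :: "'v::finite set set" and r :: "'v set \<Rightarrow> nat"
  assumes inj_r: "inj r"
begin

text \<open>The module of index 0 has one basis element per generator, so index \<open>i\<close>
  goes with sets of size \<open>i + 1\<close>; the empty set stands for the ring, the target of the
  augmentation.\<close>

definition lev :: "nat \<Rightarrow> 'v set set set" where
  "lev i = {S. S \<subseteq> \<Phi> \<and> card S = Suc i}"

definition en :: "nat \<Rightarrow> nat \<Rightarrow> 'v set set" where
  "en i = (SOME h. bij_betw h {..<card (lev i)} (lev i))"

lemma bij_en: "bij_betw (en i) {..<card (lev i)} (lev i)"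
proof -
  have "\<exists>h. bij_betw h {..<card (lev i)} (lev i)"
    using ex_bij_betw_nat_finite[of "lev i"] by (simp add: lessThan_atLeast0)
  then show ?thesis unfolding en_def by (rule someI_ex)
qed

lemma en_lev: "b < card (lev i) \<Longrightarrow> en i b \<in> lev i"
  using bij_en[of i] by (auto simp: bij_betw_def)

text \<open>For sets in consecutive levels the sum has a single summand and picks out the added
  vertex without a choice.\<close>

definition entry :: "'v set set \<Rightarrow> 'v set set \<Rightarrow> ('v, 'k::field) mpoly" where
  "entry S T = (if S \<subseteq> T then \<Sum>a\<in>T - S. sg r a S * mon (a - \<Union>S) else 0)"

definition res_complex :: "('v, 'k::field) free_complex" where
  "res_complex = \<lparr>rk = \<lambda>i. card (lev i), dg = \<lambda>i b. int (card (\<Union>(en i b))),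
     aug = \<lambda>b. mon (\<Union>(en 0 b)), dmat = \<lambda>i a b. entry (en i a) (en (Suc i) b)\<rparr>"

text \<open>Outside the level the value is 0, so \<open>tay\<close>, which looks at faces of every
  size, applies directly; \<open>enc\<close> goes back.\<close>

definition dec :: "nat \<Rightarrow> (nat \<Rightarrow> ('v, 'k::field) mpoly) \<Rightarrow> 'v set set \<Rightarrow> ('v, 'k) mpoly" where
  "dec i v S = (if S \<in> lev i then v (the_inv_into {..<card (lev i)} (en i) S) else 0)"

definition enc :: "nat \<Rightarrow> ('v set set \<Rightarrow> ('v, 'k::field) mpoly) \<Rightarrow> nat \<Rightarrow> ('v, 'k) mpoly" where
  "enc i c b = (if b < card (lev i) then c (en i b) else 0)"

abbreviation tayl :: "('v set set \<Rightarrow> ('v, 'k::field) mpoly) \<Rightarrow> 'v set set \<Rightarrow> ('v, 'k) mpoly" where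
  "tayl \<equiv> tay \<Phi> (\<lambda>F. F) r"

lemma dec_en: "b < card (lev i) \<Longrightarrow> dec i v (en i b) = v b"
  using en_lev bij_en[of i] by (simp add: dec_def the_inv_into_f_f bij_betw_def)

lemma enc_free: "enc i c \<in> free_mod res_complex i"
  by (simp add: enc_def free_mod_def coord_vecs_def res_complex_def)

lemma dec_enc:
  assumes "\<And>S. c S \<noteq> 0 \<Longrightarrow> S \<in> lev i"
  shows "dec i (enc i c) = c"
proof
  fix S
  show "dec i (enc i c) S = c S"
  proof (cases "S \<in> lev i")
    case True
    then obtain b where "b < card (lev i)" "S = en i b"
      using bij_en[of i] by (auto simp: bij_betw_def)
    then show ?thesis by (simp add: dec_en) (simp add: enc_def)
  next
    case False
    then show ?thesis using assms by (auto simp: dec_def)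
  qed
qed

lemma sum_en: "(\<Sum>b<card (lev i). f (en i b)) = (\<Sum>S\<in>lev i. f S)"
  using bij_en by (rule sum.reindex_bij_betw)

text \<open>A nonzero entry needs \<open>S \<subseteq> T\<close> with one more element, so
  \<open>T\<close> is some \<open>insert a S\<close>.\<close>

lemma sum_entry:
  fixes c :: "'v set set \<Rightarrow> ('v, 'k::field) mpoly"
  assumes S: "S \<in> lev i"
  shows "(\<Sum>T\<in>lev (Suc i). entry S T * c T) = tayl c S"
proof -
  have inj: "inj_on (\<lambda>a. insert a S) (\<Phi> - S)"
    by (auto simp: inj_on_def)
  have sub: "(\<lambda>a. insert a S) ` (\<Phi> - S) \<subseteq> lev (Suc i)"
    using S by (auto simp: lev_def)
  have zero: "entry S T = (0 :: ('v, 'k) mpoly)"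
    if T: "T \<in> lev (Suc i) - (\<lambda>a. insert a S) ` (\<Phi> - S)" for T
  proof (rule ccontr)
    assume "entry S T \<noteq> (0 :: ('v, 'k) mpoly)"
    then have ST: "S \<subseteq> T" by (auto simp: entry_def split: if_splits)
    then have "card (T - S) = 1"
      using S T by (subst card_Diff_subset) (auto simp: lev_def)
    then obtain a where "T - S = {a}" by (auto simp: card_1_singleton_iff)
    then have "T = insert a S" "a \<in> \<Phi> - S" using ST T by (auto simp: lev_def)
    with T show False by blast
  qed
  have "(\<Sum>T\<in>lev (Suc i). entry S T * c T) =
      (\<Sum>T\<in>(\<lambda>a. insert a S) ` (\<Phi> - S). entry S T * c T)"
    by (rule sum.mono_neutral_right) (use sub zero in auto)
  also have "\<dots> = (\<Sum>a\<in>\<Phi> - S. entry S (insert a S) * c (insert a S))"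
    by (simp add: sum.reindex[OF inj])
  also have "\<dots> = tayl c S"
    unfolding tay_def
  proof (rule sum.cong[OF refl])
    fix a assume "a \<in> \<Phi> - S"
    then have "insert a S - S = {a}" by auto
    then show "entry S (insert a S) * c (insert a S) =
        sg r a S * (mon (a - \<Union>((\<lambda>F. F) ` S)) * c (insert a S))"
      by (simp add: entry_def mult.assoc subset_insertI)
  qed
  finally show ?thesis .
qed

lemma diff_map_eq:
  assumes "a < card (lev i)"
  shows "diff_map res_complex i v a = tayl (dec (Suc i) v) (en i a)"
proof -
  have "diff_map res_complex i v a = (\<Sum>b<card (lev (Suc i)).
      entry (en i a) (en (Suc i) b) * dec (Suc i) v (en (Suc i) b))"
    using assms by (simp add: diff_map_def mat_apply_def res_complex_def dec_en)
  also have "\<dots> = (\<Sum>T\<in>lev (Suc i). entry (en i a) T * dec (Suc i) v T)"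
    by (rule sum_en)
  also have "\<dots> = tayl (dec (Suc i) v) (en i a)"
    using assms by (intro sum_entry en_lev)
  finally show ?thesis .
qed

lemma tayl_dec_other:
  assumes "S \<subseteq> \<Phi>" "card S \<noteq> i"
  shows "tayl (dec i v) S = 0"
  unfolding tay_def using assms by (intro sum.neutral) (auto simp: dec_def lev_def)

lemma dec_diff_map:
  assumes "S \<subseteq> \<Phi>"
  shows "dec i (diff_map res_complex i v) S = tayl (dec (Suc i) v) S"
proof (cases "S \<in> lev i")
  case True
  then obtain a where "a < card (lev i)" "S = en i a"
    using bij_en[of i] by (auto simp: bij_betw_def)
  then show ?thesis by (simp add: dec_en diff_map_eq)
next
  case False
  then show ?thesis
    using assms tayl_dec_other[of S "Suc i" v] by (auto simp: dec_def lev_def)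
qed

lemma aug_map_eq: "aug_map res_complex v = tayl (dec 0 v) {}"
proof -
  have lev0: "lev 0 = (\<lambda>a. {a}) ` \<Phi>"
    by (auto simp: lev_def card_1_singleton_iff)
  have "aug_map res_complex v = (\<Sum>b<card (lev 0). mon (\<Union>(en 0 b)) * dec 0 v (en 0 b))"
    by (simp add: aug_map_def res_complex_def dec_en)
  also have "\<dots> = (\<Sum>S\<in>lev 0. mon (\<Union>S) * dec 0 v S)"
    by (rule sum_en)
  also have "\<dots> = tayl (dec 0 v) {}"
    unfolding lev0 by (subst sum.reindex) (auto simp: tay_def sg_def inj_on_def)
  finally show ?thesis .
qed

lemma diff_map_free: "diff_map res_complex i v \<in> free_mod res_complex i"
  by (simp add: diff_map_def mat_apply_def free_mod_def coord_vecs_def)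

text \<open>Taylor exactness for faces of positive size, where the divisibility hypothesis is void.
  For \<open>i = 0\<close> the condition at the empty face says that the augmentation
  vanishes.\<close>

lemma kernel_lift:
  fixes v :: "nat \<Rightarrow> ('v, 'k::field) mpoly"
  assumes v: "v \<in> free_mod res_complex i"
    and cyc: "\<And>S. S \<subseteq> \<Phi> \<Longrightarrow> tayl (dec i v) S = 0"
  shows "v \<in> diff_map res_complex i ` free_mod res_complex (Suc i)"
proof -
  have supp: "S \<subseteq> \<Phi> \<and> card S = Suc i" if "dec i v S \<noteq> 0" for S
    using that by (auto simp: dec_def lev_def split: if_splits)
  obtain b where b: "\<And>S. b S \<noteq> 0 \<Longrightarrow> S \<subseteq> \<Phi> \<and> card S = Suc (Suc i)"
    and tb: "\<And>S. S \<subseteq> \<Phi> \<Longrightarrow> tayl b S = dec i v S"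
  proof (rule tay_exact[OF inj_r finite])
    show "S \<subseteq> \<Phi> \<and> card S = Suc i" if "dec i v S \<noteq> 0" for S
      using supp[OF that] .
    show "tayl (dec i v) S = 0" if "S \<subseteq> \<Phi>" for S
      using cyc[OF that] .
  qed (simp, blast intro: that)
  have "diff_map res_complex i (enc (Suc i) b) = v"
  proof
    fix a
    show "diff_map res_complex i (enc (Suc i) b) a = v a"
    proof (cases "a < card (lev i)")
      case True
      then have "en i a \<subseteq> \<Phi>" using en_lev by (auto simp: lev_def)
      moreover have "dec (Suc i) (enc (Suc i) b) = b"
        by (rule dec_enc) (use b in \<open>auto simp: lev_def\<close>)
      ultimately show ?thesis using True by (simp add: diff_map_eq tb dec_en)
    next
      case False
      then show ?thesis
        using v by (simp add: diff_map_def mat_apply_def free_mod_def coord_vecs_def res_complex_def)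
    qed
  qed
  then show ?thesis using enc_free[of "Suc i" b] by (metis image_eqI)
qed

lemma homogeneous_entry:
  assumes "S \<in> lev i" "T \<in> lev (Suc i)"
  shows "homogeneous (int (card (\<Union>T)) - int (card (\<Union>S))) (entry S T)"
proof (cases "S \<subseteq> T")
  case True
  have "homogeneous (int (card (\<Union>T)) - int (card (\<Union>S))) (sg r a S * mon (a - \<Union>S))"
    if "a \<in> T - S" for a
  proof -
    have "card (T - S) = 1"
      using assms True by (subst card_Diff_subset) (auto simp: lev_def)
    then have "T - S = {a}" using that by (auto simp: card_1_singleton_iff)
    then have T: "\<Union>T = \<Union>S \<union> (a - \<Union>S)" using True by blast
    have "card (\<Union>T) = card (\<Union>S) + card (a - \<Union>S)"
      unfolding T by (rule card_Un_disjoint) auto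
    then have "int (card (\<Union>T)) - int (card (\<Union>S)) = int (card (a - \<Union>S))" by simp
    then show ?thesis by (simp only: homogeneous_sg_mult homogeneous_mon)
  qed
  then show ?thesis using True unfolding entry_def by (auto intro: homogeneous_sum)
qed (simp add: entry_def)

theorem graded_free_resolution_res_complex:
  "graded_free_resolution (mon_ideal \<Phi>) (res_complex :: ('v, 'k::field) free_complex)"
proof -
  let ?C = "res_complex :: ('v, 'k) free_complex"
  have aug: "aug_map ?C ` free_mod ?C 0 = mon_ideal \<Phi>"
  proof (intro equalityI subsetI)
    fix p assume "p \<in> aug_map ?C ` free_mod ?C 0"
    then obtain v where v: "p = (\<Sum>a\<in>\<Phi> - {}. sg r a {} * (mon (a - \<Union>((\<lambda>F. F) ` {})) * dec 0 v {a}))"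
      by (auto simp: aug_map_eq tay_def)
    have "sg r a {} * (mon a * dec 0 v {a}) \<in> mon_ideal \<Phi>" if "a \<in> \<Phi>" for a
      using mon_ideal_mult[OF mon_in_mon_ideal[OF that], of "sg r a {} * dec 0 v {a}"]
      by (simp add: ac_simps)
    then show "p \<in> mon_ideal \<Phi>" unfolding v by (intro mon_ideal_sum) simp
  next
    fix p :: "('v, 'k) mpoly" assume "p \<in> mon_ideal \<Phi>"
    then obtain q where q: "p = (\<Sum>F\<in>\<Phi>. mon F * q F)" by (rule mon_idealE)
    define c where "c S = (if S \<in> lev 0 then q (the_elem S) else 0)" for S
    have "dec 0 (enc 0 c) = c"
      by (rule dec_enc) (simp add: c_def split: if_splits)
    then have "aug_map ?C (enc 0 c) = tayl c {}" by (simp add: aug_map_eq)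
    also have "\<dots> = p"
      unfolding q tay_def by (intro sum.cong) (auto simp: sg_def c_def lev_def)
    finally show "p \<in> aug_map ?C ` free_mod ?C 0" using enc_free by (metis image_eqI)
  qed
  have ker0: "diff_map ?C 0 ` free_mod ?C 1 = {v \<in> free_mod ?C 0. aug_map ?C v = 0}"
  proof (intro equalityI subsetI)
    fix v assume "v \<in> diff_map ?C 0 ` free_mod ?C 1"
    then obtain w where w: "v = diff_map ?C 0 w" by auto
    have "aug_map ?C v = tayl (tayl (dec 1 w)) {}"
      unfolding aug_map_eq w by (simp add: tay_def[of _ _ _ _ "{}"] dec_diff_map)
    then show "v \<in> {v \<in> free_mod ?C 0. aug_map ?C v = 0}"
      using w diff_map_free by (simp add: tay_tay[OF inj_r])
  next
    fix v assume v: "v \<in> {v \<in> free_mod ?C 0. aug_map ?C v = 0}"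
    have "tayl (dec 0 v) S = 0" if "S \<subseteq> \<Phi>" for S
      using tayl_dec_other[OF that, of 0 v] v by (cases "S = {}") (auto simp: aug_map_eq)
    then show "v \<in> diff_map ?C 0 ` free_mod ?C 1"
      using kernel_lift[of v 0] v by simp
  qed
  have ker: "diff_map ?C (Suc i) ` free_mod ?C (Suc (Suc i)) =
      {v \<in> free_mod ?C (Suc i). diff_map ?C i v = (\<lambda>_. 0)}" for i
  proof (intro equalityI subsetI)
    fix v assume "v \<in> diff_map ?C (Suc i) ` free_mod ?C (Suc (Suc i))"
    then obtain w where w: "v = diff_map ?C (Suc i) w" by auto
    have "diff_map ?C i v a = 0" for a
    proof (cases "a < card (lev i)")
      case True
      then have S: "en i a \<subseteq> \<Phi>" using en_lev by (auto simp: lev_def)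
      have "diff_map ?C i v a = tayl (dec (Suc i) v) (en i a)"
        using True by (rule diff_map_eq)
      also have "\<dots> = tayl (tayl (dec (Suc (Suc i)) w)) (en i a)"
        unfolding w tay_def[of _ _ _ _ "en i a"] using S by (intro sum.cong) (auto simp: dec_diff_map)
      also have "\<dots> = 0" by (rule tay_tay[OF inj_r finite S])
      finally show ?thesis .
    qed (simp add: diff_map_def mat_apply_def res_complex_def)
    then show "v \<in> {v \<in> free_mod ?C (Suc i). diff_map ?C i v = (\<lambda>_. 0)}"
      using w diff_map_free by auto
  next
    fix v assume v: "v \<in> {v \<in> free_mod ?C (Suc i). diff_map ?C i v = (\<lambda>_. 0)}"
    have "tayl (dec (Suc i) v) S = 0" if "S \<subseteq> \<Phi>" for S
      using dec_diff_map[OF that, of i v] v by (simp add: dec_def split: if_splits)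
    then show "v \<in> diff_map ?C (Suc i) ` free_mod ?C (Suc (Suc i))"
      using kernel_lift[of v "Suc i"] v by simp
  qed
  have "\<forall>b<rk ?C 0. homogeneous (dg ?C 0 b) (aug ?C b)"
    by (simp add: res_complex_def homogeneous_mon)
  moreover have "\<forall>i. \<forall>a<rk ?C i. \<forall>b<rk ?C (Suc i).
      homogeneous (dg ?C (Suc i) b - dg ?C i a) (dmat ?C i a b)"
    unfolding res_complex_def by (auto intro!: homogeneous_entry en_lev)
  ultimately show ?thesis
    unfolding graded_free_resolution_def using aug ker0 ker by blast
qed

end

text \<open>This gives the choice in \<open>graded_betti\<close> a meaning.\<close>

lemma ex_graded_free_resolution:
  "\<exists>C. graded_free_resolution (mon_ideal \<Phi> :: ('v::finite, 'k::field) mpoly set) C"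
proof -
  obtain r :: "'v set \<Rightarrow> nat" where "inj r"
    using finite_imp_inj_to_nat_seg[of "UNIV :: 'v set set"] by auto
  then interpret taylor \<Phi> r by unfold_locales
  show ?thesis using graded_free_resolution_res_complex by blast
qed

section \<open>Bases of quotient spaces\<close>

text \<open>The classes of the \<open>v i\<close> form a basis of Z / B. Stating this with
  coefficients avoids quotient spaces and lets the ambient space and its scalar multiplication
  change from place to place.\<close>

definition qbasis ::
    "('k::field \<Rightarrow> 'x::ab_group_add \<Rightarrow> 'x) \<Rightarrow> 'i set \<Rightarrow> ('i \<Rightarrow> 'x) \<Rightarrow> 'x set \<Rightarrow> 'x set \<Rightarrow> bool" where
  "qbasis s J v Z B \<longleftrightarrow> (\<forall>i\<in>J. v i \<in> Z) \<and> (\<forall>z\<in>Z. \<exists>a. z - (\<Sum>i\<in>J. s (a i) (v i)) \<in> B) \<and>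
     (\<forall>a. (\<Sum>i\<in>J. s (a i) (v i)) \<in> B \<longrightarrow> (\<forall>i\<in>J. a i = 0))"

text \<open>A linear correspondence between \<open>Z\<close> and \<open>Z'\<close> that matches \<open>B\<close> with \<open>B'\<close> identifies the
  quotients.\<close>

lemma qbasis_transport:
  fixes f :: "'x::ab_group_add \<Rightarrow> 'y::ab_group_add" and g :: "'x \<Rightarrow> 'z::ab_group_add"
  assumes basis: "qbasis s1 J v Z B" and fin: "finite J"
    and f_add: "\<And>x y. f (x + y) = f x + f y" and f_scale: "\<And>a x. f (s a x) = s1 a (f x)"
    and g_add: "\<And>x y. g (x + y) = g x + g y" and g_scale: "\<And>a x. g (s a x) = s2 a (g x)"
    and U0: "0 \<in> U" and U_add: "\<And>x y. x \<in> U \<Longrightarrow> y \<in> U \<Longrightarrow> x + y \<in> U"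
    and U_diff: "\<And>x y. x \<in> U \<Longrightarrow> y \<in> U \<Longrightarrow> x - y \<in> U"
    and U_scale: "\<And>a x. x \<in> U \<Longrightarrow> s a x \<in> U"
    and Z: "Z = f ` U" and Z': "Z' = g ` U"
    and B: "\<And>u. u \<in> U \<Longrightarrow> f u \<in> B \<longleftrightarrow> g u \<in> B'"
  shows "\<exists>v'. qbasis s2 J v' Z' B'"
proof -
  have f0: "f 0 = 0" using f_add[of 0 0] by simp
  have g0: "g 0 = 0" using g_add[of 0 0] by simp
  have f_diff: "f (x - y) = f x - f y" for x y using f_add[of "x - y" y] by (simp add: algebra_simps)
  have g_diff: "g (x - y) = g x - g y" for x y using g_add[of "x - y" y] by (simp add: algebra_simps)
  have "\<exists>u. u \<in> U \<and> f u = v i" if "i \<in> J" for i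
    using basis that Z unfolding qbasis_def by (metis imageE)
  \<comment> \<open>\<open>f\<close> and \<open>g\<close> may have kernels, but any lifts will do:
    combinations are tested only through membership in \<open>B\<close> and
    \<open>B'\<close>.\<close>
  then obtain u where u: "\<And>i. i \<in> J \<Longrightarrow> u i \<in> U" "\<And>i. i \<in> J \<Longrightarrow> f (u i) = v i" by metis
  define w where "w a = (\<Sum>i\<in>J. s (a i) (u i))" for a
  have w: "w a \<in> U \<and> f (w a) = (\<Sum>i\<in>J. s1 (a i) (v i)) \<and> g (w a) = (\<Sum>i\<in>J. s2 (a i) (g (u i)))" for a
  proof -
    have "(\<Sum>i\<in>J'. s (a i) (u i)) \<in> U \<and> f (\<Sum>i\<in>J'. s (a i) (u i)) = (\<Sum>i\<in>J'. s1 (a i) (v i)) \<and>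
        g (\<Sum>i\<in>J'. s (a i) (u i)) = (\<Sum>i\<in>J'. s2 (a i) (g (u i)))" if "J' \<subseteq> J" for J'
      using finite_subset[OF that fin] that
    proof (induction J' rule: finite_induct)
      case empty
      then show ?case by (simp add: f0 g0 U0)
    next
      case (insert x F)
      then show ?case by (simp add: f_add g_add f_scale g_scale U_add U_scale u)
    qed
    then show ?thesis unfolding w_def by blast
  qed
  have "qbasis s2 J (\<lambda>i. g (u i)) Z' B'"
    unfolding qbasis_def
  proof (intro conjI ballI allI impI)
    fix i assume "i \<in> J"
    then show "g (u i) \<in> Z'" using Z' u by blast
  next
    fix z' assume "z' \<in> Z'"
    then obtain x where x: "x \<in> U" "z' = g x" using Z' by blast
    then have "f x \<in> Z" using Z by blast
    then obtain a where "f x - (\<Sum>i\<in>J. s1 (a i) (v i)) \<in> B"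
      using basis unfolding qbasis_def by blast
    then have "f (x - w a) \<in> B" by (simp add: f_diff w)
    then have "g (x - w a) \<in> B'" using B U_diff x(1) w by blast
    then show "\<exists>a. z' - (\<Sum>i\<in>J. s2 (a i) (g (u i))) \<in> B'" using x(2) by (auto simp: g_diff w)
  next
    fix a i
    assume "(\<Sum>i\<in>J. s2 (a i) (g (u i))) \<in> B'" and i: "i \<in> J"
    then have "g (w a) \<in> B'" by (simp add: w)
    then have "f (w a) \<in> B" using B w by blast
    then have "(\<Sum>i\<in>J. s1 (a i) (v i)) \<in> B" by (simp add: w)
    then show "a i = 0" using basis i unfolding qbasis_def by blast
  qed
  then show ?thesis by blast
qed

text \<open>A basis of \<open>B\<close> is extended by the \<open>v i\<close> one at a time; the
  span at each stage consists of the vectors congruent modulo \<open>B\<close> to a combination of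
  those adjoined so far. \<open>W\<close> supplies the finiteness.\<close>

lemma (in vector_space) qbasis_dim:
  assumes basis: "qbasis scale J v Z B" and fin: "finite J"
    and Z: "subspace Z" and B: "subspace B" and BZ: "B \<subseteq> Z"
    and W: "finite W" "Z \<subseteq> span W"
  shows "dim Z = dim B + card J"
proof -
  obtain b where b: "b \<subseteq> B" "independent b" "B \<subseteq> span b" "card b = dim B"
    by (rule basis_exists)
  have span_b: "span b = B" using b(1,3) B span_minimal by blast
  have fin_b: "finite b"
    using independent_span_bound[OF W(1) b(2)] b(1) BZ W(2) by blast
  have "independent (b \<union> v ` J') \<and> card (b \<union> v ` J') = card b + card J' \<and>
      span (b \<union> v ` J') = {x. \<exists>a. x - (\<Sum>i\<in>J'. scale (a i) (v i)) \<in> B}" if "J' \<subseteq> J" for J'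
    using finite_subset[OF that fin] that
  proof (induction J' rule: finite_induct)
    case empty
    then show ?case using b span_b by simp
  next
    case (insert k J')
    let ?S = "b \<union> v ` J'"
    have k: "k \<in> J" "J' \<subseteq> J" "k \<notin> J'" using insert by auto
    have IH: "independent ?S" "card ?S = card b + card J'"
      "span ?S = {x. \<exists>a. x - (\<Sum>i\<in>J'. scale (a i) (v i)) \<in> B}"
      using insert by auto
    have notin: "v k \<notin> span ?S"
    proof
      assume "v k \<in> span ?S"
      then obtain a where a: "v k - (\<Sum>i\<in>J'. scale (a i) (v i)) \<in> B" using IH(3) by auto
      \<comment> \<open>The entries 1 at \<open>k\<close> and \<open>- a\<close> on
        \<open>J'\<close> turn the supposed dependence into a combination in \<open>B\<close> with a
        nonzero coefficient.\<close>
      define a' where "a' i = (if i = k then 1 else if i \<in> J' then - a i else 0)" for i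
      have "(\<Sum>i\<in>J. scale (a' i) (v i)) = (\<Sum>i\<in>insert k J'. scale (a' i) (v i))"
        by (rule sum.mono_neutral_right) (use fin k in \<open>auto simp: a'_def\<close>)
      also have "\<dots> = v k + (\<Sum>i\<in>J'. scale (a' i) (v i))"
        using k insert.hyps by (simp add: a'_def)
      also have "\<dots> = v k + (\<Sum>i\<in>J'. - scale (a i) (v i))"
        using k by (intro arg_cong2[where f = plus] sum.cong) (auto simp: a'_def)
      also have "\<dots> = v k - (\<Sum>i\<in>J'. scale (a i) (v i))"
        by (simp add: sum_negf)
      finally have "(\<Sum>i\<in>J. scale (a' i) (v i)) \<in> B" using a by simp
      then have "a' k = 0" using basis k(1) unfolding qbasis_def by blast
      then show False by (simp add: a'_def)
    qed
    have ins: "b \<union> v ` insert k J' = insert (v k) ?S" by auto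
    have "independent (insert (v k) ?S)"
      using notin IH(1) by (rule independent_insertI)
    moreover have "card (insert (v k) ?S) = card b + card (insert k J')"
    proof -
      have vk: "v k \<notin> ?S" using notin by (rule contrapos_nn) (rule span_base)
      have finS: "finite ?S" using fin_b insert.hyps(1) by (intro finite_UnI finite_imageI)
      have "card (insert (v k) ?S) = Suc (card ?S)" by (rule card_insert_disjoint[OF finS vk])
      then show ?thesis
        by (simp only: IH(2) card_insert_disjoint[OF insert.hyps(1,2)] add_Suc_right)
    qed
    moreover have "span (insert (v k) ?S) = {x. \<exists>a. x - (\<Sum>i\<in>insert k J'. scale (a i) (v i)) \<in> B}"
    proof (intro equalityI subsetI CollectI)
      fix x assume "x \<in> span (insert (v k) ?S)"
      then obtain c where "x - scale c (v k) \<in> span ?S" unfolding span_insert by blast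
      then obtain a where a: "x - scale c (v k) - (\<Sum>i\<in>J'. scale (a i) (v i)) \<in> B" using IH(3) by auto
      have "(\<Sum>i\<in>J'. scale ((a(k := c)) i) (v i)) = (\<Sum>i\<in>J'. scale (a i) (v i))"
        using k by (intro sum.cong) auto
      then have eq: "(\<Sum>i\<in>insert k J'. scale ((a(k := c)) i) (v i)) =
          scale c (v k) + (\<Sum>i\<in>J'. scale (a i) (v i))"
        by (simp only: sum.insert[OF insert.hyps(1,2)] fun_upd_same)
      show "\<exists>a. x - (\<Sum>i\<in>insert k J'. scale (a i) (v i)) \<in> B"
        using a[unfolded diff_diff_add, folded eq] by (rule exI[where P = "\<lambda>a. x - (\<Sum>i\<in>insert k J'. scale (a i) (v i)) \<in> B"])
    next
      fix x assume "x \<in> {x. \<exists>a. x - (\<Sum>i\<in>insert k J'. scale (a i) (v i)) \<in> B}"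
      then obtain a where "x - (\<Sum>i\<in>insert k J'. scale (a i) (v i)) \<in> B" by auto
      then have "x - scale (a k) (v k) - (\<Sum>i\<in>J'. scale (a i) (v i)) \<in> B"
        by (simp only: sum.insert[OF insert.hyps(1,2)] diff_diff_add)
      then have "x - scale (a k) (v k) \<in> span ?S" using IH(3) by auto
      then show "x \<in> span (insert (v k) ?S)" unfolding span_insert by blast
    qed
    ultimately show ?case unfolding ins by (intro conjI)
  qed
  note J = this[OF order_refl]
  have ind: "independent (b \<union> v ` J)"
    using J by (rule conjunct1)
  have card: "card (b \<union> v ` J) = card b + card J"
    using J by (elim conjE)
  have span: "span (b \<union> v ` J) = {x. \<exists>a. x - (\<Sum>i\<in>J. scale (a i) (v i)) \<in> B}"
    using J by (elim conjE)
  have "dim Z = card b + card J"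
  proof (rule dim_unique[OF _ _ ind card])
    show "b \<union> v ` J \<subseteq> Z"
      using basis by (intro Un_least subset_trans[OF b(1) BZ] image_subsetI) (simp add: qbasis_def)
    show "Z \<subseteq> span (b \<union> v ` J)"
      unfolding span using basis by (simp add: qbasis_def subset_iff)
  qed
  then show ?thesis using b(4) by simp
qed

section \<open>Computing Tor with the Koszul complex\<close>

type_synonym ('v, 'k) kchain = "'v set \<Rightarrow> nat \<Rightarrow> ('v, 'k) mpoly"

definition kscale :: "'k::field \<Rightarrow> ('v, 'k) kchain \<Rightarrow> ('v, 'k) kchain" where
  "kscale a c = (\<lambda>S b. Poly_Mapping.single 0 a * c S b)"

text \<open>The projection to the residue field, with values kept as constant polynomials: k
  \<otimes> F then lives in the same type as the rest of the double complex.\<close>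

definition const :: "('v, 'k::comm_ring_1) mpoly \<Rightarrow> ('v, 'k) mpoly" where
  "const p = Poly_Mapping.single 0 (coeff_at p 0)"

lemma const_0 [simp]: "const 0 = 0"
  by (simp add: const_def)

lemma const_add: "const (p + q) = const p + const q"
  by (simp add: const_def lookup_add single_add)

lemma const_sum: "const (\<Sum>a\<in>A. f a) = (\<Sum>a\<in>A. const (f a))"
  by (induction A rule: infinite_finite_induct) (auto simp: const_add)

lemma const_mult: "const (p * q :: ('v::finite, 'k::comm_ring_1) mpoly) = const p * const q"
  by (simp add: const_def coeff_0_mult mult_single)

lemma const_single [simp]: "const (Poly_Mapping.single 0 a) = Poly_Mapping.single 0 a"
  by (simp add: const_def)

lemma const_const [simp]: "const (const p) = const p"
  by (simp add: const_def)

lemma coeff_const: "coeff_at (const p) 0 = coeff_at p 0"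
  by (simp add: const_def)

lemma const_eq_0_iff: "const p = 0 \<longleftrightarrow> coeff_at p 0 = 0"
  by (metis coeff_const const_def lookup_zero single_zero)

lemma const_neq_0_homogeneous:
  "homogeneous e (p :: ('v::finite, 'k::comm_ring_1) mpoly) \<Longrightarrow> const p \<noteq> 0 \<Longrightarrow> e = 0"
  using homogeneous_coeff_0 const_eq_0_iff by blast

lemma homogeneous_const: "homogeneous 0 (const (p :: ('v::finite, 'k::comm_ring_1) mpoly))"
  unfolding const_def by (rule homogeneous_single_0)

locale koszul =
  fixes \<Phi> :: "'v::finite set set" and C :: "('v, 'k::field) free_complex"
    and r :: "'v \<Rightarrow> nat" and j :: int
  assumes resolution: "graded_free_resolution (mon_ideal \<Phi>) C" and inj_r: "inj r"
begin

text \<open>The resolution with the ring itself added as the term of index \<open>0\<close>.\<close>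

definition rk' :: "nat \<Rightarrow> nat" where
  "rk' l = (case l of 0 \<Rightarrow> 1 | Suc l \<Rightarrow> rk C l)"

definition dg' :: "nat \<Rightarrow> nat \<Rightarrow> int" where
  "dg' l b = (case l of 0 \<Rightarrow> 0 | Suc l \<Rightarrow> dg C l b)"

definition mat :: "nat \<Rightarrow> nat \<Rightarrow> nat \<Rightarrow> ('v, 'k) mpoly" where
  "mat l a b = (case l of 0 \<Rightarrow> aug C b | Suc l \<Rightarrow> dmat C l a b)"

definition D :: "nat \<Rightarrow> (nat \<Rightarrow> ('v, 'k) mpoly) \<Rightarrow> nat \<Rightarrow> ('v, 'k) mpoly" where
  "D l v = (\<lambda>a. if a < rk' l then \<Sum>b<rk' (Suc l). mat l a b * v b else 0)"

text \<open>The image of the augmentation is the ideal, so for \<open>l = 0\<close> membership in it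
  plays the part of a kernel condition.\<close>

definition ker :: "nat \<Rightarrow> (nat \<Rightarrow> ('v, 'k) mpoly) \<Rightarrow> bool" where
  "ker l v \<longleftrightarrow> v \<in> coord_vecs {..<rk' l} \<and>
     (case l of 0 \<Rightarrow> v 0 \<in> mon_ideal \<Phi> | Suc l' \<Rightarrow> D l' v = (\<lambda>_. 0))"

lemma homogeneous_mat:
  "a < rk' l \<Longrightarrow> b < rk' (Suc l) \<Longrightarrow> homogeneous (dg' (Suc l) b - dg' l a) (mat l a b)"
  using resolution unfolding graded_free_resolution_def rk'_def dg'_def mat_def
  by (cases l) auto

text \<open>With the shifted indices the three exactness clauses of a resolution become one
  statement.\<close>

lemma D_image: "D l ` coord_vecs {..<rk' (Suc l)} = {v. ker l v}"
proof -
  have D0: "D 0 v = (\<lambda>a. if a = 0 then aug_map C v else 0)" for v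
    by (auto simp: D_def rk'_def mat_def aug_map_def)
  have DS: "D (Suc l) v = diff_map C l v" for l v
    by (auto simp: D_def rk'_def mat_def diff_map_def mat_apply_def)
  have free: "coord_vecs {..<rk' (Suc l)} = free_mod C l" for l
    by (simp add: free_mod_def rk'_def)
  show ?thesis
  proof (cases l)
    case 0
    have "aug_map C ` free_mod C 0 = mon_ideal \<Phi>"
      using resolution by (simp add: graded_free_resolution_def)
    then have "(\<lambda>p a. if a = 0 then p else 0) ` mon_ideal \<Phi> =
        (\<lambda>p a. if a = 0 then p else 0) ` aug_map C ` free_mod C 0" by simp
    also have "\<dots> = D 0 ` free_mod C 0"
      unfolding image_image by (rule image_cong) (simp_all add: D0)
    finally have "D 0 ` free_mod C 0 = (\<lambda>p a. if a = 0 then p else 0) ` mon_ideal \<Phi>" ..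
    also have "\<dots> = {v. ker 0 v}"
    proof (intro equalityI subsetI)
      fix v assume v: "v \<in> {v. ker 0 v}"
      then have "v = (\<lambda>a. if a = 0 then v 0 else 0)"
        by (auto simp: ker_def coord_vecs_def rk'_def)
      then show "v \<in> (\<lambda>p a. if a = 0 then p else 0) ` mon_ideal \<Phi>"
        using v by (auto simp: ker_def)
    qed (auto simp: ker_def coord_vecs_def rk'_def)
    finally show ?thesis using 0 free by simp
  next
    case (Suc l')
    show ?thesis
    proof (cases l')
      case 0
      have "diff_map C 0 ` free_mod C 1 = {v \<in> free_mod C 0. aug_map C v = 0}"
        using resolution by (simp add: graded_free_resolution_def)
      moreover have "D 0 v = (\<lambda>_. 0) \<longleftrightarrow> aug_map C v = 0" for v
        unfolding D0 by (auto simp: fun_eq_iff)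
      ultimately show ?thesis
        using Suc 0 by (simp add: ker_def free DS[abs_def])
    next
      case (Suc l'')
      then show ?thesis
        using \<open>l = Suc l'\<close> resolution by (simp add: ker_def free DS[abs_def] graded_free_resolution_def)
    qed
  qed
qed

lemma D_D: "D l (D (Suc l) v) = (\<lambda>_. 0)"
proof -
  \<comment> \<open>\<open>D\<close> ignores entries beyond the rank, so truncation brings
    \<open>v\<close> into the free module without changing the image.\<close>
  define v' where "v' b = (if b < rk' (Suc (Suc l)) then v b else 0)" for b
  have "D (Suc l) v' = D (Suc l) v" by (auto simp: D_def v'_def)
  moreover have "v' \<in> coord_vecs {..<rk' (Suc (Suc l))}" by (simp add: v'_def coord_vecs_def)
  ultimately have "ker (Suc l) (D (Suc l) v)" using D_image[of "Suc l"] by (metis image_eqI mem_Collect_eq)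
  then show ?thesis by (simp add: ker_def)
qed

lemma D_0_ideal: "D 0 v 0 \<in> mon_ideal \<Phi>"
proof -
  define v' where "v' b = (if b < rk' (Suc 0) then v b else 0)" for b
  have "D 0 v' = D 0 v" by (auto simp: D_def v'_def)
  moreover have "v' \<in> coord_vecs {..<rk' (Suc 0)}" by (simp add: v'_def coord_vecs_def)
  ultimately have "ker 0 (D 0 v)" using D_image[of 0] by (metis image_eqI mem_Collect_eq)
  then show ?thesis by (simp add: ker_def)
qed

lemma D_homogeneous:
  assumes "\<And>b. homogeneous (e - dg' (Suc l) b) (v b)"
  shows "homogeneous (e - dg' l a) (D l v a)"
proof -
  have "homogeneous (e - dg' l a) (mat l a b * v b)" if "a < rk' l" "b < rk' (Suc l)" for b
    using homogeneous_mult[OF homogeneous_mat[OF that] assms[of b]] by simp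
  then show ?thesis by (auto simp: D_def intro!: homogeneous_sum)
qed

text \<open>Any preimage can be replaced by its components of the right degrees, because the matrix
  is homogeneous and \<open>v\<close> equals its own component.\<close>

lemma D_lift:
  assumes v: "ker l v" "\<And>b. homogeneous (e - dg' l b) (v b)"
  obtains w where "w \<in> coord_vecs {..<rk' (Suc l)}" "D l w = v"
    "\<And>b. homogeneous (e - dg' (Suc l) b) (w b)"
proof -
  obtain w where w: "w \<in> coord_vecs {..<rk' (Suc l)}" "D l w = v"
    using v(1) D_image[of l] by (metis imageE mem_Collect_eq)
  define w' where "w' b = hpart (e - dg' (Suc l) b) (w b)" for b
  have "D l w' a = v a" for a
  proof (cases "a < rk' l")
    case True
    have "D l w' a = (\<Sum>b<rk' (Suc l). mat l a b * hpart (e - dg' (Suc l) b) (w b))"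
      using True by (simp add: D_def w'_def)
    also have "\<dots> = (\<Sum>b<rk' (Suc l). hpart (e - dg' l a) (mat l a b * w b))"
    proof (rule sum.cong[OF refl])
      fix b assume "b \<in> {..<rk' (Suc l)}"
      then have h: "homogeneous (dg' (Suc l) b - dg' l a) (mat l a b)"
        using True homogeneous_mat by simp
      show "mat l a b * hpart (e - dg' (Suc l) b) (w b) = hpart (e - dg' l a) (mat l a b * w b)"
        using hpart_mult[OF h, of "e - dg' (Suc l) b" "w b"] by simp
    qed
    also have "\<dots> = hpart (e - dg' l a) (v a)"
      using True w(2) by (auto simp: D_def hpart_sum)
    also have "\<dots> = v a" using v(2) by (rule hpart_homogeneous)
    finally show ?thesis .
  next
    case False
    then show ?thesis using w(2) by (auto simp: D_def)
  qed
  then have "D l w' = v" by blast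
  moreover have "w' \<in> coord_vecs {..<rk' (Suc l)}"
    using w(1) by (simp add: coord_vecs_def w'_def)
  ultimately show ?thesis using that by (simp add: w'_def homogeneous_hpart)
qed

section \<open>The double complex\<close>

abbreviation kosz :: "('v set \<Rightarrow> ('v, 'k) mpoly) \<Rightarrow> 'v set \<Rightarrow> ('v, 'k) mpoly" where
  "kosz \<equiv> tay UNIV (\<lambda>x. {x}) r"

text \<open>The degree \<open>j\<close> part of the double complex \<open>K \<otimes> F\<close>: the term of index \<open>(Suc p, Suc l)\<close>
  is \<open>K\<^sub>p \<otimes> F\<^sub>l\<close>, the row of index \<open>0\<close> is \<open>k \<otimes> F\<close>, embedded as constant polynomials, and the
  column of index \<open>0\<close> is \<open>K \<otimes> I\<close>.\<close>

definition Y :: "nat \<Rightarrow> nat \<Rightarrow> ('v, 'k) kchain set" where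
  "Y p l = (case p of
     0 \<Rightarrow> {c. \<forall>S b. c S b \<noteq> 0 \<longrightarrow> S = {} \<and> b < rk' l \<and> dg' l b = j \<and> const (c S b) = c S b}
   | Suc p \<Rightarrow> {c. (\<forall>S b. c S b \<noteq> 0 \<longrightarrow> card S = p \<and> b < rk' l) \<and>
       (\<forall>S b. homogeneous (j - int p - dg' l b) (c S b)) \<and>
       (l = 0 \<longrightarrow> (\<forall>S. c S 0 \<in> mon_ideal \<Phi>))})"

text \<open>The row of index 1 holds K_0, whose map to the row of index 0 is the augmentation to k,
  that is, the constant coefficient.\<close>

definition dK :: "nat \<Rightarrow> ('v, 'k) kchain \<Rightarrow> ('v, 'k) kchain" where
  "dK p c = (case p of 0 \<Rightarrow> 0
   | Suc p \<Rightarrow> (case p of 0 \<Rightarrow> (\<lambda>S b. if S = {} then const (c {} b) else 0)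
     | Suc _ \<Rightarrow> (\<lambda>S b. kosz (\<lambda>T. c T b) S)))"

text \<open>No alternating sign occurs: the squares commute (\<open>dK_dF\<close>), which suffices
  because no total complex is formed. In row 0 the constant coefficients of the matrices give F
  \<otimes> k.\<close>

definition dF :: "nat \<Rightarrow> nat \<Rightarrow> ('v, 'k) kchain \<Rightarrow> ('v, 'k) kchain" where
  "dF p l c = (case p of
     0 \<Rightarrow> (\<lambda>S a. if a < rk' l then \<Sum>b<rk' (Suc l). const (mat l a b) * c S b else 0)
   | Suc _ \<Rightarrow> (\<lambda>S. D l (c S)))"

definition Zk :: "nat \<Rightarrow> nat \<Rightarrow> ('v, 'k) kchain set" where
  "Zk p l = {z \<in> Y p l. dK p z = 0 \<and> (case l of 0 \<Rightarrow> True | Suc l' \<Rightarrow> dF p l' z = 0)}"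

text \<open>One formula covers both ends of the staircase: in column 0 \<open>dF\<close> is onto K
  \<otimes> I, leaving the boundaries of \<open>dK\<close>; in row 0 the two maps can be exchanged
  and \<open>dK\<close> is onto, leaving the boundaries of \<open>dF\<close>.\<close>

definition Bk :: "nat \<Rightarrow> nat \<Rightarrow> ('v, 'k) kchain set" where
  "Bk p l = (\<lambda>w. dK (Suc p) (dF (Suc p) l w)) ` Y (Suc p) (Suc l)"

lemma dK_0: "dK 0 c = 0"
  by (simp add: dK_def)

lemma dK_1: "dK (Suc 0) c = (\<lambda>S b. if S = {} then const (c {} b) else 0)"
  by (simp add: dK_def)

lemma dK_SS: "dK (Suc (Suc p)) c = (\<lambda>S b. kosz (\<lambda>T. c T b) S)"
  by (simp add: dK_def)

lemma dF_0: "dF 0 l c = (\<lambda>S a. if a < rk' l then \<Sum>b<rk' (Suc l). const (mat l a b) * c S b else 0)"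
  by (simp add: dF_def)

lemma dF_S: "dF (Suc p) l c = (\<lambda>S. D l (c S))"
  by (simp add: dF_def)

lemma dK_add: "dK p (x + y) = dK p x + dK p y"
  by (auto simp: dK_def fun_eq_iff tay_add const_add split: nat.split)

lemma dK_scale: "dK p (kscale a x) = kscale a (dK p x)"
  by (auto simp: dK_def kscale_def fun_eq_iff tay_mult const_mult split: nat.split)

lemma dF_add: "dF p l (x + y) = dF p l x + dF p l y"
  by (auto simp: dF_def fun_eq_iff D_def distrib_left sum.distrib split: nat.split)

lemma dF_scale: "dF p l (kscale a x) = kscale a (dF p l x)"
  by (auto simp: dF_def kscale_def fun_eq_iff D_def sum_distrib_left ac_simps split: nat.split)

lemma additive_diff:
  fixes f :: "'x::ab_group_add \<Rightarrow> 'y::ab_group_add"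
  assumes "\<And>x y. f (x + y) = f x + f y"
  shows "f (x - y) = f x - f y"
  using assms[of "x - y" y] by (simp add: algebra_simps)

lemmas dK_diff = additive_diff[of "dK p" for p, OF dK_add]
lemmas dF_diff = additive_diff[of "dF p l" for p l, OF dF_add]

lemma dK_zero: "dK p 0 = 0"
  using dK_add[of p 0 0] by simp

lemma dF_zero: "dF p l 0 = 0"
  using dF_add[of p l 0 0] by simp

lemma kscale_minus: "kscale (-1) c = - c"
  by (simp add: kscale_def fun_eq_iff single_uminus)

lemma Y_zero: "0 \<in> Y p l"
  by (cases p) (simp_all add: Y_def)

lemma Y_add:
  assumes "x \<in> Y p l" "y \<in> Y p l"
  shows "x + y \<in> Y p l"
proof (cases p)
  case 0
  have "S = {} \<and> b < rk' l \<and> dg' l b = j \<and> const (x S b + y S b) = x S b + y S b"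
    if "x S b + y S b \<noteq> 0" for S b
  proof -
    have "x S b \<noteq> 0 \<or> y S b \<noteq> 0" using that by auto
    moreover have "const (x S b) = x S b" "const (y S b) = y S b"
      using assms 0 by (cases "x S b = 0"; cases "y S b = 0"; simp add: Y_def)+
    ultimately show ?thesis using assms 0 by (auto simp: Y_def const_add)
  qed
  then show ?thesis using 0 by (simp add: Y_def)
next
  case (Suc q)
  have "card S = q \<and> b < rk' l" if "x S b + y S b \<noteq> 0" for S b
  proof -
    have "x S b \<noteq> 0 \<or> y S b \<noteq> 0" using that by auto
    then show ?thesis using assms Suc by (auto simp: Y_def)
  qed
  then show ?thesis using assms Suc by (simp add: Y_def homogeneous_add mon_ideal_add)
qed

lemma Y_scale: "x \<in> Y p l \<Longrightarrow> kscale a x \<in> Y p l"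
proof (cases p)
  case 0
  assume x: "x \<in> Y p l"
  have nz: "x S b \<noteq> 0" if "Poly_Mapping.single 0 a * x S b \<noteq> 0" for S b using that by auto
  show ?thesis using x 0 by (auto simp: Y_def kscale_def const_mult dest!: nz)
next
  case (Suc q)
  assume x: "x \<in> Y p l"
  have nz: "x S b \<noteq> 0" if "Poly_Mapping.single 0 a * x S b \<noteq> 0" for S b using that by auto
  show ?thesis
    using x Suc by (auto simp: Y_def kscale_def homogeneous_scale mon_ideal_mult dest!: nz)
qed

lemma Y_diff: "x \<in> Y p l \<Longrightarrow> y \<in> Y p l \<Longrightarrow> x - y \<in> Y p l"
  using Y_add[of x p l "kscale (-1) y"] Y_scale[of y p l "-1"] by (simp add: kscale_minus)

lemma dF_Y:
  assumes "c \<in> Y (Suc p) (Suc l)"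
  shows "dF (Suc p) l c \<in> Y (Suc p) l"
proof -
  have "card S = p \<and> a < rk' l" if nz: "D l (c S) a \<noteq> 0" for S a
  proof -
    have "a < rk' l" using nz by (auto simp: D_def split: if_splits)
    moreover obtain b where "c S b \<noteq> 0"
      using nz by (cases "\<forall>b. c S b = 0") (auto simp: D_def split: if_splits)
    ultimately show ?thesis using assms by (auto simp: Y_def)
  qed
  moreover have "homogeneous (j - int p - dg' l a) (D l (c S) a)" for S a
    using assms by (intro D_homogeneous) (simp add: Y_def)
  ultimately show ?thesis by (simp add: Y_def dF_S D_0_ideal)
qed

lemma homogeneous_kosz:
  fixes c :: "'v set \<Rightarrow> ('v, 'k) mpoly"
  assumes "\<And>S. homogeneous (e - int (card S)) (c S)"
  shows "homogeneous (e - int (card S)) (kosz c S)"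
  using homogeneous_tay[of e "\<lambda>x. {x}" c S UNIV r] assms by simp

lemma kosz_support:
  assumes "kosz c S \<noteq> 0"
  obtains x where "x \<notin> S" "c (insert x S) \<noteq> 0"
proof -
  obtain x where "x \<in> UNIV - S" "sg r x S * (mon ({x} - \<Union>((\<lambda>x. {x}) ` S)) * c (insert x S)) \<noteq> 0"
    using assms unfolding tay_def by (rule sum.not_neutral_contains_not_neutral)
  then show ?thesis using that[of x] by (cases "c (insert x S) = 0") auto
qed

lemma homogeneous_chain:
  assumes "c \<in> Y (Suc p) l"
  shows "homogeneous (j - dg' l b - int (card S)) (c S b)"
proof (cases "c S b = 0")
  case False
  then have "card S = p" using assms by (auto simp: Y_def)
  moreover have "homogeneous (j - int p - dg' l b) (c S b)" using assms by (auto simp: Y_def)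
  ultimately show ?thesis by (simp add: algebra_simps)
qed simp

lemma dK_Y:
  assumes c: "c \<in> Y (Suc p) (Suc l)"
  shows "dK (Suc p) c \<in> Y p (Suc l)"
proof (cases p)
  case 0
  have "b < rk' (Suc l) \<and> dg' (Suc l) b = j" if "const (c {} b) \<noteq> 0" for b
  proof -
    have "c {} b \<noteq> 0" using that by auto
    moreover have "homogeneous (j - dg' (Suc l) b) (c {} b)"
      using c 0 by (simp add: Y_def)
    ultimately show ?thesis
      using c 0 const_neq_0_homogeneous that by (fastforce simp: Y_def)
  qed
  then show ?thesis using 0 by (simp add: Y_def dK_1)
next
  case (Suc q)
  have "card S = q \<and> b < rk' (Suc l)" if nz: "kosz (\<lambda>T. c T b) S \<noteq> 0" for S b
  proof -
    obtain x where "x \<notin> S" "c (insert x S) b \<noteq> 0" using nz by (rule kosz_support)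
    then show ?thesis using c Suc by (fastforce simp: Y_def)
  qed
  moreover have "homogeneous (j - int q - dg' (Suc l) b) (kosz (\<lambda>T. c T b) S)" for S b
  proof (cases "kosz (\<lambda>T. c T b) S = 0")
    case False
    then have "card S = q" using calculation by blast
    then show ?thesis
      using homogeneous_kosz[of "j - dg' (Suc l) b" "\<lambda>T. c T b" S] homogeneous_chain[OF c]
      by (simp add: algebra_simps)
  qed simp
  ultimately show ?thesis using Suc by (simp add: Y_def dK_SS)
qed

lemma dK_dK: "dK p (dK (Suc p) c) = 0"
proof (cases p)
  case 0
  then show ?thesis by (simp add: dK_0)
next
  case (Suc q)
  show ?thesis
  proof (cases q)
    case 0
    have "const (kosz (\<lambda>T. c T b) {}) = 0" for b
    proof -
      have "const (mon {x} :: ('v, 'k) mpoly) = 0" for x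
        using const_neq_0_homogeneous[OF homogeneous_mon[of "{x}"]] by fastforce
      then show ?thesis by (simp add: tay_def const_sum const_mult)
    qed
    then show ?thesis using Suc 0 by (simp add: dK_1 dK_SS fun_eq_iff)
  next
    case (Suc q')
    then show ?thesis using \<open>p = Suc q\<close> by (simp add: dK_SS fun_eq_iff tay_tay[OF inj_r])
  qed
qed

lemma dF_dF: "dF (Suc p) l (dF (Suc p) (Suc l) c) = 0"
  by (simp add: dF_S D_D fun_eq_iff)

text \<open>The Koszul differential is linear over R and \<open>D\<close> acts by ring elements; in
  the lowest row the reason is multiplicativity of \<open>const\<close>.\<close>

lemma dK_dF: "dK (Suc p) (dF (Suc p) l c) = dF p l (dK (Suc p) c)"
proof (cases p)
  case 0
  then show ?thesis
    by (auto simp: dK_1 dF_0 dF_S D_def fun_eq_iff const_sum const_mult)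
next
  case (Suc q)
  have "kosz (\<lambda>T. D l (c T) a) S = D l (\<lambda>b. kosz (\<lambda>T. c T b) S) a" for S a
  proof (cases "a < rk' l")
    case True
    then show ?thesis
      using tay_sum_mult[of UNIV "\<lambda>x. {x}" r "\<lambda>b. mat l a b" "\<lambda>T b. c T b" "{..<rk' (Suc l)}" S]
      by (simp add: D_def)
  next
    case False
    then show ?thesis by (simp add: D_def tay_def)
  qed
  then show ?thesis using Suc by (simp add: dK_SS dF_S)
qed

section \<open>Exactness along rows and columns\<close>

text \<open>The Koszul modules are free, so exactness of the augmented resolution applies to each
  coordinate \<open>S\<close> separately. In column 0 this is surjectivity onto K \<otimes>
  I.\<close>

lemma dF_exact:
  assumes y: "y \<in> Y (Suc p) l" and cyc: "case l of 0 \<Rightarrow> True | Suc l' \<Rightarrow> dF (Suc p) l' y = 0"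
  shows "\<exists>u\<in>Y (Suc p) (Suc l). dF (Suc p) l u = y"
proof -
  have "\<exists>w. (card S \<noteq> p \<longrightarrow> w = (\<lambda>_. 0)) \<and> w \<in> coord_vecs {..<rk' (Suc l)} \<and> D l w = y S \<and>
      (\<forall>b. homogeneous (j - int p - dg' (Suc l) b) (w b))" for S
  proof (cases "card S = p")
    case True
    have "ker l (y S)"
      using y cyc by (cases l) (auto simp: ker_def coord_vecs_def Y_def dF_S fun_eq_iff)
    moreover have "homogeneous (j - int p - dg' l b) (y S b)" for b
      using y by (simp add: Y_def)
    ultimately obtain w where "w \<in> coord_vecs {..<rk' (Suc l)}" "D l w = y S"
      "\<And>b. homogeneous (j - int p - dg' (Suc l) b) (w b)"
      using D_lift[of l "y S" "j - int p"] by blast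
    then show ?thesis using True by blast
  next
    case False
    then have "y S = (\<lambda>_. 0)" using y by (auto simp: Y_def)
    then show ?thesis by (intro exI[of _ "\<lambda>_. 0"]) (simp add: coord_vecs_def D_def fun_eq_iff)
  qed
  then obtain u where u: "\<And>S. card S \<noteq> p \<longrightarrow> u S = (\<lambda>_. 0)"
    "\<And>S. u S \<in> coord_vecs {..<rk' (Suc l)}" "\<And>S. D l (u S) = y S"
    "\<And>S b. homogeneous (j - int p - dg' (Suc l) b) (u S b)" by metis
  have "card S = p \<and> b < rk' (Suc l)" if "u S b \<noteq> 0" for S b
    using u(1)[of S] u(2)[of S] that by (auto simp: coord_vecs_def)
  then have "u \<in> Y (Suc p) (Suc l)" using u(4) by (simp add: Y_def)
  moreover have "dF (Suc p) l u = y" by (simp add: dF_S u(3))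
  ultimately show ?thesis by blast
qed

text \<open>For each basis element of F_l this is exactness of the augmented Koszul complex, the
  case of singletons in \<open>tay_exact\<close>.\<close>

lemma dK_exact:
  assumes x: "x \<in> Y p (Suc l)" and cyc: "dK p x = 0"
  shows "\<exists>u\<in>Y (Suc p) (Suc l). dK (Suc p) u = x"
proof (cases p)
  case 0
  have c: "const (x S b) = x S b" for S b
    using x 0 by (cases "x S b = 0") (simp_all add: Y_def)
  have "homogeneous (j - dg' (Suc l) b) (x S b)" for S b
  proof (cases "x S b = 0")
    case False
    then have "dg' (Suc l) b = j" using x 0 by (simp add: Y_def)
    then show ?thesis using homogeneous_const[of "x S b"] c by simp
  qed simp
  \<comment> \<open>A constant chain is its own lift to K_0.\<close>
  then have "x \<in> Y (Suc p) (Suc l)" using x 0 by (auto simp: Y_def)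
  moreover have "dK (Suc p) x = x"
    using x 0 c by (auto simp: dK_1 fun_eq_iff Y_def)
  ultimately show ?thesis by blast
next
  case (Suc q)
  have "\<exists>w. (b \<ge> rk' (Suc l) \<longrightarrow> w = (\<lambda>_. 0)) \<and> (\<forall>S. w S \<noteq> 0 \<longrightarrow> card S = p) \<and>
      (\<forall>S. homogeneous (j - dg' (Suc l) b - int (card S)) (w S)) \<and>
      (\<forall>S. kosz w S = x S b)" for b
  proof (cases "b < rk' (Suc l)")
    case True
    let ?x = "\<lambda>T. x T b"
    have supp: "card S = q" if "?x S \<noteq> 0" for S using x Suc that by (simp add: Y_def)
    show ?thesis
    proof (rule tay_exact[OF inj_r finite, where c = ?x and p = q and \<Phi> = UNIV and g = "\<lambda>x. {x}"])
      show "S \<subseteq> UNIV \<and> card S = q" if "?x S \<noteq> 0" for S using supp[OF that] by simp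
      show "\<exists>a\<in>UNIV. {a} \<subseteq> Poly_Mapping.keys u"
        if "q = 0" and u: "u \<in> Poly_Mapping.keys (?x {})" for u
      proof -
        \<comment> \<open>At the bottom end the vanishing constant coefficient leaves only exponents
          divisible by some variable, as exactness there requires.\<close>
        have "const (x {} b) = 0"
        proof -
          have "dK (Suc 0) x {} b = 0" using cyc Suc \<open>q = 0\<close> by simp
          then show ?thesis by (simp add: dK_1)
        qed
        then have "u \<noteq> 0" using u by (auto simp: const_eq_0_iff in_keys_iff)
        then have "Poly_Mapping.keys u \<noteq> {}"
          by (metis in_keys_iff empty_iff poly_mapping_eqI lookup_zero)
        then show ?thesis by blast
      qed
      show "kosz ?x S = 0" for S
      proof (cases q)
        case 0
        then have "\<not> card (insert a S) = q" for a by simp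
        then have "?x (insert a S) = 0" for a using supp by blast
        then show ?thesis by (simp add: tay_def)
      next
        case (Suc q')
        then show ?thesis using cyc \<open>p = Suc q\<close> by (simp add: dK_SS fun_eq_iff)
      qed
      fix w assume w: "\<And>S. w S \<noteq> 0 \<Longrightarrow> S \<subseteq> UNIV \<and> card S = Suc q"
        "\<forall>e. (\<forall>S. homogeneous (e - int (card (\<Union>((\<lambda>x. {x}) ` S)))) (?x S)) \<longrightarrow>
          (\<forall>S. homogeneous (e - int (card (\<Union>((\<lambda>x. {x}) ` S)))) (w S))"
        "\<And>S. S \<subseteq> UNIV \<Longrightarrow> kosz w S = ?x S"
      have "homogeneous (j - dg' (Suc l) b - int (card S)) (x S b)" for S
        using homogeneous_chain[of x q "Suc l"] x Suc by simp
      then have "homogeneous (j - dg' (Suc l) b - int (card S)) (w S)" for S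
        using w(2)[rule_format, of "j - dg' (Suc l) b" S] by simp
      then show ?thesis using w True Suc by (intro exI[of _ w]) auto
    qed
  next
    case False
    then have "x S b = 0" for S using x Suc by (auto simp: Y_def)
    then show ?thesis using False by (intro exI[of _ "\<lambda>_. 0"]) (simp add: tay_def)
  qed
  then obtain w where w: "\<And>b. b \<ge> rk' (Suc l) \<longrightarrow> w b = (\<lambda>_. 0)"
    "\<And>b S. w b S \<noteq> 0 \<longrightarrow> card S = p"
    "\<And>b S. homogeneous (j - dg' (Suc l) b - int (card S)) (w b S)"
    "\<And>b S. kosz (w b) S = x S b" by metis
  define u where "u S b = w b S" for S b
  have "card S = p \<and> b < rk' (Suc l)" if "u S b \<noteq> 0" for S b
    using w(1)[of b] w(2)[of b S] that by (cases "b < rk' (Suc l)") (auto simp: u_def)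
  moreover have "homogeneous (j - int p - dg' (Suc l) b) (u S b)" for S b
  proof (cases "u S b = 0")
    case False
    then have "card S = p" using calculation by blast
    then show ?thesis using w(3)[of b S] by (simp add: u_def algebra_simps)
  qed simp
  ultimately have "u \<in> Y (Suc p) (Suc l)" by (simp add: Y_def)
  moreover have "dK (Suc p) u = x"
    using Suc w(4) by (simp add: dK_SS u_def fun_eq_iff)
  ultimately show ?thesis by blast
qed

section \<open>Passage along an antidiagonal\<close>

lemma kscale_zero: "kscale a 0 = 0"
  by (simp add: kscale_def fun_eq_iff)

lemma Zk_zero: "0 \<in> Zk p l"
  by (auto simp: Zk_def Y_zero dK_zero dF_zero split: nat.splits)

lemma Zk_add: "x \<in> Zk p l \<Longrightarrow> y \<in> Zk p l \<Longrightarrow> x + y \<in> Zk p l"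
  by (auto simp: Zk_def Y_add dK_add dF_add split: nat.splits)

lemma Zk_diff: "x \<in> Zk p l \<Longrightarrow> y \<in> Zk p l \<Longrightarrow> x - y \<in> Zk p l"
  by (auto simp: Zk_def Y_diff dK_diff dF_diff split: nat.splits)

lemma Zk_scale: "x \<in> Zk p l \<Longrightarrow> kscale a x \<in> Zk p l"
  by (auto simp: Zk_def Y_scale dK_scale dF_scale kscale_zero split: nat.splits)

text \<open>A common lift to the term of index \<open>(Suc p, Suc l)\<close> relates a cycle in one of the two places
  to a cycle in the other.\<close>

lemma qbasis_step:
  assumes basis: "qbasis kscale J v (Zk (Suc p) l) (Bk (Suc p) l)" and fin: "finite J"
  shows "\<exists>v'. qbasis kscale J v' (Zk p (Suc l)) (Bk p (Suc l))"
proof -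
  define U where "U = {u \<in> Y (Suc p) (Suc l). dF (Suc p) l u \<in> Zk (Suc p) l \<and> dK (Suc p) u \<in> Zk p (Suc l)}"
  show ?thesis
  proof (rule qbasis_transport[where f = "dF (Suc p) l" and g = "dK (Suc p)" and s = kscale and U = U,
        OF basis fin dF_add dF_scale dK_add dK_scale])
    show "0 \<in> U" by (simp add: U_def Y_zero dF_zero dK_zero Zk_zero)
    show "x + y \<in> U" if "x \<in> U" "y \<in> U" for x y
      using that by (simp add: U_def Y_add dF_add dK_add Zk_add)
    show "x - y \<in> U" if "x \<in> U" "y \<in> U" for x y
      using that by (simp add: U_def Y_diff dF_diff dK_diff Zk_diff)
    show "kscale a x \<in> U" if "x \<in> U" for a x
      using that by (simp add: U_def Y_scale dF_scale dK_scale Zk_scale)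
    show "Zk (Suc p) l = dF (Suc p) l ` U"
    proof (intro equalityI subsetI)
      fix y assume y: "y \<in> Zk (Suc p) l"
      then obtain u where u: "u \<in> Y (Suc p) (Suc l)" "dF (Suc p) l u = y"
        using dF_exact[of y p l] by (auto simp: Zk_def)
      have "dF p l (dK (Suc p) u) = 0" using y u(2) by (simp add: Zk_def flip: dK_dF)
      then have "dK (Suc p) u \<in> Zk p (Suc l)"
        using dK_Y[OF u(1)] dK_dK by (simp add: Zk_def)
      then show "y \<in> dF (Suc p) l ` U" using u y by (auto simp: U_def)
    qed (auto simp: U_def)
    show "Zk p (Suc l) = dK (Suc p) ` U"
    proof (intro equalityI subsetI)
      fix x assume x: "x \<in> Zk p (Suc l)"
      then obtain u where u: "u \<in> Y (Suc p) (Suc l)" "dK (Suc p) u = x"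
        using dK_exact[of x p l] by (auto simp: Zk_def)
      have "dK (Suc p) (dF (Suc p) l u) = 0" using x u(2) by (simp add: Zk_def dK_dF)
      then have "dF (Suc p) l u \<in> Zk (Suc p) l"
        using dF_Y[OF u(1)] by (simp add: Zk_def dF_dF split: nat.split)
      then show "x \<in> dK (Suc p) ` U" using u x by (auto simp: U_def)
    qed (auto simp: U_def)
    fix u assume "u \<in> U"
    then have u: "u \<in> Y (Suc p) (Suc l)" by (simp add: U_def)
    show "dF (Suc p) l u \<in> Bk (Suc p) l \<longleftrightarrow> dK (Suc p) u \<in> Bk p (Suc l)"
    proof
      assume "dF (Suc p) l u \<in> Bk (Suc p) l"
      then obtain w where w: "w \<in> Y (Suc (Suc p)) (Suc l)"
        and eq: "dF (Suc p) l u = dK (Suc (Suc p)) (dF (Suc (Suc p)) l w)"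
        by (auto simp: Bk_def)
      \<comment> \<open>Subtracting \<open>dK w\<close> makes the lift a cycle for
        \<open>dF\<close>, and exactness of the row moves it one column further. The converse
        exchanges the two maps.\<close>
      have "dF (Suc p) l (u - dK (Suc (Suc p)) w) = 0"
        using eq by (simp add: dF_diff dK_dF)
      moreover have "u - dK (Suc (Suc p)) w \<in> Y (Suc p) (Suc l)"
        using u dK_Y[OF w] by (rule Y_diff)
      ultimately obtain t where t: "t \<in> Y (Suc p) (Suc (Suc l))"
        "dF (Suc p) (Suc l) t = u - dK (Suc (Suc p)) w"
        using dF_exact[of "u - dK (Suc (Suc p)) w" p "Suc l"] by auto
      have "dK (Suc p) u = dK (Suc p) (dF (Suc p) (Suc l) t)"
        unfolding t(2) by (simp add: dK_diff dK_dK)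
      then show "dK (Suc p) u \<in> Bk p (Suc l)" using t(1) by (auto simp: Bk_def)
    next
      assume "dK (Suc p) u \<in> Bk p (Suc l)"
      then obtain t where t: "t \<in> Y (Suc p) (Suc (Suc l))"
        and eq: "dK (Suc p) u = dK (Suc p) (dF (Suc p) (Suc l) t)"
        by (auto simp: Bk_def)
      have "dK (Suc p) (u - dF (Suc p) (Suc l) t) = 0"
        using eq by (simp add: dK_diff)
      moreover have "u - dF (Suc p) (Suc l) t \<in> Y (Suc p) (Suc l)"
        using u dF_Y[OF t] by (rule Y_diff)
      ultimately obtain w where w: "w \<in> Y (Suc (Suc p)) (Suc l)"
        "dK (Suc (Suc p)) w = u - dF (Suc p) (Suc l) t"
        using dK_exact[of "u - dF (Suc p) (Suc l) t" "Suc p" l] by auto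
      have "dF (Suc p) l u = dK (Suc (Suc p)) (dF (Suc (Suc p)) l w)"
        unfolding dK_dF w(2) by (simp add: dF_diff dF_dF)
      then show "dF (Suc p) l u \<in> Bk (Suc p) l" using w(1) by (auto simp: Bk_def)
    qed
  qed
qed

lemma qbasis_antidiagonal:
  assumes "qbasis kscale J v (Zk (p + q) l) (Bk (p + q) l)" "finite J"
  shows "\<exists>v'. qbasis kscale J v' (Zk p (q + l)) (Bk p (q + l))"
  using assms(1)
proof (induction q arbitrary: v l)
  case 0
  then show ?case by auto
next
  case (Suc q)
  then obtain v' where "qbasis kscale J v' (Zk (p + q) (Suc l)) (Bk (p + q) (Suc l))"
    using qbasis_step[of J v "p + q" l] assms(2) by auto
  from Suc.IH[OF this] show ?case by simp
qed

section \<open>Row 0 and the complex F \<otimes> k\<close>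

definition ev :: "('v, 'k) kchain \<Rightarrow> nat \<Rightarrow> 'k" where
  "ev c = (\<lambda>b. coeff_at (c {} b) 0)"

definition embed :: "(nat \<Rightarrow> 'k) \<Rightarrow> ('v, 'k) kchain" where
  "embed v = (\<lambda>S b. if S = {} then Poly_Mapping.single 0 (v b) else 0)"

lemma ev_embed: "ev (embed v) = v"
  by (simp add: ev_def embed_def)

lemma embed_ev: "c \<in> Y 0 l \<Longrightarrow> embed (ev c) = c"
proof (intro ext)
  fix S b assume c: "c \<in> Y 0 l"
  have "const (c S b) = c S b" using c by (cases "c S b = 0") (simp_all add: Y_def)
  then show "embed (ev c) S b = c S b"
    using c by (auto simp: embed_def ev_def Y_def const_def)
qed

lemma ev_inject: "c \<in> Y 0 l \<Longrightarrow> c' \<in> Y 0 l \<Longrightarrow> ev c = ev c' \<longleftrightarrow> c = c'"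
  by (metis embed_ev)

lemma ev_Y: "c \<in> Y 0 (Suc i) \<Longrightarrow> ev c \<in> tens_mod C i j"
  by (auto simp: ev_def tens_mod_def coord_vecs_def Y_def rk'_def dg'_def)
    (metis lookup_zero)+

lemma embed_Y: "v \<in> tens_mod C i j \<Longrightarrow> embed v \<in> Y 0 (Suc i)"
  by (auto simp: embed_def tens_mod_def coord_vecs_def Y_def rk'_def dg'_def)

lemma embed_Y_1: "v \<in> tens_mod C i j \<Longrightarrow> embed v \<in> Y (Suc 0) (Suc i)"
proof -
  assume v: "v \<in> tens_mod C i j"
  have "homogeneous (j - dg C i b) (Poly_Mapping.single (0 :: 'v \<Rightarrow>\<^sub>0 nat) (v b))" for b
  proof (cases "v b = 0")
    case False
    then have "dg C i b = j" using v by (auto simp: tens_mod_def coord_vecs_def)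
    then show ?thesis by (simp add: homogeneous_single_0)
  qed simp
  then show ?thesis
    using v by (auto simp: embed_def tens_mod_def coord_vecs_def Y_def rk'_def dg'_def)
qed

lemma dF_0_Y:
  assumes "c \<in> Y 0 (Suc l)"
  shows "dF 0 l c \<in> Y 0 l"
proof -
  have const: "const (c S b) = c S b" for S b
    using assms by (cases "c S b = 0") (simp_all add: Y_def)
  have "S = {} \<and> a < rk' l \<and> dg' l a = j" if nz: "dF 0 l c S a \<noteq> 0" for S a
  proof -
    have a: "a < rk' l" using nz by (auto simp: dF_0 split: if_splits)
    then have "(\<Sum>b<rk' (Suc l). const (mat l a b) * c S b) \<noteq> 0" using nz by (simp add: dF_0)
    then obtain b where "b \<in> {..<rk' (Suc l)}" "const (mat l a b) * c S b \<noteq> 0"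
      by (rule sum.not_neutral_contains_not_neutral)
    then have b: "b < rk' (Suc l)" "const (mat l a b) \<noteq> 0" "c S b \<noteq> 0" by auto
    then show ?thesis
      using a const_neq_0_homogeneous[OF homogeneous_mat[OF a b(1)] b(2)] assms
      by (auto simp: Y_def)
  qed
  then show ?thesis by (auto simp: Y_def dF_0 const_sum const_mult const)
qed

lemma ev_dF: "ev (dF 0 (Suc i) c) = tens_diff C i (ev c)"
  by (auto simp: ev_def dF_0 tens_diff_def mat_apply_def rk'_def mat_def lookup_sum coeff_0_mult
      coeff_const fun_eq_iff)

text \<open>The added term k of row 0 lies in degree 0. In all other degrees every chain of index 1
  is a cycle, in agreement with F \<otimes> k, which has no augmentation.\<close>

lemma dF_0_0:
  assumes "j \<noteq> 0" "c \<in> Y 0 (Suc 0)"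
  shows "dF 0 0 c = 0"
proof (intro ext)
  fix S a
  have "dF 0 0 c \<in> Y 0 0" using assms(2) by (rule dF_0_Y)
  then show "dF 0 0 c S a = 0 S a" using assms(1) by (auto simp: Y_def dg'_def)
qed

lemma ev_Zk:
  assumes "j \<noteq> 0"
  shows "ev ` Zk 0 (Suc i) = tens_cycles C i j"
proof -
  have Z: "Zk 0 (Suc i) = {c \<in> Y 0 (Suc i). dF 0 i c = 0}"
    by (simp add: Zk_def dK_0)
  have "ev ` {c \<in> Y 0 (Suc i). dF 0 i c = 0} = tens_cycles C i j"
  proof (cases i)
    case 0
    have "tens_mod C 0 j \<subseteq> ev ` Y 0 (Suc 0)"
      using embed_Y[of _ 0] ev_embed by (metis image_eqI subsetI)
    then show ?thesis
      using 0 ev_Y[of _ 0] assms by (auto simp: tens_cycles_def dF_0_0 cong: conj_cong)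
  next
    case (Suc i')
    have dF: "dF 0 i c = 0 \<longleftrightarrow> tens_diff C i' (ev c) = (\<lambda>_. 0)" if "c \<in> Y 0 (Suc i)" for c
    proof -
      have "dF 0 i c = 0 \<longleftrightarrow> ev (dF 0 i c) = ev 0"
        using ev_inject[OF dF_0_Y[OF that] Y_zero] by simp
      then show ?thesis using Suc by (simp add: ev_dF) (simp add: ev_def)
    qed
    have "tens_cycles C i j = {v \<in> tens_mod C i j. tens_diff C i' v = (\<lambda>_. 0)}"
      using Suc by (simp add: tens_cycles_def)
    moreover have "v \<in> ev ` {c \<in> Y 0 (Suc i). dF 0 i c = 0}"
      if "v \<in> tens_mod C i j" "tens_diff C i' v = (\<lambda>_. 0)" for v
      using that embed_Y[OF that(1)] dF[of "embed v"] by (intro image_eqI[of _ _ "embed v"]) (auto simp: ev_embed)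
    ultimately show ?thesis using ev_Y[of _ i] dF by auto
  qed
  then show ?thesis unfolding Z .
qed

text \<open>The constant chain \<open>embed v\<close> lies in rows 0 and 1 at once and is fixed by
  \<open>dK\<close>; this identifies the composite in \<open>Bk\<close> with the differential of F
  \<otimes> k.\<close>

lemma ev_Bk:
  assumes c: "c \<in> Y 0 (Suc i)"
  shows "ev c \<in> tens_boundaries C i j \<longleftrightarrow> c \<in> Bk 0 (Suc i)"
proof
  assume "ev c \<in> tens_boundaries C i j"
  then obtain v where v: "v \<in> tens_mod C (Suc i) j" "ev c = tens_diff C i v"
    by (auto simp: tens_boundaries_def)
  have "dK (Suc 0) (embed v) = embed v"
    by (auto simp: dK_1 embed_def fun_eq_iff)
  then have eq: "dK (Suc 0) (dF (Suc 0) (Suc i) (embed v)) = dF 0 (Suc i) (embed v)"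
    by (simp add: dK_dF)
  have "ev (dF 0 (Suc i) (embed v)) = ev c" by (simp add: ev_dF ev_embed v(2))
  then have "dF 0 (Suc i) (embed v) = c"
    using ev_inject[OF dF_0_Y[OF embed_Y[OF v(1)]] c] by simp
  then show "c \<in> Bk 0 (Suc i)"
    unfolding Bk_def using eq embed_Y_1[OF v(1)] by (metis image_eqI)
next
  assume "c \<in> Bk 0 (Suc i)"
  then obtain w where w: "w \<in> Y (Suc 0) (Suc (Suc i))" "c = dF 0 (Suc i) (dK (Suc 0) w)"
    by (auto simp: Bk_def dK_dF)
  then show "ev c \<in> tens_boundaries C i j"
    using ev_Y[OF dK_Y[OF w(1)]] by (auto simp: tens_boundaries_def ev_dF)
qed

theorem tor_dim_eq:
  assumes basis: "qbasis kscale J v (Zk (Suc i) 0) (Bk (Suc i) 0)" and fin: "finite J" and "j \<noteq> 0"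
  shows "tor_dim C i j = card J"
proof -
  obtain v' where v': "qbasis kscale J v' (Zk 0 (Suc i)) (Bk 0 (Suc i))"
    using qbasis_antidiagonal[of J v 0 "Suc i" 0] basis fin by auto
  let ?s = "\<lambda>(c :: 'k) (v :: nat \<Rightarrow> 'k) b. c * v b"
  interpret V: vector_space ?s
    by unfold_locales (auto simp: fun_eq_iff algebra_simps)
  have ZY: "c \<in> Y 0 (Suc i)" if "c \<in> Zk 0 (Suc i)" for c using that by (simp add: Zk_def)
  have dFz: "dF 0 i c = 0" if "c \<in> Zk 0 (Suc i)" for c using that by (simp add: Zk_def)
  have "\<exists>w. qbasis ?s J w (tens_cycles C i j) (tens_boundaries C i j)"
  \<comment> \<open>\<open>ev\<close> is injective on row 0, so here the correspondence is a
    bijection, with the identity on one side.\<close>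
  proof (rule qbasis_transport[OF v' fin, where f = "\<lambda>c. c" and g = ev and U = "Zk 0 (Suc i)"])
    show "tens_cycles C i j = ev ` Zk 0 (Suc i)" using ev_Zk[OF assms(3)] by simp
    show "ev (x + y) = ev x + ev y" for x y by (simp add: ev_def lookup_add fun_eq_iff)
    show "ev (kscale a x) = ?s a (ev x)" for a x
      by (simp add: ev_def kscale_def fun_eq_iff coeff_0_mult)
    show "u \<in> Bk 0 (Suc i) \<longleftrightarrow> ev u \<in> tens_boundaries C i j" if "u \<in> Zk 0 (Suc i)" for u
      using ev_Bk[OF ZY[OF that]] by simp
  qed (simp_all add: Zk_zero Zk_add Zk_diff Zk_scale)
  then obtain w where w: "qbasis ?s J w (tens_cycles C i j) (tens_boundaries C i j)" ..
  \<comment> \<open>Unit vectors, giving the finite spanning set that the dimension formula asks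
    for.\<close>
  define W where "W = (\<lambda>b a. if a = b then 1 else (0 :: 'k)) ` {..<rk C i}"
  have W_fin: "finite W" by (simp add: W_def)
  have diff_add: "tens_diff C n (x + y) = tens_diff C n x + tens_diff C n y" for n x y
    by (auto simp: tens_diff_def mat_apply_def fun_eq_iff distrib_left sum.distrib)
  have diff_scale: "tens_diff C n (?s a x) = ?s a (tens_diff C n x)" for n a x
    by (auto simp: tens_diff_def mat_apply_def fun_eq_iff sum_distrib_left ac_simps)
  have diff_0: "tens_diff C n 0 = 0" for n
    by (auto simp: tens_diff_def mat_apply_def fun_eq_iff)
  have sub_mod: "V.subspace (tens_mod C n j)" for n
    by (simp add: V.subspace_def tens_mod_def coord_vecs_def)
  have zero: "(\<lambda>_. 0) = (0 :: nat \<Rightarrow> 'k)" by (simp add: fun_eq_iff)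
  have "V.subspace (tens_cycles C i j)"
  proof (cases i)
    case 0
    then show ?thesis using sub_mod by (simp add: tens_cycles_def)
  next
    case (Suc i')
    then show ?thesis
      using sub_mod[of i]
      by (auto simp: V.subspace_def tens_cycles_def diff_add diff_scale diff_0 zero)
  qed
  moreover have "V.subspace (tens_boundaries C i j)"
    unfolding V.subspace_def tens_boundaries_def
  proof (intro conjI ballI allI)
    show "0 \<in> tens_diff C i ` tens_mod C (Suc i) j"
      using sub_mod[of "Suc i"] diff_0 unfolding V.subspace_def by (metis image_eqI)
  next
    fix x y assume "x \<in> tens_diff C i ` tens_mod C (Suc i) j" "y \<in> tens_diff C i ` tens_mod C (Suc i) j"
    then show "x + y \<in> tens_diff C i ` tens_mod C (Suc i) j"
      using V.subspace_add[OF sub_mod] by (auto simp flip: diff_add)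
  next
    fix a x assume "x \<in> tens_diff C i ` tens_mod C (Suc i) j"
    then show "?s a x \<in> tens_diff C i ` tens_mod C (Suc i) j"
      using V.subspace_scale[OF sub_mod] by (auto simp flip: diff_scale)
  qed
  \<comment> \<open>The square-zero property of F \<otimes> k, inherited from \<open>dF_dF\<close>
    through constant chains.\<close>
  moreover have "tens_boundaries C i j \<subseteq> tens_cycles C i j"
  proof
    fix x assume x: "x \<in> tens_boundaries C i j"
    then obtain v where v: "v \<in> tens_mod C (Suc i) j" "x = tens_diff C i v"
      by (auto simp: tens_boundaries_def)
    have e: "embed v \<in> Y (Suc 0) (Suc (Suc i))" by (rule embed_Y_1[OF v(1)])
    define c where "c = dF 0 (Suc i) (embed v)"
    have cY: "c \<in> Y 0 (Suc i)" unfolding c_def by (rule dF_0_Y[OF embed_Y[OF v(1)]])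
    have ev_c: "ev c = x" unfolding c_def ev_dF ev_embed v(2) ..
    have "dK (Suc 0) (embed v) = embed v"
      by (auto simp: dK_1 embed_def fun_eq_iff)
    then have "dF 0 i c = dK (Suc 0) (dF (Suc 0) i (dF (Suc 0) (Suc i) (embed v)))"
      unfolding c_def by (simp only: dK_dF)
    then have "dF 0 i c = 0" by (simp add: dF_dF dK_zero)
    then have "c \<in> Zk 0 (Suc i)" using cY by (simp add: Zk_def dK_0)
    then show "x \<in> tens_cycles C i j" using ev_c ev_Zk[OF assms(3)] by blast
  qed
  moreover have "tens_cycles C i j \<subseteq> V.span W"
  proof
    fix x assume "x \<in> tens_cycles C i j"
    then have "x \<in> tens_mod C i j" by (auto simp: tens_cycles_def split: nat.splits)
    then have "x b = 0" if "\<not> b < rk C i" for b using that by (auto simp: tens_mod_def coord_vecs_def)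
    then have "x = (\<Sum>b<rk C i. ?s (x b) (\<lambda>a. if a = b then 1 else 0))"
    proof (intro ext)
      fix a
      have "(\<Sum>b<n. f b) a = (\<Sum>b<n. f b a)" for f :: "nat \<Rightarrow> nat \<Rightarrow> 'k" and n
        by (induction n) auto
      then show "x a = (\<Sum>b<rk C i. ?s (x b) (\<lambda>a. if a = b then 1 else 0)) a"
        using \<open>\<And>b. \<not> b < rk C i \<Longrightarrow> x b = 0\<close>
        by (cases "a < rk C i") (simp_all add: if_distrib cong: if_cong)
    qed
    also have "\<dots> \<in> V.span W"
      by (intro V.span_sum V.span_scale V.span_base) (simp add: W_def)
    finally show "x \<in> V.span W" .
  qed
  ultimately have "V.dim (tens_cycles C i j) = V.dim (tens_boundaries C i j) + card J"
    using V.qbasis_dim[OF w fin] W_fin by blast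
  then show ?thesis by (simp add: tor_dim_def kdim_def)
qed

end

section \<open>Leaves of forests\<close>

definition down :: "'v set set \<Rightarrow> 'v set set" where
  "down \<Gamma> = {G. \<exists>F\<in>\<Gamma>. G \<subseteq> F}"

lemma facets_down: "\<Gamma> \<subseteq> facets \<Delta> \<Longrightarrow> facets (down \<Gamma>) = \<Gamma>"
  unfolding facets_def down_def by blast

lemma facet_subcomplex_down: "\<Gamma> \<subseteq> facets \<Delta> \<Longrightarrow> facet_subcomplex (down \<Gamma>) \<Delta>"
  unfolding facet_subcomplex_def simplicial_complex_def
  by (simp add: facets_down) (auto simp: down_def)

lemma ex_facet_above:
  fixes \<Delta> :: "'v::finite set set"
  assumes "G \<in> \<Delta>"
  obtains H where "H \<in> facets \<Delta>" "G \<subseteq> H"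
  using finite_has_maximal2[of \<Delta> G] assms that unfolding facets_def by auto

definition meets :: "'v set set \<Rightarrow> ('v set \<times> 'v set) set" where
  "meets \<Gamma> = {(A, B). A \<in> \<Gamma> \<and> B \<in> \<Gamma> \<and> A \<inter> B \<noteq> {}}"

definition component :: "'v set set \<Rightarrow> 'v set \<Rightarrow> 'v set set" where
  "component \<Gamma> F = {G \<in> \<Gamma>. (F, G) \<in> (meets \<Gamma>)\<^sup>*}"

lemma facets_connected_iff:
  "facets_connected \<Delta> F G \<longleftrightarrow> F \<in> facets \<Delta> \<and> G \<in> facets \<Delta> \<and> (F, G) \<in> (meets (facets \<Delta>))\<^sup>*"
  unfolding facets_connected_def meets_def ..

text \<open>Every facet on a chain starting at \<open>F\<close> lies in the component, so the chain
  stays inside. Connectedness of a subcomplex asks for chains of its own facets.\<close>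

lemma component_connected:
  assumes F: "F \<in> \<Gamma>" and G: "G \<in> component \<Gamma> F"
  shows "(F, G) \<in> (meets (component \<Gamma> F))\<^sup>*"
proof -
  have "(F, G) \<in> (meets \<Gamma>)\<^sup>*" using G by (simp add: component_def)
  then show ?thesis
  proof (induction rule: rtrancl_induct)
    case (step G H)
    then have "(F, H) \<in> (meets \<Gamma>)\<^sup>*" by (meson rtrancl.rtrancl_into_rtrancl)
    then have "(G, H) \<in> meets (component \<Gamma> F)"
      using step(1,2) by (simp add: meets_def component_def)
    then show ?case using step.IH by (rule rtrancl_into_rtrancl[rotated])
  qed simp
qed

lemma connected_complex_component:
  assumes \<Gamma>: "\<Gamma> \<subseteq> facets \<Delta>" and F: "F \<in> \<Gamma>"
  shows "connected_complex (down (component \<Gamma> F))"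
proof -
  have fac: "facets (down (component \<Gamma> F)) = component \<Gamma> F"
    by (rule facets_down[of _ \<Delta>]) (use \<Gamma> in \<open>auto simp: component_def\<close>)
  have "sym ((meets (component \<Gamma> F))\<^sup>*)"
    by (rule sym_rtrancl) (auto simp: sym_def meets_def)
  then have "(G, H) \<in> (meets (component \<Gamma> F))\<^sup>*"
    if "G \<in> component \<Gamma> F" "H \<in> component \<Gamma> F" for G H
    using component_connected[OF F that(1)] component_connected[OF F that(2)]
    by (meson rtrancl_trans symD)
  then show ?thesis
    unfolding connected_complex_def facets_connected_iff fac by blast
qed

text \<open>A larger connected subcomplex still has \<open>F\<close> as a facet, and its chains of
  facets are chains in \<Delta>, so it cannot reach beyond the component.\<close>

lemma complex_component_component:
  fixes \<Delta> :: "'v::finite set set"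
  assumes F: "F \<in> facets \<Delta>"
  shows "complex_component (down (component (facets \<Delta>) F)) \<Delta>"
proof -
  let ?K = "component (facets \<Delta>) F"
  have K: "?K \<subseteq> facets \<Delta>" by (auto simp: component_def)
  have FK: "F \<in> ?K" using F by (simp add: component_def)
  have "\<Gamma> = down ?K"
    if sub: "facet_subcomplex \<Gamma> \<Delta>" and conn: "connected_complex \<Gamma>" and le: "down ?K \<subseteq> \<Gamma>" for \<Gamma>
  proof (rule equalityI[OF subsetI le])
    have fac: "facets \<Gamma> \<subseteq> facets \<Delta>" using sub by (simp add: facet_subcomplex_def)
    have F\<Gamma>: "F \<in> \<Gamma>" using le FK by (auto simp: down_def)
    then obtain H where H: "H \<in> facets \<Gamma>" "F \<subseteq> H" by (rule ex_facet_above)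
    then have "H = F" using F fac by (auto simp: facets_def)
    fix G assume "G \<in> \<Gamma>"
    then obtain G' where G': "G' \<in> facets \<Gamma>" "G \<subseteq> G'" by (rule ex_facet_above)
    have "(F, G') \<in> (meets (facets \<Gamma>))\<^sup>*"
      using conn G'(1) H(1) \<open>H = F\<close> by (auto simp: connected_complex_def facets_connected_iff)
    moreover have "meets (facets \<Gamma>) \<subseteq> meets (facets \<Delta>)" using fac by (auto simp: meets_def)
    ultimately have "(F, G') \<in> (meets (facets \<Delta>))\<^sup>*" using rtrancl_mono by blast
    then have "G' \<in> ?K" using G'(1) fac by (auto simp: component_def)
    then show "G \<in> down ?K" using G'(2) by (auto simp: down_def)
  qed
  then show ?thesis
    unfolding complex_component_def
    using facet_subcomplex_down[OF K] connected_complex_component[OF order_refl F] facets_down[OF K] FK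
    by auto
qed

text \<open>Trees provide leaves only for connected subcomplexes, while \<open>\<Gamma>\<close> may
  be disconnected. A leaf of one component of \<open>\<Gamma>\<close> is a leaf of
  \<open>\<Gamma>\<close>, since it is disjoint from the facets outside. If that component is a
  single facet, any other facet serves as \<open>G\<close>.\<close>

lemma forest_leaf:
  fixes \<Delta> :: "'v::finite set set"
  assumes forest: "simplicial_forest \<Delta>" and \<Gamma>: "\<Gamma> \<subseteq> facets \<Delta>" "\<Gamma> \<noteq> {}"
  shows "\<exists>F\<in>\<Gamma>. \<Gamma> = {F} \<or> (\<exists>G\<in>\<Gamma>. G \<noteq> F \<and> (\<forall>F'\<in>\<Gamma>. F' \<noteq> F \<longrightarrow> F \<inter> F' \<subseteq> F \<inter> G))"
proof -
  obtain F0 where F0: "F0 \<in> \<Gamma>" using \<Gamma> by blast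
  let ?X = "component \<Gamma> F0" and ?K = "component (facets \<Delta>) F0"
  have X\<Gamma>: "?X \<subseteq> \<Gamma>" by (auto simp: component_def)
  have F0X: "F0 \<in> ?X" using F0 by (simp add: component_def)
  have "meets \<Gamma> \<subseteq> meets (facets \<Delta>)" using \<Gamma> by (auto simp: meets_def)
  then have "(meets \<Gamma>)\<^sup>* \<subseteq> (meets (facets \<Delta>))\<^sup>*" by (rule rtrancl_mono)
  then have XK: "?X \<subseteq> ?K" using \<Gamma> by (auto simp: component_def)
  have facK: "facets (down ?K) = ?K"
    by (rule facets_down[of _ \<Delta>]) (auto simp: component_def)
  have facX: "facets (down ?X) = ?X"
    by (rule facets_down[of _ \<Delta>]) (use X\<Gamma> \<Gamma> in auto)
  have "simplicial_tree (down ?K)"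
    using forest complex_component_component[of F0 \<Delta>] F0 \<Gamma> by (auto simp: simplicial_forest_def)
  moreover have "facet_subcomplex (down ?X) (down ?K)"
    by (rule facet_subcomplex_down) (simp add: facK XK)
  moreover have "connected_complex (down ?X)"
    using \<Gamma>(1) F0 by (rule connected_complex_component)
  ultimately obtain F where F: "leaf (down ?X) F"
    unfolding simplicial_tree_def using facX F0X by blast
  have FX: "F \<in> ?X" using F by (simp add: leaf_def facX)
  have disj: "F \<inter> F' = {}" if "F' \<in> \<Gamma> - ?X" for F'
  proof (rule ccontr)
    assume "F \<inter> F' \<noteq> {}"
    then have "(F, F') \<in> meets \<Gamma>" using FX X\<Gamma> that by (auto simp: meets_def)
    then have "F' \<in> ?X" using FX that by (auto simp: component_def intro: rtrancl_into_rtrancl)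
    with that show False by blast
  qed
  consider "?X = {F}" | G where "G \<in> ?X" "G \<noteq> F" "\<forall>F'\<in>?X. F' \<noteq> F \<longrightarrow> F \<inter> F' \<subseteq> F \<inter> G"
    using F unfolding leaf_def facX by blast
  then show ?thesis
  proof cases
    case 1
    show ?thesis
    proof (cases "\<Gamma> = {F}")
      case False
      then obtain G where "G \<in> \<Gamma>" "G \<noteq> F" using FX X\<Gamma> by blast
      moreover have "F \<inter> F' \<subseteq> F \<inter> G" if "F' \<in> \<Gamma>" "F' \<noteq> F" for F'
        using disj[of F'] that 1 by auto
      ultimately show ?thesis using FX X\<Gamma> by blast
    qed auto
  next
    case 2
    have le: "F \<inter> F' \<subseteq> F \<inter> G" if "F' \<in> \<Gamma>" "F' \<noteq> F" for F'
      using disj[of F'] that 2 by (cases "F' \<in> ?X") auto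
    have "F \<in> \<Gamma>" "G \<in> \<Gamma>" using FX 2(1) X\<Gamma> by auto
    then show ?thesis
      using 2(2) le by (intro bexI[of _ F] disjI2 bexI[of _ G] conjI) simp_all
  qed
qed

section \<open>The linear strand\<close>

locale leafy_koszul = koszul \<Phi> C r j
  for \<Phi> :: "'v::finite set set" and C :: "('v, 'k::field) free_complex" and r :: "'v \<Rightarrow> nat"
    and j :: int +
  fixes i d :: nat
  assumes j_eq: "j = int i + int d" and card_\<Phi>: "F \<in> \<Phi> \<Longrightarrow> card F = d" and d_pos: "d \<ge> 1"
    and leafy: "\<lbrakk>\<Gamma> \<subseteq> \<Phi>; \<Gamma> \<noteq> {}\<rbrakk> \<Longrightarrow>
      \<exists>F\<in>\<Gamma>. \<Gamma> = {F} \<or> (\<exists>G\<in>\<Gamma>. G \<noteq> F \<and> (\<forall>F'\<in>\<Gamma>. F' \<noteq> F \<longrightarrow> F \<inter> F' \<subseteq> F \<inter> G))"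
begin

text \<open>The facet omitting x meets the other two in M - {x, y} and M - {x, z}. These are
  incomparable, so none of the three is a leaf among them.\<close>

lemma not_three_facets:
  assumes \<Phi>: "M - {a} \<in> \<Phi>" "M - {b} \<in> \<Phi>" "M - {c} \<in> \<Phi>"
    and M: "a \<in> M" "b \<in> M" "c \<in> M" and dist: "a \<noteq> b" "a \<noteq> c" "b \<noteq> c"
  shows False
proof -
  define T where "T = {a, b, c}"
  define \<Gamma> where "\<Gamma> = (\<lambda>x. M - {x}) ` T"
  have \<Gamma>\<Phi>: "\<Gamma> \<subseteq> \<Phi>" using \<Phi> by (simp add: \<Gamma>_def T_def)
  have "\<Gamma> \<noteq> {}" by (simp add: \<Gamma>_def T_def)
  have \<Gamma>I: "M - {x} \<in> \<Gamma>" if "x \<in> T" for x using that by (simp add: \<Gamma>_def)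
  have TM: "x \<in> M" if "x \<in> T" for x using that M by (auto simp: T_def)
  have inj: "x = y" if "x \<in> T" "M - {x} = M - {y}" for x y
    using TM[OF that(1)] that(2) by blast
  obtain F where F: "F \<in> \<Gamma>"
    "\<Gamma> = {F} \<or> (\<exists>G\<in>\<Gamma>. G \<noteq> F \<and> (\<forall>F'\<in>\<Gamma>. F' \<noteq> F \<longrightarrow> F \<inter> F' \<subseteq> F \<inter> G))"
    using leafy[OF \<Gamma>\<Phi> \<open>\<Gamma> \<noteq> {}\<close>] by (elim bexE)
  obtain x where x: "x \<in> T" "F = M - {x}" using F(1) unfolding \<Gamma>_def by blast
  have "\<Gamma> \<noteq> {F}"
  proof
    assume eq: "\<Gamma> = {F}"
    have "a \<in> T" "b \<in> T" by (simp_all add: T_def)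
    then have "M - {a} = M - {b}" using \<Gamma>I eq by (metis singletonD)
    then show False using inj[OF \<open>a \<in> T\<close>] dist(1) by simp
  qed
  then obtain G where G: "G \<in> \<Gamma>" "G \<noteq> F" "\<And>F'. F' \<in> \<Gamma> \<Longrightarrow> F' \<noteq> F \<Longrightarrow> F \<inter> F' \<subseteq> F \<inter> G"
    using F(2) by auto
  obtain y where y: "y \<in> T" "G = M - {y}" using G(1) unfolding \<Gamma>_def by blast
  have "\<exists>z\<in>T. z \<noteq> x \<and> z \<noteq> y" using dist unfolding T_def by auto
  then obtain z where z: "z \<in> T" "z \<noteq> x" "z \<noteq> y" by blast
  have "M - {z} \<noteq> F" using inj[OF z(1), of x] z(2) x(2) by auto
  then have sub: "F \<inter> (M - {z}) \<subseteq> F \<inter> G" using G(3)[OF \<Gamma>I[OF z(1)]] by simp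
  have "y \<noteq> x" using G(2) x(2) y(2) by auto
  then have "y \<in> F \<inter> (M - {z})" using TM[OF y(1)] x(2) z(3) by simp
  then have "y \<in> G" using sub by (meson IntD2 subsetD)
  then show False using y(2) by simp
qed

text \<open>The coordinate of \<open>z\<close> at e_T times the monomial of F; column 0 has the
  single basis index 0.\<close>

definition om :: "('v, 'k) kchain \<Rightarrow> 'v set \<Rightarrow> 'v set \<Rightarrow> 'k" where
  "om z T F = coeff_at (z T 0) (ind_exp F)"

lemma om_add: "om (x + y) T F = om x T F + om y T F"
  by (simp add: om_def lookup_add)

lemma om_diff: "om (x - y) T F = om x T F - om y T F"
  by (simp add: om_def lookup_minus)

lemma om_scale: "om (kscale a x) T F = a * om x T F"
  using lookup_single_times_add[of 0 a "x T 0" "ind_exp F"] by (simp add: om_def kscale_def)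

lemma om_zero: "om 0 T F = 0"
  by (simp add: om_def)

lemma om_sum: "finite J \<Longrightarrow> om (\<Sum>k\<in>J. f k) T F = (\<Sum>k\<in>J. om (f k) T F)"
proof (induction J rule: finite_induct)
  case (insert x A)
  then show ?case by (simp only: sum.insert[OF insert.hyps(1,2)] om_add)
qed (simp only: sum.empty om_zero)

lemma Y_strand_iff:
  "z \<in> Y (Suc i) 0 \<longleftrightarrow> (\<forall>T b. z T b \<noteq> 0 \<longrightarrow> card T = i \<and> b = 0) \<and>
     (\<forall>T. homogeneous (int d) (z T 0)) \<and> (\<forall>T. z T 0 \<in> mon_ideal \<Phi>)"
proof -
  have "(\<forall>T b. homogeneous (j - int i - dg' 0 b) (z T b)) \<longleftrightarrow> (\<forall>T. homogeneous (int d) (z T 0))"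
    if "\<forall>T b. z T b \<noteq> 0 \<longrightarrow> card T = i \<and> b = 0"
  proof (intro iffI allI)
    fix T b assume "\<forall>T. homogeneous (int d) (z T 0)"
    then show "homogeneous (j - int i - dg' 0 b) (z T b)"
      using that by (cases "z T b = 0") (auto simp: dg'_def j_eq)
  next
    fix T assume "\<forall>T b. homogeneous (j - int i - dg' 0 b) (z T b)"
    then have "homogeneous (j - int i - dg' 0 0) (z T 0)" by blast
    then show "homogeneous (int d) (z T 0)" by (simp add: dg'_def j_eq)
  qed
  then show ?thesis by (auto simp: Y_def rk'_def)
qed

text \<open>A facet dividing a monomial of degree at most \<open>d\<close> exhausts it. Bounding
  \<open>e\<close> instead of fixing it serves the strand and also degree \<open>d - 1\<close>,
  where nothing remains.\<close>

lemma keys_degree_d: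
  assumes p: "(p :: ('v, 'k) mpoly) \<in> mon_ideal \<Phi>" "homogeneous (int e) p" "e \<le> d"
    and u: "u \<in> Poly_Mapping.keys p"
  shows "e = d \<and> (\<exists>F\<in>\<Phi>. u = ind_exp F)"
proof -
  obtain F where F: "F \<in> \<Phi>" "F \<subseteq> Poly_Mapping.keys u"
    using p(1) u by (auto simp: mon_ideal_def)
  then obtain m where m: "u = ind_exp F + m" using ind_exp_dvd by metis
  have "exp_degree u = d + exp_degree m"
    by (simp add: m exp_degree_add exp_degree_ind card_\<Phi> F)
  moreover have "exp_degree u = e" using p(2) u by (auto simp: homogeneous_def)
  ultimately have "exp_degree m = 0" "e = d" using p(3) by auto
  then show ?thesis using F m by (auto simp: exp_degree_eq_0)
qed

lemma keys_strand:
  assumes z: "z \<in> Y (Suc i) 0" and u: "u \<in> Poly_Mapping.keys (z T 0)"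
  shows "\<exists>F\<in>\<Phi>. u = ind_exp F"
proof -
  have "homogeneous (int d) (z T 0)" "z T 0 \<in> mon_ideal \<Phi>"
    using z unfolding Y_strand_iff by blast+
  then show ?thesis using keys_degree_d[OF _ _ order_refl u] by blast
qed

lemma strand_eq_0:
  assumes z: "z \<in> Y (Suc i) 0" and om: "\<And>T F. F \<in> \<Phi> \<Longrightarrow> om z T F = 0"
  shows "z = 0"
proof (intro ext)
  fix T b
  have "z T 0 = 0"
  proof (rule poly_mapping_eqI)
    fix u
    show "coeff_at (z T 0) u = coeff_at 0 u"
    proof (cases "u \<in> Poly_Mapping.keys (z T 0)")
      case True
      then obtain F where "F \<in> \<Phi>" "u = ind_exp F" using keys_strand[OF z] by blast
      then show ?thesis using om by (simp add: om_def)
    qed (simp add: in_keys_iff)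
  qed
  moreover have "z T b = 0" if "b \<noteq> 0"
    using z that by (auto simp: Y_def rk'_def)
  ultimately show "z T b = 0 T b" by (cases "b = 0") auto
qed

text \<open>Boundaries would come from coefficients of degree \<open>d - 1\<close>, and the ideal
  has no nonzero ones.\<close>

lemma Bk_strand: "Bk (Suc i) 0 = {0}"
proof -
  have "dF (Suc (Suc i)) 0 w = 0" if "w \<in> Y (Suc (Suc i)) (Suc 0)" for w
  proof (intro ext)
    fix T b
    let ?y = "dF (Suc (Suc i)) 0 w"
    have y: "?y \<in> Y (Suc (Suc i)) 0" using that by (rule dF_Y)
    have "homogeneous (j - int (Suc i)) (?y T 0)" "?y T 0 \<in> mon_ideal \<Phi>"
      using y by (auto simp: Y_def dg'_def)
    moreover have "j - int (Suc i) = int (d - 1)" using d_pos by (simp add: j_eq of_nat_diff)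
    ultimately have hom: "homogeneous (int (d - 1)) (?y T 0)" and ideal: "?y T 0 \<in> mon_ideal \<Phi>"
      by (simp_all only:)
    have "u \<notin> Poly_Mapping.keys (?y T 0)" for u
      using keys_degree_d[OF ideal hom, of u] d_pos by auto
    then have "?y T 0 = 0" by (intro poly_mapping_eqI) (simp add: in_keys_iff)
    moreover have "?y T b = 0" if "b \<noteq> 0"
      using y that by (auto simp: Y_def rk'_def)
    ultimately show "?y T b = 0 T b" by (cases "b = 0") auto
  qed
  then have "Bk (Suc i) 0 = (\<lambda>w. 0) ` Y (Suc (Suc i)) (Suc 0)"
    unfolding Bk_def by (intro image_cong) (simp_all add: dK_zero)
  then show ?thesis using Y_zero[of "Suc (Suc i)" "Suc 0"] by auto
qed

text \<open>The strand is the part of the ideal of degree \<open>d\<close>, with the generators as a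
  basis, and it consists of cycles since constant coefficients vanish for
  \<open>d \<ge> 1\<close>.\<close>

lemma qbasis_degree_0:
  assumes i: "i = 0"
  shows "\<exists>v. qbasis kscale \<Phi> v (Zk (Suc i) 0) (Bk (Suc i) 0)"
proof -
  define v :: "'v set \<Rightarrow> ('v, 'k) kchain" where "v F = (\<lambda>T b. if T = {} \<and> b = 0 then mon F else 0)" for F
  have om_v: "om (v F) T G = (if T = {} \<and> F = G then 1 else 0)" for F T G
    by (simp add: om_def v_def lookup_mon)
  have vY: "v F \<in> Y (Suc i) 0" if "F \<in> \<Phi>" for F
    using homogeneous_mon[of F] that i
    unfolding Y_strand_iff by (auto simp: v_def card_\<Phi> mon_in_mon_ideal)
  have Z: "Zk (Suc i) 0 = Y (Suc i) 0"
  proof -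
    have "dK (Suc i) z = 0" if z: "z \<in> Y (Suc i) 0" for z
    proof (intro ext)
      fix S b
      have "homogeneous (int d) (z {} b)"
        using z unfolding Y_strand_iff by (cases "z {} b = 0") (simp, metis)
      then have "const (z {} b) = 0" using const_neq_0_homogeneous d_pos by fastforce
      then show "dK (Suc i) z S b = 0 S b" by (simp add: i dK_1)
    qed
    then show ?thesis by (auto simp: Zk_def)
  qed
  have om_lin: "om (\<Sum>F\<in>\<Phi>. kscale (a F) (v F)) T G = (if T = {} then a G else 0)" if "G \<in> \<Phi>" for a T G
  proof -
    have "om (\<Sum>F\<in>\<Phi>. kscale (a F) (v F)) T G = (\<Sum>F\<in>\<Phi>. if F = G then (if T = {} then a G else 0) else 0)"
      unfolding om_sum[OF finite] by (intro sum.cong) (auto simp: om_scale om_v)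
    then show ?thesis using that by simp
  qed
  have sumY: "(\<Sum>F\<in>\<Phi>. kscale (a F) (v F)) \<in> Y (Suc i) 0" for a
  proof -
    have "(\<Sum>F\<in>\<Psi>. kscale (a F) (v F)) \<in> Y (Suc i) 0" if "\<Psi> \<subseteq> \<Phi>" for \<Psi>
      using finite[of \<Psi>] that
      by (induction rule: finite_induct) (auto simp: Y_zero intro!: Y_add Y_scale vY)
    then show ?thesis by blast
  qed
  have "qbasis kscale \<Phi> v (Zk (Suc i) 0) (Bk (Suc i) 0)"
    unfolding qbasis_def Z Bk_strand
  proof (intro conjI ballI allI impI)
    fix z assume z: "z \<in> Y (Suc i) 0"
    have "z T 0 = 0" if "T \<noteq> {}" for T
      using z that i by (auto simp: Y_def card_eq_0_iff)
    then have "om z T G = 0" if "T \<noteq> {}" for T G using that by (simp add: om_def)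
    then have "z - (\<Sum>F\<in>\<Phi>. kscale (om z {} F) (v F)) = 0"
      by (intro strand_eq_0 Y_diff z sumY) (simp add: om_diff om_lin)
    then show "\<exists>a. z - (\<Sum>F\<in>\<Phi>. kscale (a F) (v F)) \<in> {0}" by auto
  next
    fix a G assume "(\<Sum>F\<in>\<Phi>. kscale (a F) (v F)) \<in> {0}" "G \<in> \<Phi>"
    then show "a G = 0" using om_lin[of G a "{}"] by (simp add: om_def)
  qed (rule vY)
  then show ?thesis by blast
qed

section \<open>Cycles attached to codimension one faces\<close>

definition nbr :: "'v set \<Rightarrow> 'v set" where
  "nbr A = {x. x \<notin> A \<and> insert x A \<in> \<Phi>}"

definition idx :: "('v set \<times> 'v set) set" where
  "idx = (SIGMA A:{A. card A = d - 1}. {S. S \<subseteq> nbr A \<and> card S = Suc i})"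

text \<open>The Koszul boundary of e_S times the monomial of A. For indices in \<open>idx\<close>
  that monomial has degree \<open>d - 1\<close> and lies outside the ideal, so the cycle need not be
  a boundary in K \<otimes> I.\<close>

definition cyc :: "'v set \<times> 'v set \<Rightarrow> ('v, 'k) kchain" where
  "cyc k = (\<lambda>T b. if b = 0 then kosz (\<lambda>T. if T = snd k then mon (fst k) else 0) T else 0)"

lemma cyc_eq:
  assumes x: "x \<in> S" "x \<notin> A"
  shows "cyc (A, S) (S - {x}) 0 = sg r x (S - {x}) * mon (insert x A)"
proof -
  let ?T = "S - {x}"
  let ?f = "\<lambda>y. sg r y ?T * (mon ({y} - \<Union>((\<lambda>x. {x}) ` ?T)) *
    (if insert y ?T = S then mon A else 0)) :: ('v, 'k) mpoly"
  have "cyc (A, S) ?T 0 = (\<Sum>y\<in>UNIV - ?T. ?f y)"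
    unfolding cyc_def tay_def fst_conv snd_conv by simp
  also have "\<dots> = (\<Sum>y\<in>{x}. ?f y)"
  proof (rule sum.mono_neutral_right)
    show "\<forall>y\<in>UNIV - ?T - {x}. ?f y = 0"
    proof
      fix y assume y: "y \<in> UNIV - ?T - {x}"
      have "insert y ?T \<noteq> S" using x y by auto
      then show "?f y = 0" by simp
    qed
  qed auto
  also have "\<dots> = sg r x ?T * (mon {x} * mon A)"
    using x by (simp add: insert_absorb insert_Diff_if)
  also have "\<dots> = sg r x ?T * mon (insert x A)"
    using mon_union[of "{x}" A, where 'b = 'k] x by simp
  finally show ?thesis .
qed

lemma cyc_support:
  assumes "cyc (A, S) T 0 \<noteq> 0"
  obtains x where "x \<in> S" "T = S - {x}"
proof -
  have "kosz (\<lambda>T. if T = S then mon A else 0) T \<noteq> 0"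
    using assms unfolding cyc_def fst_conv snd_conv by simp
  then obtain x where "x \<notin> T" "(if insert x T = S then mon A else 0) \<noteq> (0 :: ('v, 'k) mpoly)"
    by (rule kosz_support)
  then show ?thesis using that[of x] by (auto split: if_splits)
qed

lemma om_cyc:
  assumes "x \<in> S" "x \<notin> A"
  shows "om (cyc (A, S)) (S - {x}) F = (if F = insert x A then sg r x (S - {x}) else 0)"
  using assms by (simp add: om_def cyc_eq coeff_sg_mult lookup_mon)

lemma om_cyc_nonzero:
  assumes "om (cyc (A, S)) T F \<noteq> 0" "S \<subseteq> nbr A"
  obtains x where "x \<in> S" "T = S - {x}" "F = insert x A"
proof -
  have "cyc (A, S) T 0 \<noteq> 0" using assms(1) by (auto simp: om_def)
  then obtain x where x: "x \<in> S" "T = S - {x}" by (rule cyc_support)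
  then have "x \<notin> A" using assms(2) by (auto simp: nbr_def)
  then have "F = insert x A" using assms(1) x by (auto simp: om_cyc split: if_splits)
  then show ?thesis using that x by blast
qed

lemma cyc_Zk:
  assumes i: "i \<ge> 1" and k: "(A, S) \<in> idx"
  shows "cyc (A, S) \<in> Zk (Suc i) 0"
proof -
  have S: "S \<subseteq> nbr A" "card S = Suc i" using k by (auto simp: idx_def)
  have val: "cyc (A, S) T 0 = 0 \<or> (\<exists>x\<in>S. T = S - {x} \<and> insert x A \<in> \<Phi> \<and>
      cyc (A, S) T 0 = sg r x T * mon (insert x A))" for T
  proof (cases "cyc (A, S) T 0 = 0")
    case False
    then obtain x where "x \<in> S" "T = S - {x}" by (rule cyc_support)
    then show ?thesis using S cyc_eq[of x S A] by (auto simp: nbr_def)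
  qed simp
  have "card T = i" if "cyc (A, S) T 0 \<noteq> 0" for T
    using val[of T] that S(2) by auto
  moreover have "cyc (A, S) T b = 0" if "b \<noteq> 0" for T b
    using that by (simp add: cyc_def)
  moreover have "homogeneous (int d) (cyc (A, S) T 0)" for T
    using val[of T] homogeneous_sg_mult[OF homogeneous_mon] card_\<Phi> by fastforce
  moreover have "cyc (A, S) T 0 \<in> mon_ideal \<Phi>" for T
    using val[of T] mon_ideal_mult[OF mon_in_mon_ideal] by auto
  ultimately have "cyc (A, S) \<in> Y (Suc i) 0"
    unfolding Y_strand_iff by metis
  moreover have "dK (Suc i) (cyc (A, S)) = 0"
  proof (intro ext)
    obtain i' where i': "i = Suc i'" using i by (cases i) auto
    fix T b
    have "kosz (\<lambda>T. cyc (A, S) T 0) T = 0"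
      by (simp add: cyc_def tay_tay[OF inj_r])
    then show "dK (Suc i) (cyc (A, S)) T b = 0 T b"
      by (cases "b = 0") (auto simp: i' dK_SS cyc_def tay_def)
  qed
  ultimately show ?thesis by (simp add: Zk_def)
qed

lemma ind_exp_exchange:
  assumes eq: "ind_exp {t} + ind_exp F = ind_exp {x} + ind_exp F'" and "x \<noteq> t"
  shows "t \<notin> F" "x \<in> F" "F' = insert t (F - {x})"
proof -
  have *: "(if y = t then 1 else 0) + (if y \<in> F then 1 else 0) =
      (if y = x then 1 else 0) + (if y \<in> F' then 1 else (0::nat))" for y
    using arg_cong[OF eq, of "\<lambda>m. Poly_Mapping.lookup m y"]
    by (simp add: lookup_add lookup_ind_exp cong: if_cong)
  show "t \<notin> F" using *[of t] \<open>x \<noteq> t\<close> by (auto split: if_splits)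
  show "x \<in> F" using *[of x] \<open>x \<noteq> t\<close> by (auto split: if_splits)
  show "F' = insert t (F - {x})"
  proof (rule set_eqI)
    fix y
    show "y \<in> F' \<longleftrightarrow> y \<in> insert t (F - {x})"
      using *[of y] \<open>x \<noteq> t\<close> by (auto split: if_splits)
  qed
qed

text \<open>In the boundary at \<open>T - {t}\<close> the term of \<open>t\<close> must be cancelled
  by that of another vertex x, with a facet F' such that F + t = F' + x as multisets. As F' has no
  repetition, t is not in F, and F' arises from F by exchanging x for t.\<close>

lemma cycle_exchange:
  assumes i: "i \<ge> 1" and z: "z \<in> Zk (Suc i) 0" and F: "F \<in> \<Phi>" and nz: "om z T F \<noteq> 0" and t: "t \<in> T"
  shows "t \<notin> F \<and> (\<exists>x\<in>F. x \<notin> T \<and> insert t (F - {x}) \<in> \<Phi> \<and>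
    om z (insert x (T - {t})) (insert t (F - {x})) \<noteq> 0)"
proof -
  obtain i' where i': "i = Suc i'" using i by (cases i) auto
  let ?T = "T - {t}" and ?m = "ind_exp {t} + ind_exp F"
  let ?f = "\<lambda>x. sg r x ?T * coeff_at (mon {x} * z (insert x ?T) 0) ?m"
  have "kosz (\<lambda>T. z T 0) ?T = 0"
  proof -
    have "dK (Suc (Suc i')) z ?T 0 = 0" using z by (simp add: Zk_def i')
    then show ?thesis by (simp add: dK_SS)
  qed
  moreover have "kosz (\<lambda>T. z T 0) ?T = (\<Sum>x\<in>UNIV - ?T. sg r x ?T * (mon {x} * z (insert x ?T) 0))"
    unfolding tay_def by (intro sum.cong) (auto simp: insert_Diff_if)
  ultimately have "coeff_at (\<Sum>x\<in>UNIV - ?T. sg r x ?T * (mon {x} * z (insert x ?T) 0)) ?m = 0"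
    by simp
  then have sum0: "(\<Sum>x\<in>UNIV - ?T. ?f x) = 0"
    by (simp only: lookup_sum coeff_sg_mult)
  have "?f t = sg r t ?T * om z T F"
    using t by (simp add: lookup_mon_times_add om_def insert_absorb)
  moreover have "sg r t ?T \<noteq> (0 :: 'k)" by (rule sg_nonzero)
  ultimately have "?f t \<noteq> 0" using nz by simp
  have "\<exists>x\<in>UNIV - ?T - {t}. ?f x \<noteq> 0"
  proof (rule ccontr)
    assume "\<not> ?thesis"
    then have "(\<Sum>x\<in>UNIV - ?T. ?f x) = (\<Sum>x\<in>{t}. ?f x)"
      by (intro sum.mono_neutral_right) auto
    then show False using sum0 \<open>?f t \<noteq> 0\<close> by simp
  qed
  then obtain x where x: "x \<notin> ?T" "x \<noteq> t" "?f x \<noteq> 0" by blast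
  then have "?m \<in> Poly_Mapping.keys (mon {x} * z (insert x ?T) 0)"
    by (auto simp: in_keys_iff)
  then obtain s where s: "?m = ind_exp {x} + s" "s \<in> Poly_Mapping.keys (z (insert x ?T) 0)"
    by (rule keys_mon_times)
  then obtain F' where F': "F' \<in> \<Phi>" "s = ind_exp F'"
    using keys_strand[of z s "insert x ?T"] z by (auto simp: Zk_def)
  note ex = ind_exp_exchange[OF s(1)[unfolded F'(2)] x(2)]
  have "om z (insert x ?T) F' \<noteq> 0" using s(2) F'(2) by (simp add: om_def in_keys_iff)
  then show ?thesis using ex F'(1) x(1,2) by blast
qed

text \<open>Let \<open>F\<close> be a leaf among the facets occurring in \<open>z\<close>, with
  \<open>G\<close> as in the definition of a leaf. Exchanging a vertex of F for t in T gives an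
  occurring facet that meets \<open>F\<close> in all but this vertex, so \<open>G\<close> contains
  the rest of \<open>F\<close>. As \<open>F\<close> is not inside \<open>G\<close>, the exchanged
  vertex y is the same for all t; then A = F - y and S = T + y.\<close>

lemma leaf_cycle:
  assumes i: "i \<ge> 1" and z: "z \<in> Zk (Suc i) 0" and nz: "z \<noteq> 0"
  obtains A S where "(A, S) \<in> idx" "\<And>s. s \<in> S \<Longrightarrow> om z (S - {s}) (insert s A) \<noteq> 0"
proof -
  have zY: "z \<in> Y (Suc i) 0" using z by (simp add: Zk_def)
  define \<Gamma> where "\<Gamma> = {F \<in> \<Phi>. \<exists>T. om z T F \<noteq> 0}"
  have \<Gamma>I: "F \<in> \<Gamma>" if "F \<in> \<Phi>" "om z T F \<noteq> 0" for F T
    unfolding \<Gamma>_def using that by blast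
  have \<Gamma>\<Phi>: "\<Gamma> \<subseteq> \<Phi>" by (auto simp: \<Gamma>_def)
  have "\<Gamma> \<noteq> {}" using strand_eq_0[OF zY] nz unfolding \<Gamma>_def by blast
  then obtain F where F: "F \<in> \<Gamma>"
    "\<Gamma> = {F} \<or> (\<exists>G\<in>\<Gamma>. G \<noteq> F \<and> (\<forall>F'\<in>\<Gamma>. F' \<noteq> F \<longrightarrow> F \<inter> F' \<subseteq> F \<inter> G))"
    using leafy[OF \<Gamma>\<Phi>] by blast
  then obtain T where F\<Phi>: "F \<in> \<Phi>" and T: "om z T F \<noteq> 0" unfolding \<Gamma>_def by blast
  have "z T 0 \<noteq> 0" using T by (auto simp: om_def)
  then have cardT: "card T = i" using zY by (simp add: Y_def)
  then obtain t0 where t0: "t0 \<in> T" using i by fastforce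
  note exch = cycle_exchange[OF i z F\<Phi> T]
  have "\<exists>x. x \<in> F \<and> x \<notin> T \<and> insert t (F - {x}) \<in> \<Phi> \<and>
      om z (insert x (T - {t})) (insert t (F - {x})) \<noteq> 0" if "t \<in> T" for t
    using exch[OF that] by blast
  then obtain X where X: "\<And>t. t \<in> T \<Longrightarrow> X t \<in> F" "\<And>t. t \<in> T \<Longrightarrow> X t \<notin> T"
    "\<And>t. t \<in> T \<Longrightarrow> insert t (F - {X t}) \<in> \<Phi>"
    "\<And>t. t \<in> T \<Longrightarrow> om z (insert (X t) (T - {t})) (insert t (F - {X t})) \<noteq> 0" by metis
  have tF: "t \<notin> F" if "t \<in> T" for t using exch[OF that] by blast
  have in\<Gamma>: "insert t (F - {X t}) \<in> \<Gamma> \<and> insert t (F - {X t}) \<noteq> F" if "t \<in> T" for t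
    using \<Gamma>I[OF X(3,4)[OF that]] tF[OF that] by blast
  then have "\<Gamma> \<noteq> {F}" using t0 by (metis singletonD)
  then obtain G where G: "G \<in> \<Gamma>" "G \<noteq> F" "\<And>F'. F' \<in> \<Gamma> \<Longrightarrow> F' \<noteq> F \<Longrightarrow> F \<inter> F' \<subseteq> F \<inter> G"
    using F(2) by blast
  have "\<not> F \<subseteq> G"
  proof
    assume "F \<subseteq> G"
    moreover have "card F = card G" using G(1) \<Gamma>\<Phi> F\<Phi> card_\<Phi> by (metis subsetD)
    ultimately show False using G(2) card_subset_eq[of G F] by simp
  qed
  have sub: "F - {X t} \<subseteq> G" if "t \<in> T" for t
  proof -
    have "F \<inter> insert t (F - {X t}) \<subseteq> F \<inter> G"
      by (rule G(3)) (use in\<Gamma>[OF that] in simp_all)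
    then show ?thesis by blast
  qed
  define y where "y = X t0"
  have y: "y \<in> F" "y \<notin> T" using X(1,2)[OF t0] by (simp_all add: y_def)
  \<comment> \<open>Two different exchanged vertices would put all of \<open>F\<close> into
    \<open>G\<close>.\<close>
  have Xy: "X t = y" if "t \<in> T" for t
    using sub[OF that] sub[OF t0] \<open>\<not> F \<subseteq> G\<close> unfolding y_def by (metis Diff_iff singletonD subset_iff)
  define A where "A = F - {y}"
  have A: "y \<notin> A" "insert y A = F" using y by (auto simp: A_def)
  have "card A = d - 1" using y card_\<Phi>[OF F\<Phi>] by (simp add: A_def)
  moreover have "insert y T \<subseteq> nbr A"
    using A F\<Phi> tF X(3) Xy by (auto simp: nbr_def A_def)
  moreover have "card (insert y T) = Suc i" using y cardT by simp
  ultimately have "(A, insert y T) \<in> idx" by (simp add: idx_def)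
  moreover have "om z (insert y T - {s}) (insert s A) \<noteq> 0" if "s \<in> insert y T" for s
  proof (cases "s = y")
    case True
    then show ?thesis using T A y by simp
  next
    case False
    then have s: "s \<in> T" using that by simp
    have "insert y T - {s} = insert (X s) (T - {s})" using False Xy[OF s] by auto
    then show ?thesis using X(4)[OF s] Xy[OF s] by (simp add: A_def)
  qed
  ultimately show ?thesis by (rule that)
qed

text \<open>Induction on the number of nonzero coordinates: all coordinates of the subtracted
  \<open>cyc\<close> already occur in \<open>z\<close>, so no new ones arise, and one is
  cancelled.\<close>

lemma cyc_span:
  assumes i: "i \<ge> 1" and "z \<in> Zk (Suc i) 0"
  shows "\<exists>a. z = (\<Sum>k\<in>idx. kscale (a k) (cyc k))"
  using assms(2)
proof (induction "card {(T, F). F \<in> \<Phi> \<and> om z T F \<noteq> 0}" arbitrary: z rule: less_induct)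
  case less
  show ?case
  proof (cases "z = 0")
    case True
    have "(0 :: ('v, 'k) kchain) = (\<Sum>k\<in>idx. kscale 0 (cyc k))"
      by (simp add: kscale_def flip: zero_fun_def)
    then show ?thesis unfolding True by (rule exI[of _ "\<lambda>_. 0"])
  next
    case False
    then obtain A S where AS: "(A, S) \<in> idx"
      and nz: "\<And>s. s \<in> S \<Longrightarrow> om z (S - {s}) (insert s A) \<noteq> 0"
      using leaf_cycle[OF i less.prems] by blast
    have S: "S \<subseteq> nbr A" "card S = Suc i" using AS by (auto simp: idx_def)
    then obtain y where y: "y \<in> S" by fastforce
    then have yA: "y \<notin> A" "insert y A \<in> \<Phi>" using S by (auto simp: nbr_def)
    \<comment> \<open>The coordinate of \<open>cyc (A, S)\<close> at this place is the sign, which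
      is its own inverse.\<close>
    define c where "c = sg r y (S - {y}) * om z (S - {y}) (insert y A)"
    define z' where "z' = z - kscale c (cyc (A, S))"
    have om_z': "om z' T F = om z T F - c * om (cyc (A, S)) T F" for T F
      by (simp add: z'_def om_diff om_scale)
    have "z' \<in> Zk (Suc i) 0"
      unfolding z'_def using less.prems cyc_Zk[OF i AS] by (intro Zk_diff Zk_scale)
    moreover have "card {(T, F). F \<in> \<Phi> \<and> om z' T F \<noteq> 0} < card {(T, F). F \<in> \<Phi> \<and> om z T F \<noteq> 0}"
    proof (rule psubset_card_mono)
      have "om z T F \<noteq> 0" if "om z' T F \<noteq> 0" for T F
      proof
        assume "om z T F = 0"
        then have "om (cyc (A, S)) T F \<noteq> 0" using that by (auto simp: om_z')
        then obtain x where "x \<in> S" "T = S - {x}" "F = insert x A"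
          using S(1) by (rule om_cyc_nonzero)
        then show False using nz \<open>om z T F = 0\<close> by blast
      qed
      moreover have "om z' (S - {y}) (insert y A) = 0"
        using y yA by (simp add: om_z' om_cyc c_def sg_sq_left mult.commute mult.left_commute)
      ultimately show "{(T, F). F \<in> \<Phi> \<and> om z' T F \<noteq> 0} \<subset> {(T, F). F \<in> \<Phi> \<and> om z T F \<noteq> 0}"
        using nz[OF y] yA(2) by blast
    qed simp
    ultimately obtain a where a: "z' = (\<Sum>k\<in>idx. kscale (a k) (cyc k))"
      using less.hyps by blast
    define b where "b k = (if k = (A, S) then c else 0)" for k
    have "(\<Sum>k\<in>idx. kscale (b k) (cyc k)) = (\<Sum>k\<in>{(A, S)}. kscale (b k) (cyc k))"
      using AS by (intro sum.mono_neutral_right) (auto simp: b_def kscale_def fun_eq_iff)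
    then have b: "(\<Sum>k\<in>idx. kscale (b k) (cyc k)) = kscale c (cyc (A, S))"
      by (simp add: b_def)
    have "z = z' + kscale c (cyc (A, S))" by (simp add: z'_def)
    also have "\<dots> = (\<Sum>k\<in>idx. kscale (a k) (cyc k) + kscale (b k) (cyc k))"
      unfolding a by (simp only: sum.distrib b)
    also have "\<dots> = (\<Sum>k\<in>idx. kscale (a k + b k) (cyc k))"
      by (intro sum.cong) (auto simp: kscale_def fun_eq_iff single_add distrib_right)
    finally show ?thesis by (rule exI[of _ "\<lambda>k. a k + b k"])
  qed
qed

text \<open>If x and y differ, a vertex t of the common set, which is nonempty as
  \<open>i \<ge> 1\<close>, yields three facets inside A + x + t: those omitting t, x and y.\<close>

lemma idx_determined:
  assumes i: "i \<ge> 1" and k: "(A, S) \<in> idx" and k': "(A', S') \<in> idx"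
    and x: "x \<in> S" and y: "y \<in> S'" and eq: "S - {x} = S' - {y}" "insert x A = insert y A'"
  shows "(A, S) = (A', S')"
proof -
  have S: "S \<subseteq> nbr A" "card S = Suc i" and S': "S' \<subseteq> nbr A'"
    using k k' by (auto simp: idx_def)
  have xy: "x \<notin> A" "insert x A \<in> \<Phi>" "y \<notin> A'" using S S' x y by (auto simp: nbr_def)
  show ?thesis
  proof (cases "x = y")
    case True
    have "S = S'" using eq(1) x y True by (metis insert_Diff)
    moreover have "A = A'" using eq(2) xy(1,3) True by (metis Diff_insert_absorb)
    ultimately show ?thesis by simp
  next
    case False
    have "card (S - {x}) = i" using S(2) x by simp
    then have "S - {x} \<noteq> {}" using i by (metis card.empty not_one_le_zero)
    then obtain t where t: "t \<in> S - {x}" by blast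
    then have t': "t \<in> S' - {y}" unfolding eq(1) .
    have tA: "t \<notin> A" "insert t A \<in> \<Phi>" using t S(1) by (auto simp: nbr_def)
    have tA': "t \<notin> A'" "insert t A' \<in> \<Phi>" using t' S' by (auto simp: nbr_def)
    have tx: "t \<noteq> x" "t \<noteq> y" using t t' by simp_all
    define M where "M = insert t (insert x A)"
    have M': "M = insert t (insert y A')" unfolding M_def eq(2) ..
    have "M - {t} = insert x A" using tA(1) tx(1) by (simp add: M_def)
    then have 1: "M - {t} \<in> \<Phi>" using xy(2) by simp
    have "M - {x} = insert t A" using xy(1) tx(1) by (simp add: M_def insert_Diff_if)
    then have 2: "M - {x} \<in> \<Phi>" using tA(2) by simp
    have "M - {y} = insert t A'" using xy(3) tx(2) by (simp add: M' insert_Diff_if)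
    then have 3: "M - {y} \<in> \<Phi>" using tA'(2) by simp
    have "t \<in> M" "x \<in> M" by (simp_all add: M_def)
    moreover have "y \<in> M" by (simp add: M')
    ultimately have False using not_three_facets[OF 1 2 3] tx False by blast
    then show ?thesis ..
  qed
qed

lemma qbasis_positive:
  assumes i: "i \<ge> 1"
  shows "qbasis kscale idx cyc (Zk (Suc i) 0) (Bk (Suc i) 0)"
  unfolding qbasis_def Bk_strand
proof (intro conjI ballI allI impI)
  fix k assume "k \<in> idx"
  then show "cyc k \<in> Zk (Suc i) 0" using cyc_Zk[OF i] by (cases k) auto
next
  fix z assume "z \<in> Zk (Suc i) 0"
  then show "\<exists>a. z - (\<Sum>k\<in>idx. kscale (a k) (cyc k)) \<in> {0}" using cyc_span[OF i] by auto
next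
  fix a k assume "(\<Sum>k\<in>idx. kscale (a k) (cyc k)) \<in> {0}" and k: "k \<in> idx"
  then have zero: "(\<Sum>k\<in>idx. kscale (a k) (cyc k)) = 0" by simp
  obtain A S where AS: "k = (A, S)" by (cases k)
  have S: "S \<subseteq> nbr A" "card S = Suc i" using k AS by (auto simp: idx_def)
  then obtain y where y: "y \<in> S" by fastforce
  then have yA: "y \<notin> A" using S by (auto simp: nbr_def)
  let ?T = "S - {y}" and ?F = "insert y A"
  \<comment> \<open>By \<open>idx_determined\<close> no other basis element shares this coordinate
    with \<open>cyc k\<close>, so it isolates \<open>a k\<close>.\<close>
  have other: "om (cyc k') ?T ?F = 0" if k': "k' \<in> idx" "k' \<noteq> k" for k'
  proof (rule ccontr)
    assume nz: "om (cyc k') ?T ?F \<noteq> 0"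
    obtain A' S' where AS': "k' = (A', S')" by (cases k')
    then have "S' \<subseteq> nbr A'" using k' by (auto simp: idx_def)
    with nz obtain x where "x \<in> S'" "?T = S' - {x}" "?F = insert x A'"
      unfolding AS' by (rule om_cyc_nonzero)
    then have "(A, S) = (A', S')"
      using idx_determined[OF i, of A S A' S' y x] k k' AS AS' y by simp
    then show False using k' AS AS' by simp
  qed
  have "0 = om (\<Sum>k\<in>idx. kscale (a k) (cyc k)) ?T ?F" unfolding zero by (simp add: om_def)
  also have "\<dots> = (\<Sum>k\<in>idx. a k * om (cyc k) ?T ?F)" by (simp only: om_sum[OF finite] om_scale)
  also have "\<dots> = (\<Sum>k\<in>{k}. a k * om (cyc k) ?T ?F)"
    using k other by (intro sum.mono_neutral_right) auto
  also have "\<dots> = a k * sg r y ?T" using y yA by (simp add: AS om_cyc)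
  finally have "a k * sg r y ?T = 0" by simp
  moreover have "sg r y ?T \<noteq> (0 :: 'k)" by (rule sg_nonzero)
  ultimately show "a k = 0" by simp
qed

end

theorem theorem5p9:
  fixes \<Delta> :: "'v::finite set set" and d i :: nat
  assumes "d \<ge> 2"
    and "simplicial_complex UNIV \<Delta>"
    and "pure_complex d \<Delta>"
    and "simplicial_forest \<Delta>"
  shows "graded_betti (facet_ideal \<Delta> :: ('v, 'k::field) mpoly set) i (int (i + d)) =
    (if i = 0 then card (facets \<Delta>)
     else \<Sum>G\<in>codim1_faces d \<Delta>. face_degree \<Delta> G choose (i + 1))"
proof -
  let ?\<Phi> = "facets \<Delta>"
  let ?I = "mon_ideal ?\<Phi> :: ('v, 'k) mpoly set"
  define C where "C = (SOME C. graded_free_resolution ?I C)"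
  have C: "graded_free_resolution ?I C"
    unfolding C_def using ex_graded_free_resolution by (rule someI_ex)
  have betti: "graded_betti (facet_ideal \<Delta> :: ('v, 'k) mpoly set) i (int (i + d)) =
      tor_dim C i (int (i + d))"
    by (simp add: graded_betti_def facet_ideal_eq C_def)
  obtain r :: "'v \<Rightarrow> nat" where r: "inj r"
    using finite_imp_inj_to_nat_seg[of "UNIV :: 'v set"] by auto
  interpret leafy_koszul ?\<Phi> C r "int (i + d)" i d
  proof
    show "graded_free_resolution ?I C" by (rule C)
    show "inj r" by (rule r)
    show "int (i + d) = int i + int d" by simp
    show "d \<ge> 1" using assms(1) by simp
    show "card F = d" if "F \<in> ?\<Phi>" for F
      using assms(3) that by (simp add: pure_complex_def)
    show "\<exists>F\<in>\<Gamma>. \<Gamma> = {F} \<or> (\<exists>G\<in>\<Gamma>. G \<noteq> F \<and> (\<forall>F'\<in>\<Gamma>. F' \<noteq> F \<longrightarrow> F \<inter> F' \<subseteq> F \<inter> G))"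
      if "\<Gamma> \<subseteq> ?\<Phi>" "\<Gamma> \<noteq> {}" for \<Gamma>
      using forest_leaf[OF assms(4) that] .
  qed
  have j: "int (i + d) \<noteq> 0" using assms(1) by simp
  show ?thesis
  proof (cases "i = 0")
    case True
    then show ?thesis using qbasis_degree_0 tor_dim_eq[OF _ finite j] betti by auto
  next
    case False
    have codim: "codim1_faces d \<Delta> \<subseteq> {A. card A = d - 1}" by (auto simp: codim1_faces_def)
    have deg: "face_degree \<Delta> A = card (nbr A)" if A: "card A = d - 1" for A
    proof -
      \<comment> \<open>A facet has one vertex more than \<open>A\<close>, so the facets over
        \<open>A\<close> correspond to its neighbours.\<close>
      have "{F \<in> ?\<Phi>. A \<subseteq> F} = (\<lambda>x. insert x A) ` nbr A"
      proof (intro equalityI subsetI)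
        fix F assume F: "F \<in> {F \<in> ?\<Phi>. A \<subseteq> F}"
        then have "card (F - A) = 1"
          using A card_\<Phi>[of F] assms(1) by (subst card_Diff_subset) auto
        then obtain x where "F - A = {x}" by (auto simp: card_1_singleton_iff)
        then have "F = insert x A" "x \<notin> A" using F by auto
        then show "F \<in> (\<lambda>x. insert x A) ` nbr A" using F by (auto simp: nbr_def)
      qed (auto simp: nbr_def)
      moreover have "inj_on (\<lambda>x. insert x A) (nbr A)"
        by (auto simp: inj_on_def nbr_def)
      ultimately show ?thesis by (simp add: face_degree_def card_image)
    qed
    \<comment> \<open>\<open>idx\<close> runs through all sets of size \<open>d - 1\<close>, the sum
      in the statement only through faces; the remaining sets contribute binomials of 0 over a
      positive number.\<close>
    have zero: "nbr A = {}" if "card A = d - 1" "A \<notin> \<Delta>" for A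
    proof -
      have "insert x A \<notin> ?\<Phi>" for x
      proof
        assume "insert x A \<in> ?\<Phi>"
        then have "A \<in> \<Delta>"
          using assms(2) unfolding facets_def simplicial_complex_def by (blast intro: subset_insertI)
        then show False using that by simp
      qed
      then show ?thesis by (simp add: nbr_def)
    qed
    have "card idx = (\<Sum>A\<in>{A. card A = d - 1}. card (nbr A) choose Suc i)"
      unfolding idx_def by (subst card_SigmaI) (auto simp: n_subsets)
    also have "\<dots> = (\<Sum>A\<in>codim1_faces d \<Delta>. card (nbr A) choose Suc i)"
    proof (rule sum.mono_neutral_right[OF finite codim])
      show "\<forall>A\<in>{A. card A = d - 1} - codim1_faces d \<Delta>. card (nbr A) choose Suc i = 0"
      proof
        fix A assume "A \<in> {A. card A = d - 1} - codim1_faces d \<Delta>"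
        then have "card A = d - 1" "A \<notin> \<Delta>" by (auto simp: codim1_faces_def)
        then show "card (nbr A) choose Suc i = 0" by (simp add: zero del: One_nat_def)
      qed
    qed
    also have "\<dots> = (\<Sum>A\<in>codim1_faces d \<Delta>. face_degree \<Delta> A choose Suc i)"
      by (intro sum.cong) (auto simp: deg codim1_faces_def)
    finally show ?thesis
      using False tor_dim_eq[OF qbasis_positive finite j] betti by simp
  qed
qed

end
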